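(* The optimization problem of computing a minimum-cost $3$-diverse database is $\mathsf{NP}$-hard, even restricted to instances with a single sensitive attribute taking at most three values and all quasi-identifier attributes binary.
   Context: An instance is a database (matrix) with rows and columns (attributes), where each attribute is labeled either quasi-identifier or sensitive, giving a partition of the attributes into sets $Q$ and $S$. A database $D$ is $\ell$-diverse if for every row $u_0$ of $D$ there are at least $\ell-1$ distinct other rows $u_1,\dots,u_{\ell-1}$ of $D$ such that (1) for all $q\in Q$ and $0\le i<j<\ell$, $u_i[q]=u_j[q]$, and (2) for all $s\in S$ and $0\le i<j<\ell$, $u_i[s]\ne u_j[s]$. One may replace entries of quasi-identifier attributes by a symbol $\star$ (treated as an ordinary value for the equality in (1)); the cost of an $\ell$-diverse solution is the number of stars introduced among the attributes in $Q$, and the problem asks for an $\ell$-diverse database obtainable this way with minimum cost. *)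

theory Defs
  imports "HOL-Computational_Algebra.Polynomial"
begin

section \<open>Deterministic multi-tape Turing machines\<close>

datatype direction = Move_Left | Stay | Move_Right

text \<open>
  States are \<open>{..nstates}\<close>: computation starts in \<open>0\<close> and halts in \<open>nstates\<close>.
  Symbols are \<open>{..<nsyms}\<close>: \<open>0\<close> is the blank, \<open>1\<close> and \<open>2\<close> are the bits.
  The transition function maps a non-halting state and the list of scanned symbols to a new state
  and, for every tape, the symbol to be written and the head movement.
\<close>

record turing_machine =
  ntapes :: nat
  nstates :: nat
  nsyms :: nat
  delta :: "nat \<Rightarrow> nat list \<Rightarrow> nat \<times> (nat \<times> direction) list"

definition wf_tm :: "turing_machine \<Rightarrow> bool" where
  "wf_tm M \<longleftrightarrow> ntapes M \<ge> 1 \<and> nsyms M \<ge> 3 \<and>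
     (\<forall>q ss. q < nstates M \<and> length ss = ntapes M \<and> set ss \<subseteq> {..<nsyms M} \<longrightarrow>
        fst (delta M q ss) \<le> nstates M \<and>
        length (snd (delta M q ss)) = ntapes M \<and>
        fst ` set (snd (delta M q ss)) \<subseteq> {..<nsyms M})"

text \<open>A tape is infinite in both directions and is given by its cells and its head position.\<close>

type_synonym tape = "(int \<Rightarrow> nat) \<times> int"
type_synonym config = "nat \<times> tape list"

definition read_tape :: "tape \<Rightarrow> nat" where
  "read_tape t = fst t (snd t)"

fun offset :: "direction \<Rightarrow> int" where
  "offset Move_Left = -1"
| "offset Stay = 0"
| "offset Move_Right = 1"

definition act_tape :: "nat \<times> direction \<Rightarrow> tape \<Rightarrow> tape" where
  "act_tape a t = ((fst t)(snd t := fst a), snd t + offset (snd a))"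

definition tm_step :: "turing_machine \<Rightarrow> config \<Rightarrow> config" where
  "tm_step M c =
     (if fst c < nstates M
      then (let r = delta M (fst c) (map read_tape (snd c))
            in (fst r, map2 act_tape (snd r) (snd c)))
      else c)"

definition sym_of_bit :: "bool \<Rightarrow> nat" where
  "sym_of_bit b = (if b then 2 else 1)"

definition input_tape :: "bool list \<Rightarrow> tape" where
  "input_tape x =
     (\<lambda>i. if 0 \<le> i \<and> i < int (length x) then sym_of_bit (x ! nat i) else 0, 0)"

definition blank_tape :: tape where
  "blank_tape = (\<lambda>_. 0, 0)"

definition init_config :: "turing_machine \<Rightarrow> bool list \<Rightarrow> config" where
  "init_config M x = (0, input_tape x # replicate (ntapes M - 1) blank_tape)"

text \<open>
  The input is on the first tape. The output is read from the last tape (the same one if there is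
  only one), from cell \<open>0\<close> up to the first blank, wherever the head is.
\<close>

definition has_output :: "config \<Rightarrow> bool list \<Rightarrow> bool" where
  "has_output c y \<longleftrightarrow>
     (\<forall>j<length y. fst (last (snd c)) (int j) = sym_of_bit (y ! j)) \<and>
     fst (last (snd c)) (int (length y)) = 0"

definition computes_in_time ::
  "turing_machine \<Rightarrow> (bool list \<Rightarrow> bool list) \<Rightarrow> (nat \<Rightarrow> nat) \<Rightarrow> bool" where
  "computes_in_time M f T \<longleftrightarrow>
     (\<forall>x. \<exists>t\<le>T (length x).
        fst ((tm_step M ^^ t) (init_config M x)) = nstates M \<and>
        has_output ((tm_step M ^^ t) (init_config M x)) (f x))"


section \<open>Polynomial time, NP and NP-hardness\<close>

definition poly_time :: "(bool list \<Rightarrow> bool list) \<Rightarrow> bool" where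
  "poly_time f \<longleftrightarrow> (\<exists>M (p :: nat poly). wf_tm M \<and> computes_in_time M f (poly p))"

definition class_P :: "bool list set set" where
  "class_P = {L. poly_time (\<lambda>x. [x \<in> L])}"

definition pair :: "bool list \<Rightarrow> bool list \<Rightarrow> bool list" where
  "pair x y = concat (map (\<lambda>b. [True, b]) x) @ False # y"

definition class_NP :: "bool list set set" where
  "class_NP = {L. \<exists>V\<in>class_P. \<exists>p :: nat poly.
     \<forall>x. x \<in> L \<longleftrightarrow> (\<exists>y. length y \<le> poly p (length x) \<and> pair x y \<in> V)}"

definition optimal_solution :: "('i \<Rightarrow> 's \<Rightarrow> bool) \<Rightarrow> ('i \<Rightarrow> 's \<Rightarrow> nat) \<Rightarrow> 'i \<Rightarrow> 's \<Rightarrow> bool" where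
  "optimal_solution sol cost i y \<longleftrightarrow>
     sol i y \<and> (\<forall>z. sol i z \<longrightarrow> cost i y \<le> cost i z)"

text \<open>
  NP-hardness of a minimization problem, in the usual sense: every language in NP has a
  polynomial-time many-one reduction to the question whether the optimum of a given instance is
  at most a given budget. Every word is mapped to a legal instance, i.e. one in the set \<open>I\<close>.
  The budget is written in unary, so hardness is claimed even in this stronger form.
  An instance without solutions has no optimum and is a no-instance.
\<close>

definition np_hard_minimization ::
  "('i \<Rightarrow> bool list) \<Rightarrow> 'i set \<Rightarrow> ('i \<Rightarrow> 's \<Rightarrow> bool) \<Rightarrow> ('i \<Rightarrow> 's \<Rightarrow> nat) \<Rightarrow> bool" where
  "np_hard_minimization enc I sol cost \<longleftrightarrow>
     (\<forall>A\<in>class_NP. \<exists>f. poly_time f \<and>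
        (\<forall>x. \<exists>i\<in>I. \<exists>k. f x = pair (enc i) (replicate k True) \<and>
           (x \<in> A \<longleftrightarrow> (\<exists>y. optimal_solution sol cost i y \<and> cost i y \<le> k))))"


section \<open>Databases and diversity\<close>

datatype attribute = Quasi_Identifier | Sensitive

text \<open>
  A database consists of the labels of its columns and the list of its rows. Rows are identified by
  their positions, so equal rows may occur repeatedly.
\<close>

type_synonym 'v database = "attribute list \<times> 'v list list"

definition wf_database :: "'v database \<Rightarrow> bool" where
  "wf_database D \<longleftrightarrow> (\<forall>r\<in>set (snd D). length r = length (fst D))"

definition columns :: "attribute \<Rightarrow> 'v database \<Rightarrow> nat set" where
  "columns a D = {j. j < length (fst D) \<and> fst D ! j = a}"

definition diverse :: "nat \<Rightarrow> 'v database \<Rightarrow> bool" where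
  "diverse l D \<longleftrightarrow>
     (\<forall>r<length (snd D). \<exists>u :: nat \<Rightarrow> nat.
        u 0 = r \<and> inj_on u {..<l} \<and> u ` {..<l} \<subseteq> {..<length (snd D)} \<and>
        (\<forall>q\<in>columns Quasi_Identifier D. \<forall>i j. i < j \<and> j < l \<longrightarrow>
           snd D ! u i ! q = snd D ! u j ! q) \<and>
        (\<forall>s\<in>columns Sensitive D. \<forall>i j. i < j \<and> j < l \<longrightarrow>
           snd D ! u i ! s \<noteq> snd D ! u j ! s))"

text \<open>The star is \<^term>\<open>None\<close>; in \<^const>\<open>diverse\<close> it is compared like any other value.\<close>

definition suppression :: "'v database \<Rightarrow> 'v option database \<Rightarrow> bool" where
  "suppression D E \<longleftrightarrow>
     fst E = fst D \<and> wf_database E \<and> length (snd E) = length (snd D) \<and>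
     (\<forall>r<length (snd D). \<forall>j<length (fst D).
        snd E ! r ! j = Some (snd D ! r ! j) \<or>
        j \<in> columns Quasi_Identifier D \<and> snd E ! r ! j = None)"

definition diverse_solution :: "nat \<Rightarrow> 'v database \<Rightarrow> 'v option database \<Rightarrow> bool" where
  "diverse_solution l D E \<longleftrightarrow> suppression D E \<and> diverse l E"

definition star_cost :: "'v database \<Rightarrow> 'v option database \<Rightarrow> nat" where
  "star_cost D E =
     card {(r, j). r < length (snd D) \<and> j \<in> columns Quasi_Identifier D \<and> snd E ! r ! j = None}"

definition binary_ternary_databases :: "nat database set" where
  "binary_ternary_databases = {D. wf_database D \<and> card (columns Sensitive D) = 1 \<and>
     (\<forall>r<length (snd D).
        (\<forall>q\<in>columns Quasi_Identifier D. snd D ! r ! q \<in> {0, 1}) \<and>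
        (\<forall>s\<in>columns Sensitive D. snd D ! r ! s \<in> {0, 1, 2}))}"


section \<open>Encoding of databases as words\<close>

text \<open>
  All encodings are self-delimiting. Values are written in unary, which costs only a constant
  factor in \<open>binary_ternary_databases\<close>, where they are at most \<open>2\<close>.
\<close>

definition encode_nat :: "nat \<Rightarrow> bool list" where
  "encode_nat n = replicate n True @ [False]"

definition encode_list :: "('a \<Rightarrow> bool list) \<Rightarrow> 'a list \<Rightarrow> bool list" where
  "encode_list e xs = concat (map (\<lambda>x. True # e x) xs) @ [False]"

definition encode_attribute :: "attribute \<Rightarrow> bool list" where
  "encode_attribute a = [a = Sensitive]"

definition encode_database :: "nat database \<Rightarrow> bool list" where
  "encode_database D =
     encode_list encode_attribute (fst D) @ encode_list (encode_list encode_nat) (snd D)"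

lemma pair_inject: "pair x y = pair x' y' \<longleftrightarrow> x = x' \<and> y = y'"
proof (induction x arbitrary: x')
  case Nil
  then show ?case by (cases x') (auto simp: pair_def)
next
  case (Cons a x)
  then show ?case by (cases x') (auto simp: pair_def)
qed

lemma encode_nat_append_inject: "encode_nat m @ v = encode_nat n @ w \<longleftrightarrow> m = n \<and> v = w"
proof (induction m arbitrary: n)
  case 0
  then show ?case by (cases n) (auto simp: encode_nat_def)
next
  case (Suc m)
  then show ?case by (cases n) (auto simp: encode_nat_def)
qed

lemma encode_attribute_append_inject:
  "encode_attribute a @ v = encode_attribute b @ w \<longleftrightarrow> a = b \<and> v = w"
  by (cases a; cases b) (auto simp: encode_attribute_def)

lemma encode_list_append_inject:
  assumes "\<And>a b v w. e a @ v = e b @ w \<longleftrightarrow> a = b \<and> v = w"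
  shows "encode_list e xs @ v = encode_list e ys @ w \<longleftrightarrow> xs = ys \<and> v = w"
proof (induction xs arbitrary: ys)
  case Nil
  then show ?case by (cases ys) (auto simp: encode_list_def)
next
  case (Cons a xs)
  then show ?case by (cases ys) (auto simp: encode_list_def assms)
qed

lemma inj_encode_database: "inj encode_database"
proof (rule injI)
  fix D E assume "encode_database D = encode_database E"
  then have "fst D = fst E \<and>
      encode_list (encode_list encode_nat) (snd D) @ [] =
      encode_list (encode_list encode_nat) (snd E) @ []"
    by (simp add: encode_database_def
        encode_list_append_inject[OF encode_attribute_append_inject])
  then show "D = E"
    by (subst (asm) encode_list_append_inject[OF encode_list_append_inject[OF
          encode_nat_append_inject]]) (simp add: prod_eq_iff)
qed

end

theory Submission
  imports Defs
begin

text \<open>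
  Let a language in NP be given by a verifier. The computations of the verifier on an input and all
  certificates are the tilings of a torus: rows are time steps, a tile carries the contents of one
  tape cell together with the state and the scanned symbols, and the input enters only through the
  category of tiles that is admitted at each position.

  A tiling problem becomes a partition of a tripartite graph into triangles. Every pair
  of a position and a tile owns a ring of vertices that can be covered in two ways only.
  One of them uses no vertex outside the ring. The other one takes in all the
  elements listed for the tile. Covering every element exactly once means that the colours of
  neighbouring tiles agree.

  The rows of the database are the vertices, and the sensitive value is the part of the vertex. The
  columns are chosen such that a group of \<open>g \<ge> 3\<close> rows is not constant on exactly
  \<open>2 * n * g - e\<close> columns, where \<open>n\<close> is the number of vertices and \<open>e\<close> the number of ordered
  pairs of adjacent vertices in the group. This is at least \<open>6 * n - 6\<close>, with equality only
  for triangles.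

  The reduction is computed by a program with counters. A counter is the position of a head on a tape
  that is marked only at the origin, so such a program runs step by step on a Turing machine.
\<close>

section \<open>Counter programs\<close>

text \<open>A row pays one star for every column on which its group is not constant, so the obstacle
  is that large groups must not be cheaper per row than triangles. Since all rows have equally many
  ones and no column has more than two, the excess of a group over \<open>6 * n - 6\<close> is
  \<open>(g - 3) * (2 * n - g - 2) + (g * (g - 1) - e)\<close>. Both terms are nonnegative and they
  vanish together only for triangles. The constant is \<open>2 * n * 3\<close> minus the 6 ordered
  pairs of a triangle. The budget \<open>n * (6 * n - 6)\<close> then leaves no slack in any row.
  Starting from computations instead of another hard problem keeps the output regular: vertices are
  a fixed finite list of tags, depending on the verifier only, times a grid, and adjacency is
  decided by comparing coordinates. On a torus every position carries the same gadget; boundary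
  conditions are moved into colours and categories. The gadget is a variant of the one for
  three-dimensional matching. Here every tile covers the same number of elements and every element
  is covered once, so the vertices left over by chosen tiles can be matched with further copies of
  the elements.\<close>

datatype 'v com = Skip | Mv 'v direction | Out bool | Seq "'v com" "'v com"
  | Cond 'v nat "'v com" "'v com" | Loop 'v nat "'v com"

text \<open>The argument \<open>r\<close> gives the symbols under the heads and not the counter
  values. So the same function drives the abstract machine \<open>cstep\<close> and the transition
  table \<open>prog_delta\<close>.\<close>

fun lstep :: "'v com list \<Rightarrow> ('v \<Rightarrow> nat) \<Rightarrow> 'v com list \<times> ('v \<Rightarrow> direction) \<times> bool list" where
  "lstep [] r = ([], \<lambda>_. Stay, [])"
| "lstep (Skip # k) r = (k, \<lambda>_. Stay, [])"
| "lstep (Mv v d # k) r = (k, (\<lambda>_. Stay)(v := d), [])"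
| "lstep (Out b # k) r = (k, \<lambda>_. Stay, [b])"
| "lstep (Seq c d # k) r = (c # d # k, \<lambda>_. Stay, [])"
| "lstep (Cond v a c d # k) r = ((if r v = a then c else d) # k, \<lambda>_. Stay, [])"
| "lstep (Loop v a c # k) r = (if r v = a then k else c # Loop v a c # k, \<lambda>_. Stay, [])"

text \<open>
  A counter is the head position on a tape that is blank except for a mark in cell \<open>0\<close>, so that
  testing it for zero amounts to reading. Counter \<open>0\<close> is the head position on the input tape.
\<close>

definition base :: "bool list \<Rightarrow> nat \<Rightarrow> int \<Rightarrow> nat" where
  "base x v = (if v = 0 then fst (input_tape x) else (\<lambda>i. if i = 0 then 1 else 0))"

fun cstep :: "bool list \<Rightarrow> nat com list \<times> (nat \<Rightarrow> int) \<times> bool list \<Rightarrow>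
    nat com list \<times> (nat \<Rightarrow> int) \<times> bool list" where
  "cstep x (k, s, w) =
     (case lstep k (\<lambda>v. base x v (s v)) of (k', m, u) \<Rightarrow> (k', \<lambda>v. s v + offset (m v), w @ u))"

text \<open>Quantifying over the remaining program \<open>k\<close> and the earlier output
  \<open>u\<close> makes runs composable. A bound instead of an exact time lets the branches of a
  conditional differ in length.\<close>

definition run ::
  "bool list \<Rightarrow> nat com \<Rightarrow> (nat \<Rightarrow> int) \<Rightarrow> (nat \<Rightarrow> int) \<Rightarrow> bool list \<Rightarrow> nat \<Rightarrow> bool" where
  "run x c s s' w t \<longleftrightarrow>
     (\<forall>k u. \<exists>t'\<le>t. (cstep x ^^ t') (c # k, s, u) = (k, s', u @ w))"

lemma run_mono: "run x c s s' w t \<Longrightarrow> t \<le> t' \<Longrightarrow> run x c s s' w t'"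
  unfolding run_def by (meson le_trans)

lemma run_one:
  assumes "\<And>k u. cstep x (c # k, s, u) = (k, s', u @ w)"
  shows "run x c s s' w 2"
  unfolding run_def
proof (intro allI)
  fix k u
  show "\<exists>t'\<le>2. (cstep x ^^ t') (c # k, s, u) = (k, s', u @ w)"
    using assms by (intro exI[of _ 1]) simp
qed

lemma run_Skip: "run x Skip s s [] 2"
  by (rule run_one) simp

lemma run_Out: "run x (Out b) s s [b] 2"
  by (rule run_one) simp

lemma run_Mv: "run x (Mv v d) s (s(v := s v + offset d)) [] 2"
  by (rule run_one) (auto simp: fun_eq_iff)

lemma funpow_add_eq: "(f ^^ a) x = y \<Longrightarrow> (f ^^ b) y = z \<Longrightarrow> (f ^^ (b + a)) x = z"
  by (simp add: funpow_add)

lemma run_prefix: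
  assumes "\<And>k u. cstep x (c # k, s, u) = (c' # k, s, u)" and "run x c' s s' w t"
  shows "run x c s s' w (Suc t)"
  unfolding run_def
proof (intro allI)
  fix k u
  obtain a where a: "a \<le> t" "(cstep x ^^ a) (c' # k, s, u) = (k, s', u @ w)"
    using assms(2) unfolding run_def by blast
  have "(cstep x ^^ 1) (c # k, s, u) = (c' # k, s, u)" using assms(1) by simp
  from funpow_add_eq[OF this a(2)] a(1)
  show "\<exists>t'\<le>Suc t. (cstep x ^^ t') (c # k, s, u) = (k, s', u @ w)"
    by (intro exI[of _ "a + 1"]) simp
qed

lemma run_Seq:
  assumes "run x c s s' w t" and "run x d s' s'' w' t'"
  shows "run x (Seq c d) s s'' (w @ w') (Suc (t + t'))"
  unfolding run_def
proof (intro allI)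
  fix k u
  obtain a where a: "a \<le> t" "(cstep x ^^ a) (c # d # k, s, u) = (d # k, s', u @ w)"
    using assms(1) unfolding run_def by blast
  obtain b where b: "b \<le> t'" "(cstep x ^^ b) (d # k, s', u @ w) = (k, s'', (u @ w) @ w')"
    using assms(2) unfolding run_def by blast
  have "(cstep x ^^ 1) (Seq c d # k, s, u) = (c # d # k, s, u)" by simp
  from funpow_add_eq[OF this funpow_add_eq[OF a(2) b(2)]] a(1) b(1)
  show "\<exists>t''\<le>Suc (t + t'). (cstep x ^^ t'') (Seq c d # k, s, u) = (k, s'', u @ w @ w')"
    by (intro exI[of _ "b + a + 1"]) simp
qed

lemma run_Cond:
  assumes "run x (if base x v (s v) = a then c else d) s s' w t"
  shows "run x (Cond v a c d) s s' w (Suc t)"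
  by (rule run_prefix[OF _ assms]) simp

text \<open>\<open>S\<close> is the trace of counter states at the loop head and takes the place of
  an invariant. Every round costs one test besides the body, and the test that leaves the loop costs
  one more.\<close>

lemma run_Loop:
  assumes "\<And>i. i < n \<Longrightarrow> base x v (S i v) \<noteq> a"
    and "\<And>i. i < n \<Longrightarrow> run x c (S i) (S (Suc i)) (W i) t"
    and "base x v (S n v) = a"
  shows "run x (Loop v a c) (S 0) (S n) (concat (map W [0..<n])) (Suc (n * Suc t))"
  using assms
proof (induction n arbitrary: S W)
  case 0
  show ?case
    using 0(3) unfolding run_def by (auto intro!: exI[of _ 1])
next
  case (Suc n)
  show ?case unfolding run_def
  proof (intro allI)
    fix k u
    have IH: "run x (Loop v a c) (S 1) (S (Suc n)) (concat (map (\<lambda>i. W (Suc i)) [0..<n]))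
        (Suc (n * Suc t))"
      using Suc.IH[of "\<lambda>i. S (Suc i)" "\<lambda>i. W (Suc i)"] Suc.prems by simp
    have "base x v (S 0 v) \<noteq> a" using Suc.prems(1)[of 0] by simp
    then have 1: "(cstep x ^^ 1) (Loop v a c # k, S 0, u) = (c # Loop v a c # k, S 0, u)" by simp
    obtain p where p: "p \<le> t"
      "(cstep x ^^ p) (c # Loop v a c # k, S 0, u) = (Loop v a c # k, S 1, u @ W 0)"
      using Suc.prems(2)[of 0] unfolding run_def by auto
    obtain q where q: "q \<le> Suc (n * Suc t)"
      "(cstep x ^^ q) (Loop v a c # k, S 1, u @ W 0) =
        (k, S (Suc n), (u @ W 0) @ concat (map (\<lambda>i. W (Suc i)) [0..<n]))"
      using IH unfolding run_def by blast
    have "concat (map W [0..<Suc n]) = W 0 @ concat (map (\<lambda>i. W (Suc i)) [0..<n])"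
      by (subst upt_conv_Cons) (simp_all add: map_Suc_upt[symmetric] comp_def del: upt_Suc)
    with funpow_add_eq[OF 1 funpow_add_eq[OF p(2) q(2)]] p(1) q(1)
    show "\<exists>t'\<le>Suc (Suc n * Suc t). (cstep x ^^ t') (Loop v a c # k, S 0, u) =
        (k, S (Suc n), u @ concat (map W [0..<Suc n]))"
      by (intro exI[of _ "q + p + 1"]) simp
  qed
qed

text \<open>The continuations that occur while \<open>c\<close> runs before \<open>k\<close>; they become machine states.\<close>

primrec conts :: "'v com \<Rightarrow> 'v com list \<Rightarrow> 'v com list set" where
  "conts Skip k = {Skip # k}"
| "conts (Mv v d) k = {Mv v d # k}"
| "conts (Out b) k = {Out b # k}"
| "conts (Seq c d) k = {Seq c d # k} \<union> conts c (d # k) \<union> conts d k"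
| "conts (Cond v a c d) k = {Cond v a c d # k} \<union> conts c k \<union> conts d k"
| "conts (Loop v a c) k = {Loop v a c # k} \<union> conts c (Loop v a c # k)"

lemma finite_conts: "finite (conts c k)"
  by (induction c arbitrary: k) auto

lemma conts_self: "c # k \<in> conts c k"
  by (cases c) auto

lemma conts_nonempty: "l \<in> conts c k \<Longrightarrow> l \<noteq> []"
  by (induction c arbitrary: k) auto

text \<open>A machine whose states are the continuations of a fixed program thus never leaves a
  finite set.\<close>

lemma conts_closed: "l \<in> conts c k \<Longrightarrow> fst (lstep l r) \<in> insert k (conts c k)"
proof (induction c arbitrary: k)
  case (Seq c d)
  from Seq.prems consider "l = Seq c d # k" | "l \<in> conts c (d # k)" | "l \<in> conts d k" by auto
  then show ?case
    by cases (use Seq.IH(1)[of "d # k"] Seq.IH(2)[of k] conts_self[of c "d # k"]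
      conts_self[of d k] in auto)
next
  case (Cond v a c d)
  from Cond.prems consider "l = Cond v a c d # k" | "l \<in> conts c k" | "l \<in> conts d k" by auto
  then show ?case
    by cases (use Cond.IH(1)[of k] Cond.IH(2)[of k] conts_self[of c k] conts_self[of d k] in auto)
next
  case (Loop v a c)
  from Loop.prems consider "l = Loop v a c # k" | "l \<in> conts c (Loop v a c # k)" by auto
  then show ?case
    by cases (use Loop.IH[of "Loop v a c # k"] conts_self[of c "Loop v a c # k"] in auto)
qed auto

lemma set_conts: "l \<in> conts c k \<Longrightarrow> e \<in> set l \<Longrightarrow> e \<in> set k \<or> set_com e \<subseteq> set_com c"
  by (induction c arbitrary: k) fastforce+

lemma finite_set_com: "finite (set_com c)"
  by (induction c) auto

lemma lstep_cong:
  assumes "\<And>e v. e \<in> set k \<Longrightarrow> v \<in> set_com e \<Longrightarrow> r v = r' v"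
  shows "lstep k r = lstep k r'"
proof (cases "(k, r)" rule: lstep.cases)
  case (6 v a c d k' _)
  then show ?thesis using assms[of "Cond v a c d" v] by simp
next
  case (7 v a c k' _)
  then show ?thesis using assms[of "Loop v a c" v] by simp
qed simp_all

lemma lstep_output: "snd (snd (lstep k r)) = [] \<or> (\<exists>b. snd (snd (lstep k r)) = [b])"
  by (cases "(k, r)" rule: lstep.cases) auto

text \<open>Tapes \<open>0..<n\<close> are the counters and tape \<open>n\<close> is the output. All
  tapes but the input start blank, so the extra state \<open>0\<close> spends one step on writing
  the marks at the origins of tapes \<open>1..<n\<close>.\<close>

definition prog_delta ::
  "nat com list set \<Rightarrow> (nat com list \<Rightarrow> nat) \<Rightarrow> nat com \<Rightarrow> nat \<Rightarrow> nat \<Rightarrow> nat list \<Rightarrow>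
    nat \<times> (nat \<times> direction) list" where
  "prog_delta Q h c n q ss =
     (if q = 0 then (h [c], map (\<lambda>v. (if v = 0 \<or> v = n then ss ! v else 1, Stay)) [0..<Suc n])
      else case lstep (inv_into Q h q) (\<lambda>v. ss ! v) of (k, m, u) \<Rightarrow>
        (h k, map (\<lambda>v. (ss ! v, m v)) [0..<n] @
          [if u = [] then (ss ! n, Stay) else (sym_of_bit (hd u), Move_Right)]))"

definition prog_config ::
  "bool list \<Rightarrow> (nat com list \<Rightarrow> nat) \<Rightarrow> nat \<Rightarrow> nat com list \<times> (nat \<Rightarrow> int) \<times> bool list \<Rightarrow> config"
  where
  "prog_config x h n C =
     (case C of (k, s, w) \<Rightarrow>
        (h k, map (\<lambda>v. (base x v, s v)) [0..<n] @ [(fst (input_tape w), int (length w))]))"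

text \<open>The output tape is described as the input tape of the word written so far; this is the
  step that appends a bit.\<close>

lemma input_tape_snoc:
  "(fst (input_tape w))(int (length w) := sym_of_bit b) = fst (input_tape (w @ [b]))"
  by (auto simp: input_tape_def fun_eq_iff nth_append nat_less_iff)

text \<open>Each program step is one machine step. The summand \<open>1\<close> in the final bound
  pays for the step that writes the marks.\<close>

lemma run_poly_time:
  fixes q :: "nat poly"
  assumes c: "\<And>x. run x c (\<lambda>_. 0) (s' x) (f x) (poly q (length x))"
  shows "poly_time f"
proof -
  define Q where "Q = conts c []"
  have finQ: "finite Q" unfolding Q_def by (rule finite_conts)
  obtain h0 where h0: "bij_betw h0 Q {0..<card Q}"
    using ex_bij_betw_finite_nat[OF finQ] by blast
  \<comment> \<open>Number \<open>0\<close> is spared for the initialising state, and the empty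
    continuation gets the largest number, which is the halting state.\<close>
  define h where "h k = (if k = [] then Suc (card Q) else Suc (h0 k))" for k
  have ne: "k \<noteq> []" if "k \<in> Q" for k using conts_nonempty that unfolding Q_def by blast
  have h0_less: "h0 k < card Q" if "k \<in> Q" for k
    using bij_betwE[OF h0] that by simp
  have h_pos: "0 < h k" for k by (simp add: h_def)
  have h_less: "h k < Suc (card Q)" if "k \<in> Q" for k
    using that ne h0_less unfolding h_def by simp
  have h_le: "h k \<le> Suc (card Q)" if "k \<in> insert [] Q" for k
    using that h_less[of k] by (auto simp: h_def)
  have inj: "inj_on h Q"
    using h0 ne unfolding h_def bij_betw_def inj_on_def by auto
  have img: "h ` Q = {1..<Suc (card Q)}"
  proof -
    have "h ` Q = Suc ` (h0 ` Q)" unfolding image_image using ne by (intro image_cong) (auto simp: h_def)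
    then show ?thesis using h0 by (simp add: bij_betw_def image_Suc_atLeastLessThan)
  qed
  obtain n0 where n0: "set_com c \<subseteq> {..<n0}"
    using finite_nat_bounded[OF finite_set_com[of c]] by (auto intro: that)
  \<comment> \<open>The successor ensures that the input tape \<open>0\<close> and the output tape
    \<open>n\<close> are different.\<close>
  define n where "n = Suc n0"
  have n: "set_com c \<subseteq> {..<n}" "0 < n" using n0 unfolding n_def by auto
  define M where "M = \<lparr>ntapes = Suc n, nstates = Suc (card Q), nsyms = 3,
      delta = prog_delta Q h c n\<rparr>"
  have cQ: "[c] \<in> Q" unfolding Q_def by (rule conts_self)
  have closed: "fst (lstep k r) \<in> insert [] Q" if "k \<in> Q" for k r
    using conts_closed that unfolding Q_def by blast
  have wf: "wf_tm M"
  proof -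
    have "fst (prog_delta Q h c n p ss) \<le> Suc (card Q) \<and>
        length (snd (prog_delta Q h c n p ss)) = Suc n \<and>
        fst ` set (snd (prog_delta Q h c n p ss)) \<subseteq> {..<3}"
      if p: "p < Suc (card Q)" and ss: "length ss = Suc n" "set ss \<subseteq> {..<3}" for p ss
    proof -
      have nth: "ss ! v < 3" if "v \<le> n" for v
        using ss that nth_mem[of v ss] by (auto simp: subset_eq)
      show ?thesis
      proof (cases "p = 0")
        case True
        then show ?thesis using h_le[of "[c]"] cQ nth by (auto simp: prog_delta_def)
      next
        case False
        then have "p \<in> h ` Q" using p img by auto
        then have "inv_into Q h p \<in> Q" by (rule inv_into_into)
        from closed[OF this] show ?thesis
          using False h_le nth by (auto simp: prog_delta_def sym_of_bit_def split: prod.splits)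
            (metis fst_conv insertI1 insertI2 insertE)+
      qed
    qed
    then show ?thesis unfolding wf_tm_def M_def by simp
  qed
  have step: "tm_step M (prog_config x h n C) = prog_config x h n (cstep x C)"
    if "fst C \<in> Q" for x C
  proof -
    obtain k s w where C: "C = (k, s, w)" by (cases C)
    have k: "k \<in> Q" using that C by simp
    define ss where "ss = map read_tape (snd (prog_config x h n C))"
    have ss: "ss ! v = base x v (s v)" if "v < n" for v
      unfolding ss_def prog_config_def C using that by (simp add: read_tape_def nth_append)
    have ssn: "ss ! n = fst (input_tape w) (int (length w))"
      unfolding ss_def prog_config_def C by (simp add: read_tape_def nth_append)
    have "lstep k (\<lambda>v. ss ! v) = lstep k (\<lambda>v. base x v (s v))"
      using set_conts[of k c "[]"] k n ss unfolding Q_def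
      by (intro lstep_cong) auto
    moreover obtain k' m u where l: "lstep k (\<lambda>v. base x v (s v)) = (k', m, u)"
      by (cases "lstep k (\<lambda>v. base x v (s v))")
    moreover have "inv_into Q h (h k) = k" using inj k by simp
    moreover have hk: "0 < h k" "h k < Suc (card Q)" using h_pos h_less k by auto
    ultimately have d: "prog_delta Q h c n (h k) ss = (h k', map (\<lambda>v. (ss ! v, m v)) [0..<n] @
          [if u = [] then (ss ! n, Stay) else (sym_of_bit (hd u), Move_Right)])"
      by (simp add: prog_delta_def)
    have fst: "fst (prog_config x h n C) = h k" by (simp add: prog_config_def C)
    have u: "u = [] \<or> (\<exists>b. u = [b])" using lstep_output[of k "\<lambda>v. base x v (s v)"] l by simp
    have m2: "map2 act_tape (map (\<lambda>v. (ss ! v, m v)) [0..<n]) (map (\<lambda>v. (base x v, s v)) [0..<n])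
        = map (\<lambda>v. (base x v, s v + offset (m v))) [0..<n]"
      by (intro nth_equalityI) (auto simp: act_tape_def ss)
    show ?thesis
      unfolding tm_step_def fst
      using hk u d l
      by (auto simp: M_def ss_def[symmetric] Let_def)
        (auto simp: prog_config_def C m2 act_tape_def ssn input_tape_snoc)
  qed
  have "\<exists>t\<le>poly (q + 1) (length x).
        fst ((tm_step M ^^ t) (init_config M x)) = nstates M \<and>
        has_output ((tm_step M ^^ t) (init_config M x)) (f x)" for x
  proof -
    define C0 :: "nat com list \<times> (nat \<Rightarrow> int) \<times> bool list" where "C0 = ([c], \<lambda>_. 0, [])"
    have init: "tm_step M (init_config M x) = prog_config x h n C0"
    proof -
      have "map2 act_tape
          (map (\<lambda>v. (if v = 0 \<or> v = n
              then map read_tape (input_tape x # replicate n blank_tape) ! v else 1, Stay)) [0..<Suc n])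
          (input_tape x # replicate n blank_tape) =
        map (\<lambda>v. (base x v, 0)) [0..<n] @ [(fst (input_tape []), 0)]" (is "?l = ?r")
      proof (intro nth_equalityI)
        fix i assume "i < length ?l"
        then have i: "i < Suc n" by simp
        show "?l ! i = ?r ! i"
          using i n(2)
          by (cases i) (auto simp: act_tape_def read_tape_def base_def blank_tape_def input_tape_def
              nth_append nth_Cons' fun_eq_iff simp del: upt_Suc)
      qed simp
      then show ?thesis
        by (simp add: tm_step_def init_config_def M_def prog_delta_def prog_config_def C0_def Let_def
            del: upt_Suc list.map map_replicate)
    qed
    obtain t where t: "t \<le> poly q (length x)" "(cstep x ^^ t) C0 = ([], s' x, f x)"
      using c[of x] unfolding run_def C0_def by (metis append_Nil)
    have "\<exists>t'\<le>t. (tm_step M ^^ t') (prog_config x h n C0) = prog_config x h n ([], s' x, f x)"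
    proof -
      \<comment> \<open>Only \<open>t' \<le> i\<close> is claimed: once the continuation is empty,
        \<open>cstep\<close> idles and \<open>step\<close> no longer applies.\<close>
      have main: "fst ((cstep x ^^ i) C0) \<in> insert [] Q \<and>
        (\<exists>t'\<le>i. (tm_step M ^^ t') (prog_config x h n C0) = prog_config x h n ((cstep x ^^ i) C0))" for i
      proof (induction i)
        case 0
        then show ?case using cQ by (auto simp: C0_def)
      next
        case (Suc i)
        then obtain t' where t': "t' \<le> i"
          "(tm_step M ^^ t') (prog_config x h n C0) = prog_config x h n ((cstep x ^^ i) C0)" by blast
        obtain k s w where C: "(cstep x ^^ i) C0 = (k, s, w)" by (cases "(cstep x ^^ i) C0")
        show ?case
        proof (cases "k = []")
          case True
          then have "(cstep x ^^ Suc i) C0 = (cstep x ^^ i) C0" using C by simp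
          then show ?thesis using Suc by (metis le_SucI)
        next
          case False
          then have kQ: "k \<in> Q" using Suc C by simp
          have "(tm_step M ^^ Suc t') (prog_config x h n C0) = prog_config x h n ((cstep x ^^ Suc i) C0)"
            using t' step[of "(cstep x ^^ i) C0" x] kQ C by simp
          moreover have "fst ((cstep x ^^ Suc i) C0) \<in> insert [] Q"
            using C closed[OF kQ, of "\<lambda>v. base x v (s v)"] by (auto split: prod.splits)
          ultimately show ?thesis using t'(1) by (intro conjI exI[of _ "Suc t'"]) auto
        qed
      qed
      show ?thesis using main[of t] t(2) by simp
    qed
    then obtain t' where t': "t' \<le> t"
      "(tm_step M ^^ t') (prog_config x h n C0) = prog_config x h n ([], s' x, f x)" by blast
    then have "(tm_step M ^^ Suc t') (init_config M x) = prog_config x h n ([], s' x, f x)"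
      using init by (simp add: funpow_swap1)
    moreover have "has_output (prog_config x h n ([], s' x, f x)) (f x)"
      by (simp add: has_output_def prog_config_def input_tape_def)
    moreover have "fst (prog_config x h n ([], s' x, f x)) = nstates M"
      by (simp add: prog_config_def M_def h_def)
    ultimately show ?thesis using t(1) t'(1) by (intro exI[of _ "Suc t'"]) simp
  qed
  then have "computes_in_time M f (poly (q + 1))" unfolding computes_in_time_def by blast
  then show ?thesis using wf unfolding poly_time_def by blast
qed

section \<open>Functions and words computed by counter programs\<close>

lemma poly_nat_mono: "a \<le> b \<Longrightarrow> poly p a \<le> poly p b" for p :: "nat poly"
  by (induction p) (auto intro: add_mono mult_mono)

lemma base_counter: "0 < v \<Longrightarrow> base x v i = (if i = 0 then 1 else 0)"
  by (simp add: base_def)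

lemma run_Mv_eq: "s' = s(v := s v + offset d) \<Longrightarrow> run x (Mv v d) s s' [] 2"
  using run_Mv by simp

lemma run_Mv2:
  assumes "s' = s(v := s v + offset d, v' := (s(v := s v + offset d)) v' + offset d')"
  shows "run x (Seq (Mv v d) (Mv v' d')) s s' [] 5"
  using run_Seq[OF run_Mv run_Mv_eq[OF assms]] by simp

lemma run_Mv3:
  assumes "s' = s(v := s v + offset d, v' := (s(v := s v + offset d)) v' + offset d',
      v'' := (s(v := s v + offset d, v' := (s(v := s v + offset d)) v' + offset d')) v'' + offset d'')"
  shows "run x (Seq (Mv v d) (Seq (Mv v' d') (Mv v'' d''))) s s' [] 8"
  using run_Seq[OF run_Mv run_Mv2[OF assms]] by simp

lemma run_Seq_silent:
  "run x c s s' [] t \<Longrightarrow> run x d s' s'' [] t' \<Longrightarrow> run x (Seq c d) s s'' [] (Suc (t + t'))"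
  using run_Seq[of x c s s' "[]" t d s'' "[]" t'] by simp

lemma run_Loop_silent:
  assumes "s = S 0" and "s' = S n"
    and "\<And>i. i < n \<Longrightarrow> base x v (S i v) \<noteq> a"
    and "\<And>i. i < n \<Longrightarrow> run x c (S i) (S (Suc i)) [] t"
    and "base x v (S n v) = a"
  shows "run x (Loop v a c) s s' [] (Suc (n * Suc t))"
proof -
  have "concat (map (\<lambda>_. []) [0..<n]) = ([] :: bool list)" by simp
  then show ?thesis using run_Loop[of n x v S a c "\<lambda>_. []" t] assms by metis
qed

section \<open>Clearing, moving and copying counters\<close>

definition clear :: "nat \<Rightarrow> nat com" where
  "clear v = Loop v 1 (Mv v Move_Left)"

lemma run_clear:
  assumes "s v = int a" and "0 < v"
  shows "run x (clear v) s (s(v := 0)) [] (Suc (a * 3))"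
proof -
  have "run x (clear v) s (s(v := 0)) [] (Suc (a * Suc 2))" unfolding clear_def
    by (rule run_Loop_silent[where S = "\<lambda>i. s(v := int a - int i)"])
      (use assms in \<open>auto simp: base_counter fun_eq_iff intro!: run_Mv_eq\<close>)
  then show ?thesis by simp
qed

definition transfer :: "nat \<Rightarrow> nat \<Rightarrow> nat com" where
  "transfer v u = Loop v 1 (Seq (Mv v Move_Left) (Mv u Move_Right))"

lemma run_transfer:
  assumes "s v = int a" and "0 < v" and "u \<noteq> v"
  shows "run x (transfer v u) s (s(v := 0, u := s u + int a)) [] (Suc (a * 6))"
proof -
  have "run x (transfer v u) s (s(v := 0, u := s u + int a)) [] (Suc (a * Suc 5))"
    unfolding transfer_def
    by (rule run_Loop_silent[where S = "\<lambda>i. s(v := int a - int i, u := s u + int i)"])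
      (use assms in \<open>auto simp: base_counter fun_eq_iff intro!: run_Mv2\<close>)
  then show ?thesis by simp
qed

text \<open>The second target \<open>e\<close> receives a copy from which \<open>v\<close> can be
  restored. The direction is a parameter because \<open>u\<close> may also be the input head, which
  has to be moved out and back.\<close>

definition transfer2 :: "nat \<Rightarrow> nat \<Rightarrow> direction \<Rightarrow> nat \<Rightarrow> nat com" where
  "transfer2 v u d e = Loop v 1 (Seq (Mv v Move_Left) (Seq (Mv u d) (Mv e Move_Right)))"

lemma run_transfer2:
  assumes "s v = int a" and "0 < v" and "u \<noteq> v" and "e \<noteq> v" and "u \<noteq> e"
  shows "run x (transfer2 v u d e) s
    (s(v := 0, u := s u + int a * offset d, e := s e + int a)) [] (Suc (a * 9))"
proof -
  have "run x (transfer2 v u d e) s (s(v := 0, u := s u + int a * offset d, e := s e + int a)) []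
      (Suc (a * Suc 8))"
    unfolding transfer2_def
    by (rule run_Loop_silent[where
            S = "\<lambda>i. s(v := int a - int i, u := s u + int i * offset d, e := s e + int i)"])
      (use assms in \<open>auto simp: base_counter fun_eq_iff algebra_simps
          intro!: run_Mv3\<close>)
  then show ?thesis by simp
qed

definition add_copy :: "nat \<Rightarrow> nat \<Rightarrow> nat \<Rightarrow> nat com" where
  "add_copy v u e = Seq (transfer2 v u Move_Right e) (transfer e v)"

lemma run_add_copy:
  assumes "s v = int a" and "s e = 0" and "0 < v" and "0 < e" and "u \<noteq> v" and "e \<noteq> v" and "u \<noteq> e"
  shows "run x (add_copy v u e) s (s(u := s u + int a)) [] (a * 15 + 3)"
proof -
  let ?s = "s(v := 0, u := s u + int a * offset Move_Right, e := s e + int a)"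
  have "run x (transfer e v) ?s (?s(e := 0, v := ?s v + int a)) [] (Suc (a * 6))"
    using assms by (intro run_transfer) auto
  moreover have "?s(e := 0, v := ?s v + int a) = s(u := s u + int a)"
    using assms by (auto simp: fun_eq_iff)
  ultimately have "run x (add_copy v u e) s (s(u := s u + int a)) []
      (Suc (Suc (a * 9) + Suc (a * 6)))"
    unfolding add_copy_def using assms by (intro run_Seq_silent[OF run_transfer2]) auto
  then show ?thesis by (rule run_mono) simp
qed

text \<open>
  In \<open>st xs\<close> the counters below \<open>length xs\<close> hold the variables and the others are zero, hence
  available as scratch space. Variable \<open>0\<close> is the input head and always \<open>0\<close>.
\<close>

definition st :: "nat list \<Rightarrow> nat \<Rightarrow> int" where
  "st xs v = (if v < length xs then int (xs ! v) else 0)"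

lemma st_snoc: "st (xs @ [a]) = (st xs)(length xs := int a)"
  by (auto simp: st_def fun_eq_iff nth_append)

lemma st_free: "length xs \<le> v \<Longrightarrow> st xs v = 0"
  by (simp add: st_def)

text \<open>\<open>m\<close> is the one size parameter for all time bounds: it dominates the input
  length and all variables.\<close>

definition env :: "nat \<Rightarrow> bool list \<Rightarrow> nat \<Rightarrow> nat list \<Rightarrow> bool" where
  "env d x m xs \<longleftrightarrow> length xs = d \<and> 0 < d \<and> xs ! 0 = 0 \<and> length x \<le> m \<and> (\<forall>v\<in>set xs. v \<le> m)"

lemma env_snoc: "env d x m xs \<Longrightarrow> m \<le> m' \<Longrightarrow> a \<le> m' \<Longrightarrow> env (Suc d) x m' (xs @ [a])"
  by (auto simp: env_def nth_append)

lemma env_mono: "env d x m xs \<Longrightarrow> m \<le> m' \<Longrightarrow> env d x m' xs"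
  by (auto simp: env_def)

text \<open>The variables form a stack and the result is pushed on top. Its value has to be
  polynomially bounded as well, because later programs take time proportional to unary
  counters.\<close>

definition computes :: "nat \<Rightarrow> (bool list \<Rightarrow> nat list \<Rightarrow> nat) \<Rightarrow> bool" where
  "computes d f \<longleftrightarrow> (\<exists>c (q :: nat poly). \<forall>x xs m. env d x m xs \<longrightarrow>
     run x c (st xs) (st (xs @ [f x xs])) [] (poly q m) \<and> f x xs \<le> poly q m)"

lemma computesI:
  fixes q :: "nat poly"
  assumes "\<And>x xs m. env d x m xs \<Longrightarrow>
     run x c (st xs) (st (xs @ [f x xs])) [] (poly q m) \<and> f x xs \<le> poly q m"
  shows "computes d f"
  using assms unfolding computes_def by blast

text \<open>Evaluation as on a stack machine: \<open>f\<close> is pushed, \<open>g\<close> is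
  evaluated one level higher, and \<open>P\<close> replaces the two top entries by the
  result.\<close>

lemma computes_binop:
  fixes r :: "nat poly"
  assumes f: "computes d f" and g: "computes (Suc d) g"
    and P: "\<And>x xs m a b. env d x m xs \<Longrightarrow> a \<le> m \<Longrightarrow> b \<le> m \<Longrightarrow>
      run x P (st (xs @ [a, b])) (st (xs @ [h x a b])) [] (poly r m) \<and> h x a b \<le> poly r m"
  shows "computes d (\<lambda>x xs. h x (f x xs) (g x (xs @ [f x xs])))"
proof -
  obtain c1 q1 where 1: "\<And>x xs m. env d x m xs \<Longrightarrow>
     run x c1 (st xs) (st (xs @ [f x xs])) [] (poly q1 m) \<and> f x xs \<le> poly q1 m"
    using f unfolding computes_def by blast
  obtain c2 q2 where 2: "\<And>x xs m. env (Suc d) x m xs \<Longrightarrow>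
     run x c2 (st xs) (st (xs @ [g x xs])) [] (poly q2 m) \<and> g x xs \<le> poly q2 m"
    using g unfolding computes_def by blast
  \<comment> \<open>\<open>?p1\<close> bounds the size parameter after the first push,
    \<open>?p2\<close> after the second. Composing with them expresses the later time bounds in the
    original \<open>m\<close>.\<close>
  let ?p1 = "[:0, 1:] + q1"
  let ?p2 = "?p1 + pcompose q2 ?p1"
  show ?thesis
  proof (rule computesI[where c = "Seq c1 (Seq c2 P)"
        and q = "q1 + (pcompose q2 ?p1 + pcompose r ?p2 + 2)"])
    fix x xs m assume e: "env d x m xs"
    let ?a = "f x xs" and ?b = "g x (xs @ [f x xs])"
    have e1: "env (Suc d) x (poly ?p1 m) (xs @ [?a])"
      using env_snoc[OF e, of "poly ?p1 m" ?a] 1[OF e] by simp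
    have a: "?a \<le> poly ?p2 m" and m: "m \<le> poly ?p2 m" using 1[OF e] by auto
    have b: "?b \<le> poly ?p2 m" using 2[OF e1] by (simp add: poly_pcompose)
    have r: "run x P (st (xs @ [?a, ?b])) (st (xs @ [h x ?a ?b])) [] (poly r (poly ?p2 m))"
      "h x ?a ?b \<le> poly r (poly ?p2 m)"
      using P[OF env_mono[OF e m] a b] by auto
    have "run x (Seq c1 (Seq c2 P)) (st xs) (st (xs @ [h x ?a ?b])) []
        (Suc (poly q1 m + Suc (poly q2 (poly ?p1 m) + poly r (poly ?p2 m))))"
      using 1[OF e] 2[OF e1] r by (intro run_Seq_silent) auto
    then show "run x (Seq c1 (Seq c2 P)) (st xs) (st (xs @ [h x ?a ?b])) []
        (poly (q1 + (pcompose q2 ?p1 + pcompose r ?p2 + 2)) m) \<and>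
        h x ?a ?b \<le> poly (q1 + (pcompose q2 ?p1 + pcompose r ?p2 + 2)) m"
      using r(2) by (auto simp: poly_pcompose elim!: run_mono)
  qed
qed

lemma computes_unop:
  fixes r :: "nat poly"
  assumes f: "computes d f"
    and P: "\<And>x xs m a. env d x m xs \<Longrightarrow> a \<le> m \<Longrightarrow>
      run x P (st (xs @ [a])) (st (xs @ [h x a])) [] (poly r m) \<and> h x a \<le> poly r m"
  shows "computes d (\<lambda>x xs. h x (f x xs))"
proof -
  obtain c1 q1 where 1: "\<And>x xs m. env d x m xs \<Longrightarrow>
     run x c1 (st xs) (st (xs @ [f x xs])) [] (poly q1 m) \<and> f x xs \<le> poly q1 m"
    using f unfolding computes_def by blast
  let ?p1 = "[:0, 1:] + q1"
  show ?thesis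
  proof (rule computesI[where c = "Seq c1 P" and q = "q1 + (pcompose r ?p1 + 1)"])
    fix x xs m assume e: "env d x m xs"
    let ?a = "f x xs"
    have a: "?a \<le> poly ?p1 m" and m: "m \<le> poly ?p1 m" using 1[OF e] by auto
    have r: "run x P (st (xs @ [?a])) (st (xs @ [h x ?a])) [] (poly r (poly ?p1 m))"
      "h x ?a \<le> poly r (poly ?p1 m)"
      using P[OF env_mono[OF e m] a] by auto
    have "run x (Seq c1 P) (st xs) (st (xs @ [h x ?a])) []
        (Suc (poly q1 m + poly r (poly ?p1 m)))"
      using 1[OF e] r by (intro run_Seq_silent) auto
    then show "run x (Seq c1 P) (st xs) (st (xs @ [h x ?a])) []
        (poly (q1 + (pcompose r ?p1 + 1)) m) \<and> h x ?a \<le> poly (q1 + (pcompose r ?p1 + 1)) m"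
      using r(2) by (auto simp: poly_pcompose elim!: run_mono)
  qed
qed

text \<open>
  \<open>calc d\<close> describes functions that depend on the first \<open>d\<close> variables only, so that they can also
  be computed when further variables are in use.
\<close>

definition calc :: "nat \<Rightarrow> (bool list \<Rightarrow> nat list \<Rightarrow> nat) \<Rightarrow> bool" where
  "calc d f \<longleftrightarrow> 0 < d \<and> (\<forall>x xs ys. d \<le> length xs \<longrightarrow> f x (xs @ ys) = f x xs) \<and>
     (\<forall>e\<ge>d. computes e f)"

lemma calc_pos: "calc d f \<Longrightarrow> 0 < d"
  by (simp add: calc_def)

lemma computes_cong:
  assumes "computes d f" and "\<And>x xs. length xs = d \<Longrightarrow> f x xs = g x xs"
  shows "computes d g"
proof -
  from assms(1) obtain c q where "\<And>x xs m. env d x m xs \<Longrightarrow>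
     run x c (st xs) (st (xs @ [f x xs])) [] (poly q m) \<and> f x xs \<le> poly q m"
    unfolding computes_def by blast
  then show ?thesis using assms(2) by (intro computesI[of d c g q]) (auto simp: env_def)
qed

text \<open>While \<open>g\<close> is computed the value of \<open>f\<close> is already on the
  stack; a \<open>calc\<close> function does not see it, so both may be stated over the same
  variables.\<close>

lemma calc_binop:
  fixes r :: "nat \<Rightarrow> nat poly"
  assumes f: "calc d f" and g: "calc d g"
    and P: "\<And>e x xs m a b. env e x m xs \<Longrightarrow> a \<le> m \<Longrightarrow> b \<le> m \<Longrightarrow>
      run x (P e) (st (xs @ [a, b])) (st (xs @ [h x a b])) [] (poly (r e) m) \<and>
      h x a b \<le> poly (r e) m"
  shows "calc d (\<lambda>x xs. h x (f x xs) (g x xs))"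
  unfolding calc_def
proof (intro conjI allI impI)
  show "0 < d" using f by (simp add: calc_def)
  show "h x (f x (xs @ ys)) (g x (xs @ ys)) = h x (f x xs) (g x xs)" if "d \<le> length xs" for x xs ys
    using f g that by (simp add: calc_def)
  show "computes e (\<lambda>x xs. h x (f x xs) (g x xs))" if "d \<le> e" for e
  proof (rule computes_cong[of e "\<lambda>x xs. h x (f x xs) (g x (xs @ [f x xs]))"])
    show "computes e (\<lambda>x xs. h x (f x xs) (g x (xs @ [f x xs])))"
    proof (rule computes_binop[where P = "P e" and r = "r e" and h = h and f = f and g = g])
      show "computes e f" using f that by (simp add: calc_def)
      show "computes (Suc e) g" using g that by (simp add: calc_def)
    qed (use P in blast)
  qed (use g that in \<open>auto simp: calc_def\<close>)
qed

lemma calc_unop: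
  fixes r :: "nat \<Rightarrow> nat poly"
  assumes f: "calc d f"
    and P: "\<And>e x xs m a. env e x m xs \<Longrightarrow> a \<le> m \<Longrightarrow>
      run x (P e) (st (xs @ [a])) (st (xs @ [h x a])) [] (poly (r e) m) \<and> h x a \<le> poly (r e) m"
  shows "calc d (\<lambda>x xs. h x (f x xs))"
  unfolding calc_def
proof (intro conjI allI impI)
  show "0 < d" using f by (simp add: calc_def)
  show "h x (f x (xs @ ys)) = h x (f x xs)" if "d \<le> length xs" for x xs ys
    using f that by (simp add: calc_def)
  show "computes e (\<lambda>x xs. h x (f x xs))" if "d \<le> e" for e
  proof (rule computes_unop[where P = "P e" and r = "r e" and h = h and f = f])
    show "computes e f" using f that by (simp add: calc_def)
  qed (use P in blast)
qed

section \<open>Variables, arithmetic and access to the input\<close>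

lemma calc_var:
  assumes "0 < j" and "j < d"
  shows "calc d (\<lambda>x xs. xs ! j)"
proof -
  have "computes e (\<lambda>x xs. xs ! j)" if "d \<le> e" for e
  proof (rule computesI[where c = "add_copy j e (Suc e)" and q = "[:3, 15:]"])
    fix x xs m assume e: "env e x m xs"
    then have len: "length xs = e" and le: "xs ! j \<le> m" using assms that by (auto simp: env_def)
    have "run x (add_copy j e (Suc e)) (st xs) ((st xs)(e := st xs e + int (xs ! j))) []
        (xs ! j * 15 + 3)"
      using assms that len by (intro run_add_copy) (auto simp: st_def)
    then show "run x (add_copy j e (Suc e)) (st xs) (st (xs @ [xs ! j])) [] (poly [:3, 15:] m) \<and>
        xs ! j \<le> poly [:3, 15:] m"
      using len le by (auto simp: st_snoc st_free elim!: run_mono)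
  qed
  then show ?thesis using assms by (auto simp: calc_def nth_append)
qed

lemma calc_zero: "0 < d \<Longrightarrow> calc d (\<lambda>x xs. 0)"
proof -
  have "computes e (\<lambda>x xs. 0)" for e
  proof (rule computesI[where c = Skip and q = "[:2:]"])
    fix x xs m assume "env e x m xs"
    then have "st (xs @ [0]) = st xs" by (auto simp: st_snoc st_free fun_eq_iff)
    then show "run x Skip (st xs) (st (xs @ [0])) [] (poly [:2:] m) \<and> 0 \<le> poly [:2:] m"
      using run_Skip by simp
  qed
  then show "0 < d \<Longrightarrow> calc d (\<lambda>x xs. 0)" by (simp add: calc_def)
qed

lemma calc_Suc:
  assumes "calc d f"
  shows "calc d (\<lambda>x xs. Suc (f x xs))"
proof (rule calc_unop[OF assms, where h = "\<lambda>x a. Suc a" and P = "\<lambda>e. Mv e Move_Right"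
      and r = "\<lambda>e. [:2, 1:]"])
  fix e x xs m a assume "env e x m xs" "a \<le> m"
  moreover from this have "run x (Mv e Move_Right) (st (xs @ [a])) (st (xs @ [Suc a])) [] 2"
    by (intro run_Mv_eq) (auto simp: st_snoc env_def fun_eq_iff)
  ultimately show "run x (Mv e Move_Right) (st (xs @ [a])) (st (xs @ [Suc a])) []
      (poly [:2, 1:] m) \<and> Suc a \<le> poly [:2, 1:] m"
    by (auto elim!: run_mono)
qed

lemma calc_const: "0 < d \<Longrightarrow> calc d (\<lambda>x xs. n)"
  by (induction n) (auto intro: calc_zero calc_Suc)

lemma st_snoc2: "st (xs @ [a, b]) = (st xs)(length xs := int a, Suc (length xs) := int b)"
  using st_snoc[of "xs @ [a]" b] by (simp add: st_snoc)

lemma calc_add: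
  assumes "calc d f" and "calc d g"
  shows "calc d (\<lambda>x xs. f x xs + g x xs)"
proof (rule calc_binop[OF assms, where h = "\<lambda>x a b. a + b" and P = "\<lambda>e. transfer (Suc e) e"
      and r = "\<lambda>e. [:1, 6:]"])
  fix e x xs m a b assume e: "env e x m xs" "a \<le> m" "b \<le> m"
  then have len: "length xs = e" by (simp add: env_def)
  let ?s = "st (xs @ [a, b])"
  have "run x (transfer (Suc e) e) ?s (?s(Suc e := 0, e := ?s e + int b)) [] (Suc (b * 6))"
    using len by (intro run_transfer) (auto simp: st_snoc2)
  moreover have "?s(Suc e := 0, e := ?s e + int b) = st (xs @ [a + b])"
    using len by (auto simp: st_snoc2 st_snoc st_free fun_eq_iff)
  ultimately show "run x (transfer (Suc e) e) ?s (st (xs @ [a + b])) [] (poly [:1, 6:] m) \<and>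
      a + b \<le> poly [:1, 6:] m"
    using e by (auto elim!: run_mono)
qed

lemma calc_diff:
  assumes "calc d f" and "calc d g"
  shows "calc d (\<lambda>x xs. f x xs - g x xs)"
proof (rule calc_binop[OF assms, where h = "\<lambda>x a b. a - b" and r = "\<lambda>e. [:1, 7:]" and
      P = "\<lambda>e. Loop (Suc e) 1 (Seq (Mv (Suc e) Move_Left) (Cond e 1 Skip (Mv e Move_Left)))"])
  fix e x xs m a b assume e: "env e x m xs" "a \<le> m" "b \<le> m"
  then have len: "length xs = e" and e0: "0 < e" by (simp_all add: env_def)
  let ?s = "st (xs @ [a, b])"
  \<comment> \<open>Natural subtraction in \<open>a - i\<close> mirrors the test: once counter
    \<open>e\<close> reads its mark it is no longer decremented.\<close>
  let ?S = "\<lambda>i. (st xs)(e := int (a - i), Suc e := int b - int i)"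
  have "run x (Loop (Suc e) 1 (Seq (Mv (Suc e) Move_Left) (Cond e 1 Skip (Mv e Move_Left))))
      ?s (st (xs @ [a - b])) [] (Suc (b * Suc (Suc (2 + Suc 2))))"
  proof (rule run_Loop_silent[where S = ?S])
    fix i assume "i < b"
    let ?s' = "(?S i)(Suc e := ?S i (Suc e) + offset Move_Left)"
    show "run x (Seq (Mv (Suc e) Move_Left) (Cond e 1 Skip (Mv e Move_Left))) (?S i) (?S (Suc i)) []
        (Suc (2 + Suc 2))"
    proof (rule run_Seq_silent[OF run_Mv], rule run_Cond)
      show "run x (if base x e (?s' e) = 1 then Skip else Mv e Move_Left) ?s' (?S (Suc i)) [] 2"
      proof (cases "a \<le> i")
        case True
        then have "?s' = ?S (Suc i)" by (auto simp: fun_eq_iff)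
        then show ?thesis using True run_Skip[of x ?s'] e0 by (simp add: base_counter)
      next
        case False
        then show ?thesis using e0 by (auto simp: base_counter fun_eq_iff intro!: run_Mv_eq)
      qed
    qed
  qed (use len in \<open>auto simp: base_counter st_snoc st_snoc2 st_free fun_eq_iff\<close>)
  then show "run x (Loop (Suc e) 1 (Seq (Mv (Suc e) Move_Left) (Cond e 1 Skip (Mv e Move_Left))))
      ?s (st (xs @ [a - b])) [] (poly [:1, 7:] m) \<and> a - b \<le> poly [:1, 7:] m"
    using e by (auto elim!: run_mono)
qed

lemma calc_mult:
  assumes "calc d f" and "calc d g"
  shows "calc d (\<lambda>x xs. f x xs * g x xs)"
proof (rule calc_binop[OF assms, where h = "\<lambda>x a b. a * b" and r = "\<lambda>e. [:5, 10, 21:]" and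
      P = "\<lambda>e. Seq (Loop e 1 (Seq (Mv e Move_Left) (add_copy (Suc e) (e + 2) (e + 3))))
        (Seq (clear (Suc e)) (transfer (e + 2) e))"])
  fix e x xs m a b assume e: "env e x m xs" "a \<le> m" "b \<le> m"
  then have len: "length xs = e" and e0: "0 < e" by (simp_all add: env_def)
  let ?s = "st (xs @ [a, b])"
  let ?S = "\<lambda>i. (st xs)(e := int a - int i, Suc e := int b, e + 2 := int (i * b))"
  have 1: "run x (Loop e 1 (Seq (Mv e Move_Left) (add_copy (Suc e) (e + 2) (e + 3)))) ?s (?S a) []
      (Suc (a * Suc (Suc (2 + (b * 15 + 3)))))"
  proof (rule run_Loop_silent[where S = ?S])
    fix i assume "i < a"
    let ?s' = "(?S i)(e := ?S i e + offset Move_Left)"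
    have "run x (add_copy (Suc e) (e + 2) (e + 3)) ?s' (?s'(e + 2 := ?s' (e + 2) + int b)) []
        (b * 15 + 3)"
      using len by (intro run_add_copy) (auto simp: st_free)
    moreover have "?s'(e + 2 := ?s' (e + 2) + int b) = ?S (Suc i)" by (auto simp: fun_eq_iff)
    ultimately show "run x (Seq (Mv e Move_Left) (add_copy (Suc e) (e + 2) (e + 3)))
        (?S i) (?S (Suc i)) [] (Suc (2 + (b * 15 + 3)))"
      by (intro run_Seq_silent[OF run_Mv]) simp
  qed (use len e0 in \<open>auto simp: base_counter st_snoc2 st_free fun_eq_iff\<close>)
  have 2: "run x (clear (Suc e)) (?S a) ((?S a)(Suc e := 0)) [] (Suc (b * 3))"
    by (rule run_clear) auto
  let ?s' = "(?S a)(Suc e := 0)"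
  have 3: "run x (transfer (e + 2) e) ?s' (?s'(e + 2 := 0, e := ?s' e + int (a * b))) []
      (Suc (a * b * 6))"
    by (rule run_transfer) auto
  have eq: "?s'(e + 2 := 0, e := ?s' e + int (a * b)) = st (xs @ [a * b])"
    using len by (auto simp: st_snoc st_free fun_eq_iff)
  have ab: "a * b \<le> m * m" using e by (intro mult_mono) auto
  have "run x (Seq (Loop e 1 (Seq (Mv e Move_Left) (add_copy (Suc e) (e + 2) (e + 3))))
      (Seq (clear (Suc e)) (transfer (e + 2) e))) ?s (st (xs @ [a * b])) []
      (Suc (Suc (a * Suc (Suc (2 + (b * 15 + 3)))) + Suc (Suc (b * 3) + Suc (a * b * 6))))"
    using run_Seq_silent[OF 1 run_Seq_silent[OF 2 3]] unfolding eq .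
  then have 4: "run x (Seq (Loop e 1 (Seq (Mv e Move_Left) (add_copy (Suc e) (e + 2) (e + 3))))
      (Seq (clear (Suc e)) (transfer (e + 2) e))) ?s (st (xs @ [a * b])) []
      (poly [:5, 10, 21:] m)"
  proof (rule run_mono)
    have "Suc (Suc (a * Suc (Suc (2 + (b * 15 + 3)))) + Suc (Suc (b * 3) + Suc (a * b * 6)))
        = 5 + a * 7 + b * 3 + 21 * (a * b)"
      by (simp add: algebra_simps)
    also have "\<dots> \<le> poly [:5, 10, 21:] m" using ab e by (simp add: algebra_simps)
    finally show "Suc (Suc (a * Suc (Suc (2 + (b * 15 + 3)))) + Suc (Suc (b * 3) + Suc (a * b * 6)))
        \<le> poly [:5, 10, 21:] m" .
  qed
  have "a * b \<le> poly [:5, 10, 21:] m" using ab by (simp add: algebra_simps)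
  with 4 show "run x (Seq (Loop e 1 (Seq (Mv e Move_Left) (add_copy (Suc e) (e + 2) (e + 3))))
      (Seq (clear (Suc e)) (transfer (e + 2) e))) ?s (st (xs @ [a * b])) []
      (poly [:5, 10, 21:] m) \<and> a * b \<le> poly [:5, 10, 21:] m"
    by (rule conjI)
qed

lemma calc_half:
  assumes "calc d f"
  shows "calc d (\<lambda>x xs. f x xs div 2)"
proof (rule calc_unop[OF assms, where h = "\<lambda>x a. a div 2" and r = "\<lambda>e. [:9, 30:]" and
      P = "\<lambda>e. Seq (Loop e 1 (Seq (Mv e Move_Left) (Cond (e + 2) 1 (Mv (e + 2) Move_Right)
          (Seq (Mv (e + 2) Move_Left) (Mv (e + 1) Move_Right)))))
        (Seq (clear (e + 2)) (transfer (e + 1) e))"])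
  fix e x xs m a assume e: "env e x m xs" "a \<le> m"
  then have len: "length xs = e" and e0: "0 < e" by (simp_all add: env_def)
  let ?s = "st (xs @ [a])"
  \<comment> \<open>Counter \<open>e + 2\<close> toggles with the parity of the rounds done, and
    every second round increments the quotient in \<open>e + 1\<close>.\<close>
  let ?S = "\<lambda>i. (st xs)(e := int a - int i, e + 1 := int (i div 2), e + 2 := int (i mod 2))"
  let ?L = "Loop e 1 (Seq (Mv e Move_Left) (Cond (e + 2) 1 (Mv (e + 2) Move_Right)
          (Seq (Mv (e + 2) Move_Left) (Mv (e + 1) Move_Right))))"
  have 1: "run x ?L ?s (?S a) [] (Suc (a * Suc (Suc (2 + Suc 5))))"
  proof (rule run_Loop_silent[where S = ?S])
    fix i assume "i < a"
    let ?s' = "(?S i)(e := ?S i e + offset Move_Left)"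
    show "run x (Seq (Mv e Move_Left) (Cond (e + 2) 1 (Mv (e + 2) Move_Right)
          (Seq (Mv (e + 2) Move_Left) (Mv (e + 1) Move_Right)))) (?S i) (?S (Suc i)) []
        (Suc (2 + Suc 5))"
    proof (rule run_Seq_silent[OF run_Mv], rule run_Cond)
      show "run x (if base x (e + 2) (?s' (e + 2)) = 1 then Mv (e + 2) Move_Right
          else Seq (Mv (e + 2) Move_Left) (Mv (e + 1) Move_Right)) ?s' (?S (Suc i)) [] 5"
      proof (cases "even i")
        case True
        then have "Suc i div 2 = i div 2" "Suc i mod 2 = 1" "i mod 2 = 0"
          by (auto elim!: evenE)
        then have "run x (Mv (e + 2) Move_Right) ?s' (?S (Suc i)) [] 2"
          by (intro run_Mv_eq) (auto simp: fun_eq_iff)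
        then show ?thesis using \<open>i mod 2 = 0\<close> by (auto simp: base_counter elim!: run_mono)
      next
        case False
        then have i: "Suc i div 2 = Suc (i div 2)" "Suc i mod 2 = 0" "i mod 2 = 1"
          by (auto elim!: oddE)
        then have "run x (Seq (Mv (e + 2) Move_Left) (Mv (e + 1) Move_Right)) ?s' (?S (Suc i)) [] 5"
          by (intro run_Mv2) (auto simp: fun_eq_iff)
        then show ?thesis using i by (auto simp: base_counter elim!: run_mono)
      qed
    qed
  qed (use len e0 in \<open>auto simp: base_counter st_snoc st_free fun_eq_iff\<close>)
  have 2: "run x (clear (e + 2)) (?S a) ((?S a)(e + 2 := 0)) [] (Suc (a mod 2 * 3))"
    by (rule run_clear) auto
  let ?s' = "(?S a)(e + 2 := 0)"
  have 3: "run x (transfer (e + 1) e) ?s' (?s'(e + 1 := 0, e := ?s' e + int (a div 2))) []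
      (Suc (a div 2 * 6))"
    by (rule run_transfer) auto
  have eq: "?s'(e + 1 := 0, e := ?s' e + int (a div 2)) = st (xs @ [a div 2])"
    using len by (auto simp: st_snoc st_free fun_eq_iff)
  have "run x (Seq ?L (Seq (clear (e + 2)) (transfer (e + 1) e))) ?s (st (xs @ [a div 2])) []
      (Suc (Suc (a * Suc (Suc (2 + Suc 5))) + Suc (Suc (a mod 2 * 3) + Suc (a div 2 * 6))))"
    using run_Seq_silent[OF 1 run_Seq_silent[OF 2 3]] unfolding eq .
  moreover have "a mod 2 \<le> 1" "a div 2 \<le> a" by auto
  ultimately show "run x (Seq ?L (Seq (clear (e + 2)) (transfer (e + 1) e))) ?s
      (st (xs @ [a div 2])) [] (poly [:9, 30:] m) \<and> a div 2 \<le> poly [:9, 30:] m"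
    using e by (auto elim!: run_mono)
qed

text \<open>The input head walks \<open>a\<close> cells to the right, the symbol read there is
  turned into a counter value, and the copy of \<open>a\<close> in counter \<open>Suc e\<close>
  brings the head back, so that variable \<open>0\<close> is zero again.\<close>

lemma calc_symbol:
  assumes "calc d f"
  shows "calc d (\<lambda>x xs. fst (input_tape x) (int (f x xs)))"
proof (rule calc_unop[OF assms, where h = "\<lambda>x a. fst (input_tape x) (int a)" and
      r = "\<lambda>e. [:30, 30:]" and
      P = "\<lambda>e. Seq (transfer2 e 0 Move_Right (Suc e))
        (Seq (Cond 0 1 (Mv e Move_Right) (Cond 0 2 (Seq (Mv e Move_Right) (Mv e Move_Right)) Skip))
          (Loop (Suc e) 1 (Seq (Mv (Suc e) Move_Left) (Mv 0 Move_Left))))"])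
  fix e x xs m a assume e: "env e x m xs" "a \<le> m"
  then have len: "length xs = e" and e0: "0 < e" and x0: "xs ! 0 = 0" by (simp_all add: env_def)
  let ?s = "st (xs @ [a])"
  let ?v = "fst (input_tape x) (int a)"
  let ?s1 = "(st xs)(0 := int a, Suc e := int a)"
  let ?s2 = "(st xs)(0 := int a, Suc e := int a, e := int ?v)"
  have v: "?v \<in> {0, 1, 2}" by (auto simp: input_tape_def sym_of_bit_def)
  have st0: "st xs 0 = 0" using x0 e0 len by (simp add: st_def)
  have "run x (transfer2 e 0 Move_Right (Suc e)) ?s
      (?s(e := 0, 0 := ?s 0 + int a * offset Move_Right, Suc e := ?s (Suc e) + int a)) []
      (Suc (a * 9))"
    using e0 len by (intro run_transfer2) (auto simp: st_snoc)
  moreover have "?s(e := 0, 0 := ?s 0 + int a * offset Move_Right, Suc e := ?s (Suc e) + int a) = ?s1"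
    using e0 len st0 by (auto simp: st_snoc st_free fun_eq_iff)
  ultimately have 1: "run x (transfer2 e 0 Move_Right (Suc e)) ?s ?s1 [] (Suc (a * 9))" by simp
  have b: "base x 0 (?s1 0) = ?v" by (simp add: base_def)
  have 2: "run x (Cond 0 1 (Mv e Move_Right) (Cond 0 2 (Seq (Mv e Move_Right) (Mv e Move_Right)) Skip))
      ?s1 ?s2 [] 7"
  proof -
    have A: "run x (Mv e Move_Right) ?s1 ?s2 [] 2" if "?v = 1"
      using that e0 len by (intro run_Mv_eq) (auto simp: st_free fun_eq_iff)
    have B: "run x (Seq (Mv e Move_Right) (Mv e Move_Right)) ?s1 ?s2 [] 5" if "?v = 2"
      using that e0 len by (intro run_Mv2) (auto simp: st_free fun_eq_iff)
    have C: "run x Skip ?s1 ?s2 [] 2" if "?v = 0"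
    proof -
      have "?s2 = ?s1" using that e0 len by (auto simp: st_free fun_eq_iff)
      then show ?thesis using run_Skip[of x ?s1] by simp
    qed
    have "run x (if ?v = 1 then Mv e Move_Right
        else Cond 0 2 (Seq (Mv e Move_Right) (Mv e Move_Right)) Skip) ?s1 ?s2 [] 6"
    proof (cases "?v = 1")
      case True
      then show ?thesis using A by (auto elim!: run_mono)
    next
      case False
      have "run x (if base x 0 (?s1 0) = 2 then Seq (Mv e Move_Right) (Mv e Move_Right) else Skip)
          ?s1 ?s2 [] 5"
        unfolding b using False v B C by (auto elim!: run_mono)
      from run_Cond[OF this] have "run x (Cond 0 2 (Seq (Mv e Move_Right) (Mv e Move_Right)) Skip)
          ?s1 ?s2 [] 6" by (rule run_mono) simp
      then show ?thesis using False by (simp only: if_False)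
    qed
    then have "run x (if base x 0 (?s1 0) = 1 then Mv e Move_Right
        else Cond 0 2 (Seq (Mv e Move_Right) (Mv e Move_Right)) Skip) ?s1 ?s2 [] 6"
      unfolding b .
    from run_Cond[OF this] show ?thesis by (rule run_mono) simp
  qed
  have 3: "run x (Loop (Suc e) 1 (Seq (Mv (Suc e) Move_Left) (Mv 0 Move_Left))) ?s2 (st (xs @ [?v])) []
      (Suc (a * Suc 5))"
  proof (rule run_Loop_silent[where
        S = "\<lambda>i. (st xs)(0 := int a - int i, Suc e := int a - int i, e := int ?v)"])
    fix i assume "i < a"
    show "run x (Seq (Mv (Suc e) Move_Left) (Mv 0 Move_Left))
        ((st xs)(0 := int a - int i, Suc e := int a - int i, e := int ?v))
        ((st xs)(0 := int a - int (Suc i), Suc e := int a - int (Suc i), e := int ?v)) [] 5"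
      using e0 by (intro run_Mv2) (auto simp: fun_eq_iff)
  qed (use len e0 st0 in \<open>auto simp: base_counter st_snoc st_free fun_eq_iff\<close>)
  have "?v \<le> 2" using v by auto
  then show "run x (Seq (transfer2 e 0 Move_Right (Suc e))
        (Seq (Cond 0 1 (Mv e Move_Right) (Cond 0 2 (Seq (Mv e Move_Right) (Mv e Move_Right)) Skip))
          (Loop (Suc e) 1 (Seq (Mv (Suc e) Move_Left) (Mv 0 Move_Left))))) ?s
        (st (xs @ [?v])) [] (poly [:30, 30:] m) \<and> ?v \<le> poly [:30, 30:] m"
    using run_Seq_silent[OF 1 run_Seq_silent[OF 2 3]] e by (auto elim!: run_mono)
qed

text \<open>The input contains no blank, so the head reaches the first blank after
  \<open>length x\<close> moves. Counter \<open>e\<close> records them; it is spent on returning the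
  head and rebuilt from its copy.\<close>

lemma calc_length:
  assumes "0 < d"
  shows "calc d (\<lambda>x xs. length x)"
proof -
  have "computes e (\<lambda>x xs. length x)" for e
  proof (rule computesI[where q = "[:30, 30:]" and
        c = "Seq (Loop 0 0 (Seq (Mv 0 Move_Right) (Mv e Move_Right)))
          (Seq (transfer2 e 0 Move_Left (Suc e)) (transfer (Suc e) e))"])
    fix x xs m assume e: "env e x m xs"
    then have len: "length xs = e" and e0: "0 < e" and x0: "xs ! 0 = 0" and m: "length x \<le> m"
      by (simp_all add: env_def)
    have st0: "st xs 0 = 0" using x0 e0 len by (simp add: st_def)
    let ?n = "int (length x)"
    let ?s1 = "(st xs)(0 := ?n, e := ?n)" and ?s2 = "(st xs)(Suc e := ?n)"
    have 1: "run x (Loop 0 0 (Seq (Mv 0 Move_Right) (Mv e Move_Right))) (st xs) ?s1 []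
        (Suc (length x * Suc 5))"
    proof (rule run_Loop_silent[where S = "\<lambda>i. (st xs)(0 := int i, e := int i)"])
      fix i
      show "run x (Seq (Mv 0 Move_Right) (Mv e Move_Right)) ((st xs)(0 := int i, e := int i))
          ((st xs)(0 := int (Suc i), e := int (Suc i))) [] 5"
        using e0 by (intro run_Mv2) (auto simp: fun_eq_iff)
    qed (use e0 len st0 in \<open>auto simp: base_def input_tape_def sym_of_bit_def st_free fun_eq_iff\<close>)
    have "run x (transfer2 e 0 Move_Left (Suc e)) ?s1
        (?s1(e := 0, 0 := ?s1 0 + ?n * offset Move_Left, Suc e := ?s1 (Suc e) + ?n)) []
        (Suc (length x * 9))"
      using e0 by (intro run_transfer2) auto
    moreover have "?s1(e := 0, 0 := ?s1 0 + ?n * offset Move_Left, Suc e := ?s1 (Suc e) + ?n) = ?s2"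
      using e0 len st0 by (auto simp: st_free fun_eq_iff)
    ultimately have 2: "run x (transfer2 e 0 Move_Left (Suc e)) ?s1 ?s2 [] (Suc (length x * 9))"
      by simp
    have "run x (transfer (Suc e) e) ?s2 (?s2(Suc e := 0, e := ?s2 e + ?n)) [] (Suc (length x * 6))"
      by (rule run_transfer) auto
    moreover have "?s2(Suc e := 0, e := ?s2 e + ?n) = st (xs @ [length x])"
      using len by (auto simp: st_snoc st_free fun_eq_iff)
    ultimately have 3: "run x (transfer (Suc e) e) ?s2 (st (xs @ [length x])) [] (Suc (length x * 6))"
      by simp
    show "run x (Seq (Loop 0 0 (Seq (Mv 0 Move_Right) (Mv e Move_Right)))
          (Seq (transfer2 e 0 Move_Left (Suc e)) (transfer (Suc e) e))) (st xs)
          (st (xs @ [length x])) [] (poly [:30, 30:] m) \<and> length x \<le> poly [:30, 30:] m"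
      using run_Seq_silent[OF 1 run_Seq_silent[OF 2 3]] m by (auto elim!: run_mono)
  qed
  then show ?thesis using assms by (simp add: calc_def)
qed

lemma calc_if:
  assumes "calc d f" and "calc d g" and "calc d h"
  shows "calc d (\<lambda>x xs. if f x xs \<noteq> 0 then g x xs else h x xs)"
proof -
  have "computes e (\<lambda>x xs. if f x xs \<noteq> 0 then g x xs else h x xs)" if "d \<le> e" for e
  proof -
    obtain c1 q1 where 1: "\<And>x xs m. env e x m xs \<Longrightarrow>
       run x c1 (st xs) (st (xs @ [f x xs])) [] (poly q1 m) \<and> f x xs \<le> poly q1 m"
      using assms(1) \<open>d \<le> e\<close> unfolding calc_def computes_def by metis
    obtain c2 q2 where 2: "\<And>x xs m. env e x m xs \<Longrightarrow>
       run x c2 (st xs) (st (xs @ [g x xs])) [] (poly q2 m) \<and> g x xs \<le> poly q2 m"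
      using assms(2) \<open>d \<le> e\<close> unfolding calc_def computes_def by metis
    obtain c3 q3 where 3: "\<And>x xs m. env e x m xs \<Longrightarrow>
       run x c3 (st xs) (st (xs @ [h x xs])) [] (poly q3 m) \<and> h x xs \<le> poly q3 m"
      using assms(3) \<open>d \<le> e\<close> unfolding calc_def computes_def by metis
    show ?thesis
    proof (rule computesI[where c = "Seq c1 (Cond e 1 c3 (Seq (clear e) c2))"
          and q = "q1 + (3 * q1 + q2 + q3 + 4)"])
      fix x xs m assume e: "env e x m xs"
      then have len: "length xs = e" and e0: "0 < e" by (simp_all add: env_def)
      let ?r = "if f x xs \<noteq> 0 then g x xs else h x xs"
      have "run x (if base x e (st (xs @ [f x xs]) e) = 1 then c3 else Seq (clear e) c2)
          (st (xs @ [f x xs])) (st (xs @ [?r])) [] (poly (3 * q1 + q2 + q3 + 2) m)"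
      proof (cases "f x xs = 0")
        case True
        then have "st (xs @ [f x xs]) = st xs" using len by (auto simp: st_snoc st_free fun_eq_iff)
        then show ?thesis using True 3[OF e] len e0
          by (auto simp: base_counter st_free elim!: run_mono)
      next
        case False
        have "run x (clear e) (st (xs @ [f x xs])) ((st (xs @ [f x xs]))(e := 0)) []
            (Suc (f x xs * 3))"
          using len e0 by (intro run_clear) (auto simp: st_snoc)
        moreover have "(st (xs @ [f x xs]))(e := 0) = st xs"
          using len by (auto simp: st_snoc st_free fun_eq_iff)
        ultimately have "run x (Seq (clear e) c2) (st (xs @ [f x xs])) (st (xs @ [g x xs])) []
            (Suc (Suc (f x xs * 3) + poly q2 m))"
          using 2[OF e] by (intro run_Seq_silent) auto
        then show ?thesis using False len e0 1[OF e]
          by (auto simp: base_counter st_snoc elim!: run_mono)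
      qed
      from run_Seq_silent[OF conjunct1[OF 1[OF e]] run_Cond[OF this]]
      show "run x (Seq c1 (Cond e 1 c3 (Seq (clear e) c2))) (st xs) (st (xs @ [?r])) []
          (poly (q1 + (3 * q1 + q2 + q3 + 4)) m) \<and> ?r \<le> poly (q1 + (3 * q1 + q2 + q3 + 4)) m"
        using 2[OF e] 3[OF e] by (auto elim!: run_mono)
    qed
  qed
  then show ?thesis using assms by (simp add: calc_def)
qed

text \<open>Horner's scheme.\<close>

lemma calc_poly:
  assumes "calc d f"
  shows "calc d (\<lambda>x xs. poly p (f x xs))"
proof (induction p)
  case 0
  show ?case using calc_zero[OF calc_pos[OF assms]] by simp
next
  case (pCons a p)
  from calc_const[OF calc_pos[OF assms]] show ?case using calc_add[OF _ calc_mult[OF assms pCons(2)]] by simp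
qed

section \<open>Decidable conditions\<close>

definition dec :: "nat \<Rightarrow> (bool list \<Rightarrow> nat list \<Rightarrow> bool) \<Rightarrow> bool" where
  "dec d \<phi> \<longleftrightarrow> calc d (\<lambda>x xs. of_bool (\<phi> x xs))"

lemma dec_const: "0 < d \<Longrightarrow> dec d (\<lambda>x xs. b)"
  unfolding dec_def by (rule calc_const)

lemma dec_not:
  assumes "dec d \<phi>"
  shows "dec d (\<lambda>x xs. \<not> \<phi> x xs)"
proof -
  have "calc d (\<lambda>x xs. 1 - of_bool (\<phi> x xs))"
    using assms unfolding dec_def by (intro calc_diff calc_const calc_pos)
  moreover have "1 - of_bool (\<phi> x xs) = (of_bool (\<not> \<phi> x xs) :: nat)" for x xs
    by simp
  ultimately show ?thesis unfolding dec_def by simp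
qed

lemma dec_and:
  assumes "dec d \<phi>" and "dec d \<psi>"
  shows "dec d (\<lambda>x xs. \<phi> x xs \<and> \<psi> x xs)"
proof -
  have "calc d (\<lambda>x xs. of_bool (\<phi> x xs) * of_bool (\<psi> x xs))"
    using assms unfolding dec_def by (rule calc_mult)
  then show ?thesis unfolding dec_def by (simp add: of_bool_conj)
qed

lemma dec_or:
  assumes "dec d \<phi>" and "dec d \<psi>"
  shows "dec d (\<lambda>x xs. \<phi> x xs \<or> \<psi> x xs)"
  using dec_not[OF dec_and[OF dec_not[OF assms(1)] dec_not[OF assms(2)]]] by simp

lemma calc_dec_if:
  assumes "dec d \<phi>" and "calc d g" and "calc d h"
  shows "calc d (\<lambda>x xs. if \<phi> x xs then g x xs else h x xs)"
  using calc_if[OF assms(1)[unfolded dec_def] assms(2,3)] by simp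

lemma dec_le:
  assumes "calc d f" and "calc d g"
  shows "dec d (\<lambda>x xs. f x xs \<le> g x xs)"
proof -
  have "calc d (\<lambda>x xs. if f x xs - g x xs \<noteq> 0 then 0 else 1)"
    by (intro calc_if calc_diff assms calc_const calc_pos[OF assms(1)])
  moreover have "(if f x xs - g x xs \<noteq> 0 then 0 else 1 :: nat) = of_bool (f x xs \<le> g x xs)" for x xs
    by simp
  ultimately show ?thesis unfolding dec_def by simp
qed

lemma dec_less:
  assumes "calc d f" and "calc d g"
  shows "dec d (\<lambda>x xs. f x xs < g x xs)"
  using dec_not[OF dec_le[OF assms(2,1)]] by (simp add: not_le)

lemma dec_eq:
  assumes "calc d f" and "calc d g"
  shows "dec d (\<lambda>x xs. f x xs = g x xs)"
  using dec_and[OF dec_le[OF assms] dec_le[OF assms(2,1)]] by (simp add: eq_iff)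

section \<open>Programs that write output\<close>

definition gen :: "nat \<Rightarrow> (bool list \<Rightarrow> nat list \<Rightarrow> bool list) \<Rightarrow> bool" where
  "gen d g \<longleftrightarrow> (\<exists>c (q :: nat poly). \<forall>x xs m. env d x m xs \<longrightarrow>
     run x c (st xs) (st xs) (g x xs) (poly q m))"

lemma genI:
  fixes q :: "nat poly"
  assumes "\<And>x xs m. env d x m xs \<Longrightarrow> run x c (st xs) (st xs) (g x xs) (poly q m)"
  shows "gen d g"
  using assms unfolding gen_def by blast

text \<open>Works because \<open>gen\<close> asks the program to restore all variables; the same
  requirement allows nesting in loops.\<close>

lemma gen_append:
  assumes "gen d g" and "gen d h"
  shows "gen d (\<lambda>x xs. g x xs @ h x xs)"
proof -
  obtain c1 q1 where 1: "\<And>x xs m. env d x m xs \<Longrightarrow> run x c1 (st xs) (st xs) (g x xs) (poly q1 m)"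
    using assms(1) unfolding gen_def by blast
  obtain c2 q2 where 2: "\<And>x xs m. env d x m xs \<Longrightarrow> run x c2 (st xs) (st xs) (h x xs) (poly q2 m)"
    using assms(2) unfolding gen_def by blast
  show ?thesis
    using run_Seq[OF 1 2] by (intro genI[where c = "Seq c1 c2" and q = "q1 + q2 + 1"]) simp
qed

lemma gen_const: "gen d (\<lambda>x xs. w)"
proof (induction w)
  case Nil
  show ?case by (rule genI[where c = Skip and q = 2]) (simp add: run_Skip)
next
  case (Cons b w)
  have "gen d (\<lambda>x xs. [b])" by (rule genI[where c = "Out b" and q = 2]) (simp add: run_Out)
  from gen_append[OF this Cons] show ?case by simp
qed

lemma gen_concat_list:
  assumes "\<And>a. a \<in> set as \<Longrightarrow> gen d (g a)"
  shows "gen d (\<lambda>x xs. concat (map (\<lambda>a. g a x xs) as))"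
  using assms by (induction as) (auto intro: gen_const gen_append)

lemma gen_if:
  assumes \<phi>: "dec e \<phi>" and "e \<le> d" and g: "gen d g" and h: "gen d h"
  shows "gen d (\<lambda>x xs. if \<phi> x xs then g x xs else h x xs)"
proof -
  obtain c1 q1 where 1: "\<And>x xs m. env d x m xs \<Longrightarrow>
     run x c1 (st xs) (st (xs @ [of_bool (\<phi> x xs)])) [] (poly q1 m)"
    using \<phi> \<open>e \<le> d\<close> unfolding dec_def calc_def computes_def by metis
  obtain c2 q2 where 2: "\<And>x xs m. env d x m xs \<Longrightarrow> run x c2 (st xs) (st xs) (g x xs) (poly q2 m)"
    using g unfolding gen_def by blast
  obtain c3 q3 where 3: "\<And>x xs m. env d x m xs \<Longrightarrow> run x c3 (st xs) (st xs) (h x xs) (poly q3 m)"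
    using h unfolding gen_def by blast
  show ?thesis
  proof (rule genI[where c = "Seq c1 (Cond d 1 c3 (Seq (clear d) c2))" and q = "q1 + q2 + q3 + 7"])
    fix x xs m assume e: "env d x m xs"
    then have len: "length xs = d" and d0: "0 < d" by (simp_all add: env_def)
    let ?s = "st (xs @ [of_bool (\<phi> x xs)])"
    let ?w = "if \<phi> x xs then g x xs else h x xs"
    have "run x (if base x d (?s d) = 1 then c3 else Seq (clear d) c2) ?s (st xs) ?w
        (poly (q2 + q3 + 5) m)"
    proof (cases "\<phi> x xs")
      case False
      then have "?s = st xs" using len by (auto simp: st_snoc st_free fun_eq_iff)
      then show ?thesis using False 3[OF e] len d0
        by (auto simp: base_counter st_free elim!: run_mono)
    next
      case True
      have "run x (clear d) ?s (?s(d := 0)) [] (Suc (1 * 3))"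
        using len d0 True by (intro run_clear) (auto simp: st_snoc)
      moreover have "?s(d := 0) = st xs" using len by (auto simp: st_snoc st_free fun_eq_iff)
      ultimately have "run x (Seq (clear d) c2) ?s (st xs) ([] @ g x xs) (Suc (Suc (1 * 3) + poly q2 m))"
        using 2[OF e] by (intro run_Seq) auto
      then show ?thesis using True len d0 by (auto simp: base_counter st_snoc elim!: run_mono)
    qed
    from run_Seq[OF 1[OF e] run_Cond[OF this]]
    show "run x (Seq c1 (Cond d 1 c3 (Seq (clear d) c2))) (st xs) (st xs) ?w
        (poly (q1 + q2 + q3 + 7) m)"
      by (auto elim!: run_mono)
  qed
qed

lemma rev_upt_eq: "rev [0..<b] = map (\<lambda>i. b - Suc i) [0..<b]"
  by (rule nth_equalityI) (simp_all add: rev_nth)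

text \<open>The loop variable counts down, so that the loop needs no second counter.\<close>

lemma gen_for:
  assumes f: "calc e f" and "e \<le> d" and g: "gen (Suc d) g"
  shows "gen d (\<lambda>x xs. concat (map (\<lambda>k. g x (xs @ [k])) (rev [0..<f x xs])))"
proof -
  obtain c1 q1 where 1: "\<And>x xs m. env d x m xs \<Longrightarrow>
     run x c1 (st xs) (st (xs @ [f x xs])) [] (poly q1 m) \<and> f x xs \<le> poly q1 m"
    using f \<open>e \<le> d\<close> unfolding calc_def computes_def by metis
  obtain c2 q2 where 2: "\<And>x xs m. env (Suc d) x m xs \<Longrightarrow>
      run x c2 (st xs) (st xs) (g x xs) (poly q2 m)"
    using g unfolding gen_def by blast
  let ?p1 = "[:0, 1:] + q1"
  show ?thesis
  proof (rule genI[where c = "Seq c1 (Loop d 1 (Seq (Mv d Move_Left) c2))"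
        and q = "q1 + (q1 * (pcompose q2 ?p1 + 4) + 2)"])
    fix x xs m assume e: "env d x m xs"
    then have len: "length xs = d" and d0: "0 < d" by (simp_all add: env_def)
    let ?b = "f x xs"
    let ?S = "\<lambda>i. st (xs @ [?b - i])"
    have b: "?b \<le> poly q1 m" using 1[OF e] by simp
    have "run x (Loop d 1 (Seq (Mv d Move_Left) c2)) (?S 0) (?S ?b)
        (concat (map (\<lambda>i. g x (xs @ [?b - Suc i])) [0..<?b]))
        (Suc (?b * Suc (Suc (2 + poly q2 (poly ?p1 m)))))"
    proof (rule run_Loop)
      fix i assume i: "i < ?b"
      then have "run x (Mv d Move_Left) (?S i) (?S (Suc i)) [] 2"
        using len by (intro run_Mv_eq) (auto simp: st_snoc fun_eq_iff)
      moreover have "env (Suc d) x (poly ?p1 m) (xs @ [?b - Suc i])"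
        using b by (intro env_snoc[OF e]) auto
      ultimately show "run x (Seq (Mv d Move_Left) c2) (?S i) (?S (Suc i)) (g x (xs @ [?b - Suc i]))
          (Suc (2 + poly q2 (poly ?p1 m)))"
        using run_Seq[OF _ 2] by fastforce
    qed (use len d0 in \<open>auto simp: base_counter st_snoc\<close>)
    moreover have "?S ?b = st xs" using len by (auto simp: st_snoc st_free fun_eq_iff)
    moreover have "concat (map (\<lambda>i. g x (xs @ [?b - Suc i])) [0..<?b]) =
        concat (map (\<lambda>k. g x (xs @ [k])) (rev [0..<?b]))"
      by (simp add: rev_upt_eq o_def)
    ultimately have "run x (Loop d 1 (Seq (Mv d Move_Left) c2)) (st (xs @ [?b])) (st xs)
        (concat (map (\<lambda>k. g x (xs @ [k])) (rev [0..<?b])))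
        (Suc (?b * Suc (Suc (2 + poly q2 (poly ?p1 m)))))"
      by simp
    from run_Seq[OF conjunct1[OF 1[OF e]] this]
    have "run x (Seq c1 (Loop d 1 (Seq (Mv d Move_Left) c2))) (st xs) (st xs)
        (concat (map (\<lambda>k. g x (xs @ [k])) (rev [0..<?b])))
        (Suc (poly q1 m + Suc (?b * Suc (Suc (2 + poly q2 (poly ?p1 m))))))"
      by simp
    moreover have "?b * Suc (Suc (2 + poly q2 (poly ?p1 m))) \<le> poly q1 m * (poly q2 (poly ?p1 m) + 4)"
      using b by (intro mult_mono) auto
    ultimately show "run x (Seq c1 (Loop d 1 (Seq (Mv d Move_Left) c2))) (st xs) (st xs)
        (concat (map (\<lambda>k. g x (xs @ [k])) (rev [0..<?b])))
        (poly (q1 + (q1 * (pcompose q2 ?p1 + 4) + 2)) m)"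
      by (elim run_mono) (simp add: poly_pcompose)
  qed
qed

theorem gen_poly_time:
  assumes "gen 1 (\<lambda>x xs. f x)"
  shows "poly_time f"
proof -
  obtain c q where c: "\<And>x xs m. env 1 x m xs \<Longrightarrow> run x c (st xs) (st xs) (f x) (poly q m)"
    using assms unfolding gen_def by blast
  have "st [0] = (\<lambda>_. 0)" by (simp add: st_def fun_eq_iff)
  with c[of x "length x" "[0]" for x] have "run x c (\<lambda>_. 0) (\<lambda>_. 0) (f x) (poly q (length x))" for x
    by (simp add: env_def)
  then show ?thesis by (rule run_poly_time)
qed

section \<open>Rainbow triangles and diversity\<close>

text \<open>Costs are natural numbers, so an optimum exists as soon as there is a solution. The
  question about the optimum thus becomes one about any solution within the budget.\<close>

lemma optimal_solution_budget:
  "(\<exists>y. optimal_solution sol cost i y \<and> cost i y \<le> k) \<longleftrightarrow> (\<exists>y. sol i y \<and> cost i y \<le> k)"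
proof
  assume "\<exists>y. sol i y \<and> cost i y \<le> k"
  then obtain y where y: "sol i y" "cost i y \<le> k" by blast
  then obtain z where "sol i z" "\<And>w. sol i w \<Longrightarrow> cost i z \<le> cost i w"
    using ex_has_least_nat[of "sol i" y "cost i"] by blast
  then show "\<exists>y. optimal_solution sol cost i y \<and> cost i y \<le> k"
    using y unfolding optimal_solution_def by (meson le_trans)
qed (auto simp: optimal_solution_def)

definition adj :: "('v \<Rightarrow> 'v \<Rightarrow> bool) \<Rightarrow> 'v \<Rightarrow> 'v \<Rightarrow> bool" where
  "adj arc a b \<longleftrightarrow> arc a b \<or> arc b a"

text \<open>
  An adjacent pair shares the two columns \<open>(a, b, False)\<close> and \<open>(b, a, False)\<close>. The columns
  \<open>(a, b, True)\<close> for non-adjacent pairs make the number of ones in every row the same,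
  namely twice the number of vertices.
\<close>

definition mark :: "('v \<Rightarrow> 'v \<Rightarrow> bool) \<Rightarrow> 'v \<Rightarrow> 'v \<times> 'v \<times> bool \<Rightarrow> bool" where
  "mark arc u c \<longleftrightarrow> (case c of (a, b, l) \<Rightarrow>
     if l then u = a \<and> \<not> adj arc a b else u = a \<or> u = b \<and> adj arc a b)"

definition cols :: "'v list \<Rightarrow> ('v \<times> 'v \<times> bool) list" where
  "cols vs = concat (map (\<lambda>a. concat (map (\<lambda>b. [(a, b, False), (a, b, True)]) vs)) vs)"

definition graph_db :: "'v list \<Rightarrow> ('v \<Rightarrow> nat) \<Rightarrow> ('v \<Rightarrow> 'v \<Rightarrow> bool) \<Rightarrow> nat database" where
  "graph_db vs col arc =
     (Sensitive # map (\<lambda>_. Quasi_Identifier) (cols vs),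
      map (\<lambda>u. col u # map (\<lambda>c. of_bool (mark arc u c)) (cols vs)) vs)"

definition triangle_partition :: "('v \<Rightarrow> 'v \<Rightarrow> bool) \<Rightarrow> 'v set \<Rightarrow> 'v set set \<Rightarrow> bool" where
  "triangle_partition arc V P \<longleftrightarrow>
     (\<forall>X\<in>P. \<exists>a b c. X = {a, b, c} \<and> X \<subseteq> V \<and> arc a b \<and> arc a c \<and> arc b c) \<and>
     (\<forall>u\<in>V. \<exists>!X. X \<in> P \<and> u \<in> X)"

lemma set_cols: "set (cols vs) = set vs \<times> set vs \<times> UNIV"
proof -
  have "(a, b, l) \<in> set (cols vs) \<longleftrightarrow> (a, b, l) \<in> set vs \<times> set vs \<times> UNIV" for a b l
    unfolding cols_def by (cases l) auto
  then show ?thesis by auto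
qed

lemma length_cols: "length (cols vs) = 2 * length vs * length vs"
proof -
  have "length (concat (map (\<lambda>a. concat (map (\<lambda>b. [(a, b, False), (a, b, True)]) vs)) us)) =
      2 * length vs * length us" for us :: "'a list"
  proof (induction us)
    case (Cons a us)
    have "length (concat (map (\<lambda>b. [(a, b, False), (a, b, True)]) ws)) = 2 * length ws" for ws :: "'a list"
      by (induction ws) auto
    with Cons show ?case by simp
  qed simp
  then show ?thesis unfolding cols_def by simp
qed

lemma distinct_cols: "distinct vs \<Longrightarrow> distinct (cols vs)"
  by (rule card_distinct) (simp add: set_cols length_cols card_cartesian_product distinct_card)

locale rainbow_graph =
  fixes vs :: "'v list" and col :: "'v \<Rightarrow> nat" and arc :: "'v \<Rightarrow> 'v \<Rightarrow> bool"
  assumes dist: "distinct vs" and large: "4 \<le> length vs"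
    and col_less: "v \<in> set vs \<Longrightarrow> col v < 3"
    and arc_col: "arc a b \<Longrightarrow> col a < col b"
begin

abbreviation "V \<equiv> set vs"
abbreviation "n \<equiv> length vs"
abbreviation "D \<equiv> graph_db vs col arc"
abbreviation "C \<equiv> cols vs"
abbreviation "inner G \<equiv> {(a, b). a \<in> G \<and> b \<in> G \<and> adj arc a b}"

text \<open>If the rows of \<open>G\<close> end up with equal quasi-identifiers, each of them needs
  a star in all these columns.\<close>

definition mixed :: "'v set \<Rightarrow> ('v \<times> 'v \<times> bool) set" where
  "mixed G = {c \<in> set C. \<exists>u\<in>G. \<exists>v\<in>G. mark arc u c \<noteq> mark arc v c}"

lemma card_V: "card V = n"
  using dist by (rule distinct_card)

lemma adj_sym: "adj arc a b \<longleftrightarrow> adj arc b a"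
  by (auto simp: adj_def)

lemma adj_col: "adj arc a b \<Longrightarrow> col a \<noteq> col b"
  using arc_col unfolding adj_def by (metis less_irrefl)

text \<open>A group of at least three rows is constant on a column iff none of its rows has a one there.\<close>

lemma card_mixed:
  assumes G: "G \<subseteq> V" and g: "3 \<le> card G"
  shows "card (mixed G) + card (inner G) = 2 * (card G * n)"
proof -
  have finG: "finite G" using G finite_subset by blast
  \<comment> \<open>\<open>T\<close> indexes the ones of \<open>G\<close> in columns labelled
    \<open>True\<close>. In columns labelled \<open>False\<close> they are at
    \<open>G \<times> V\<close>, through the first vertex of the column, and at \<open>X\<close>,
    through the second one only. \<open>Y\<close> is the mirror image of \<open>X\<close>.\<close>
  define T where "T = {(a, b). a \<in> G \<and> b \<in> V \<and> \<not> adj arc a b}"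
  define X where "X = {(a, b). a \<in> V - G \<and> b \<in> G \<and> adj arc a b}"
  define Y where "Y = {(a, b). a \<in> G \<and> b \<in> V - G \<and> adj arc a b}"
  have fin: "finite T" "finite X" "finite Y" "finite (inner G)"
    unfolding T_def X_def Y_def using G finG
    by (auto intro: finite_subset[of _ "V \<times> V"])
  have "mixed G = {c \<in> set C. \<exists>u\<in>G. mark arc u c}"
  proof -
    have "\<exists>w\<in>G. \<not> mark arc w c" for c
    proof -
      obtain a b l where c: "c = (a, b, l)" by (cases c)
      \<comment> \<open>Only \<open>a\<close> and \<open>b\<close> can have a one in this column, so
        among three rows one has a zero.\<close>
      have "card {a, b} \<le> 2" by (simp add: card_insert_if)
      then have "\<not> G \<subseteq> {a, b}" using g card_mono[of "{a, b}" G] by auto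
      then obtain w where "w \<in> G" "w \<noteq> a" "w \<noteq> b" by blast
      then show ?thesis by (auto simp: c mark_def)
    qed
    then show ?thesis unfolding mixed_def by blast
  qed
  also have "\<dots> = (\<lambda>(a, b). (a, b, True)) ` T \<union> (\<lambda>(a, b). (a, b, False)) ` (G \<times> V \<union> X)"
  proof -
    have mem: "(a, b, l) \<in> (\<lambda>(a, b). (a, b, k)) ` S \<longleftrightarrow> l = k \<and> (a, b) \<in> S" for a b :: 'v and l k S
      by force
    have *: "(a, b, l) \<in> {c \<in> set C. \<exists>u\<in>G. mark arc u c} \<longleftrightarrow>
        (a, b, l) \<in> (\<lambda>(a, b). (a, b, True)) ` T \<union> (\<lambda>(a, b). (a, b, False)) ` (G \<times> V \<union> X)" for a b l
      using G unfolding set_cols T_def X_def mark_def Un_iff mem by (cases l) auto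
    show ?thesis
    proof (rule set_eqI)
      fix c :: "'v \<times> 'v \<times> bool"
      obtain a b l where "c = (a, b, l)" by (cases c)
      then show "c \<in> {c \<in> set C. \<exists>u\<in>G. mark arc u c} \<longleftrightarrow>
          c \<in> (\<lambda>(a, b). (a, b, True)) ` T \<union> (\<lambda>(a, b). (a, b, False)) ` (G \<times> V \<union> X)"
        using * by simp
    qed
  qed
  also have "card \<dots> = card T + card (G \<times> V \<union> X)"
  proof -
    have "card ((\<lambda>(a, b). (a, b, k)) ` S) = card S" for k :: bool and S :: "('v \<times> 'v) set"
      by (rule card_image) (auto simp: inj_on_def)
    then show ?thesis using fin finG by (subst card_Un_disjoint) auto
  qed
  also have "card (G \<times> V \<union> X) = card G * n + card X"
    using fin finG by (subst card_Un_disjoint) (auto simp: X_def card_cartesian_product card_V)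
  also have "card X = card Y"
  proof -
    have "X = prod.swap ` Y" unfolding X_def Y_def by (auto simp: image_iff adj_sym)
    then show ?thesis by (simp add: card_image)
  qed
  finally have 1: "card (mixed G) = card T + (card G * n + card Y)" .
  have "G \<times> V = T \<union> (Y \<union> inner G)" using G unfolding T_def Y_def by auto
  then have "card (G \<times> V) = card T + (card Y + card (inner G))"
    using fin by (simp add: card_Un_disjoint T_def Y_def disjoint_iff)
  with 1 show ?thesis by (simp add: card_cartesian_product card_V)
qed

lemma inner_subset: "inner G \<subseteq> (SIGMA a:G. G - {a})"
  using adj_col by fastforce

lemma card_pairs: "finite G \<Longrightarrow> card (SIGMA a:G. G - {a}) = card G * (card G - 1)"
  by simp

text \<open>The identity \<open>id\<close> writes the excess as a sum of two terms. The first is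
  nonnegative by \<open>3 \<le> k \<le> n\<close>, the second because at most all ordered pairs are
  adjacent. As \<open>2 * n - k - 2\<close> is positive, equality forces \<open>k = 3\<close>, and
  then all pairs are adjacent.\<close>

lemma mixed_ge:
  assumes G: "G \<subseteq> V" and g: "3 \<le> card G"
  shows "6 * n - 6 \<le> card (mixed G)"
    and "card (mixed G) = 6 * n - 6 \<Longrightarrow> card G = 3 \<and> (\<forall>a\<in>G. \<forall>b\<in>G. a \<noteq> b \<longrightarrow> adj arc a b)"
proof -
  have finG: "finite G" using G finite_subset by blast
  have le: "card G \<le> n" using card_mono[OF _ G] by (simp add: card_V)
  have fin: "finite (SIGMA a:G. G - {a})" using finG by simp
  have inn: "card (inner G) \<le> card G * (card G - 1)"
    using card_mono[OF fin inner_subset] card_pairs[OF finG] by simp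
  define m where "m = int (card (mixed G))"
  define k where "k = int (card G)"
  define e where "e = int (card (inner G))"
  have eq: "m + e = 2 * (k * int n)"
    using arg_cong[OF card_mixed[OF G g], of int] unfolding m_def e_def k_def by simp
  have e: "e \<le> k * (k - 1)"
  proof -
    have "e \<le> int (card G * (card G - 1))" unfolding e_def using inn by (simp only: of_nat_le_iff)
    also have "\<dots> = k * (k - 1)" unfolding k_def using g by (simp add: of_nat_diff)
    finally show ?thesis .
  qed
  have k: "3 \<le> k" "k \<le> int n" "4 \<le> int n" unfolding k_def using g le large by auto
  have id: "m - (6 * int n - 6) = (k - 3) * (2 * int n - k - 2) + (k * (k - 1) - e)"
    using eq by (simp add: algebra_simps)
  have pos: "0 \<le> (k - 3) * (2 * int n - k - 2)" using k by (intro mult_nonneg_nonneg) auto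
  have "6 * int n - 6 \<le> m" using id pos e by linarith
  then show "6 * n - 6 \<le> card (mixed G)" unfolding m_def by linarith
  assume "card (mixed G) = 6 * n - 6"
  then have "m = 6 * int n - 6" unfolding m_def using large by auto
  then have z: "(k - 3) * (2 * int n - k - 2) = 0" "e = k * (k - 1)" using id pos e by linarith+
  then have 3: "card G = 3" using k unfolding k_def by auto
  moreover have "inner G = (SIGMA a:G. G - {a})"
  proof (rule card_subset_eq[OF fin inner_subset])
    have "int (card (inner G)) = 6" using z(2) 3 unfolding e_def k_def by simp
    then show "card (inner G) = card (SIGMA a:G. G - {a})" using card_pairs[OF finG] 3 by simp
  qed
  ultimately show "card G = 3 \<and> (\<forall>a\<in>G. \<forall>b\<in>G. a \<noteq> b \<longrightarrow> adj arc a b)" by blast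
qed

lemma mixed_triangle:
  assumes "{a, b, c} \<subseteq> V" and arcs: "arc a b" "arc a c" "arc b c"
  shows "card (mixed {a, b, c}) = 6 * n - 6"
proof -
  have ne: "a \<noteq> b" "a \<noteq> c" "b \<noteq> c" using arc_col arcs by fastforce+
  then have 3: "card {a, b, c} = 3" by simp
  have "inner {a, b, c} = (SIGMA x:{a, b, c}. {a, b, c} - {x})"
    using inner_subset[of "{a, b, c}"] arcs ne by (auto simp: adj_def)
  then have "card (inner {a, b, c}) = 6" using card_pairs[of "{a, b, c}"] 3 by simp
  then show ?thesis using card_mixed[OF assms(1)] 3 by simp
qed

lemma columns_D:
  "columns Sensitive D = {0}" "columns Quasi_Identifier D = Suc ` {..<length C}"
proof -
  have "j \<in> columns Sensitive D \<longleftrightarrow> j = 0" for j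
    by (cases j) (auto simp: columns_def graph_db_def)
  then show "columns Sensitive D = {0}" by auto
  have "j \<in> columns Quasi_Identifier D \<longleftrightarrow> j \<in> Suc ` {..<length C}" for j
    by (cases j) (auto simp: columns_def graph_db_def)
  then show "columns Quasi_Identifier D = Suc ` {..<length C}" by auto
qed

lemma nth_D:
  assumes "r < n"
  shows "snd D ! r ! 0 = col (vs ! r)"
    and "j < length C \<Longrightarrow> snd D ! r ! Suc j = of_bool (mark arc (vs ! r) (C ! j))"
  using assms by (simp_all add: graph_db_def)

lemma length_D: "length (snd D) = n" "length (fst D) = Suc (length C)"
  by (simp_all add: graph_db_def)

lemma graph_db_legal: "D \<in> binary_ternary_databases"
  unfolding binary_ternary_databases_def mem_Collect_eq columns_D length_D
proof (intro conjI allI impI)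
  show "wf_database D" by (auto simp: wf_database_def graph_db_def)
  fix r assume r: "r < n"
  show "\<forall>q\<in>Suc ` {..<length C}. snd D ! r ! q \<in> {0, 1}" using nth_D(2)[OF r] by auto
  have "col (vs ! r) < 3" using col_less r by simp
  then show "\<forall>s\<in>{0}. snd D ! r ! s \<in> {0, 1, 2}" using nth_D(1)[OF r] by auto
qed simp

definition stars :: "'a option database \<Rightarrow> nat \<Rightarrow> nat set" where
  "stars E r = {j. j < length C \<and> snd E ! r ! Suc j = None}"

lemma star_cost_D: "star_cost D E = (\<Sum>r<n. card (stars E r))"
proof -
  have "{(r, j). r < length (snd D) \<and> j \<in> columns Quasi_Identifier D \<and> snd E ! r ! j = None} =
      (SIGMA r:{..<n}. Suc ` stars E r)"
    by (auto simp: columns_D length_D stars_def)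
  then show ?thesis by (simp add: star_cost_def stars_def card_image)
qed

lemma card_col_indices:
  assumes "A \<subseteq> set C"
  shows "card {j. j < length C \<and> C ! j \<in> A} = card A"
proof -
  have inj: "inj_on ((!) C) {j. j < length C \<and> C ! j \<in> A}"
    using distinct_cols[OF dist] by (auto intro: inj_on_subset[OF inj_on_nth])
  have "(!) C ` {j. j < length C \<and> C ! j \<in> A} = A"
    using assms by (auto simp: image_iff in_set_conv_nth subset_eq) metis
  with card_image[OF inj] show ?thesis by simp
qed

text \<open>Arcs increase the colour, which rules out the two cyclic orientations; the six others
  are transitive.\<close>

lemma triangle_order:
  assumes "adj arc a b" "adj arc a c" "adj arc b c"
  obtains a' b' c' where "{a, b, c} = {a', b', c'}" "arc a' b'" "arc a' c'" "arc b' c'"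
proof -
  have no: "\<not> (arc x y \<and> arc y z \<and> arc z x)" for x y z
    using arc_col[of x y] arc_col[of y z] arc_col[of z x] by auto
  consider "arc a b" "arc a c" "arc b c" | "arc a b" "arc a c" "arc c b"
    | "arc b a" "arc a c" "arc b c" | "arc a b" "arc c a" "arc c b"
    | "arc b a" "arc c a" "arc b c" | "arc b a" "arc c a" "arc c b"
    using assms no[of a b c] no[of a c b] unfolding adj_def by blast
  then show thesis
  proof cases
    case 1 then show ?thesis by (intro that[of a b c]) auto
  next
    case 2 then show ?thesis by (intro that[of a c b]) auto
  next
    case 3 then show ?thesis by (intro that[of b a c]) auto
  next
    case 4 then show ?thesis by (intro that[of c a b]) auto
  next
    case 5 then show ?thesis by (intro that[of b c a]) auto
  next
    case 6 then show ?thesis by (intro that[of c b a]) auto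
  qed
qed

text \<open>The groups are the classes of rows with equal quasi-identifiers after suppression.
  Diversity puts at least three rows into each, every row has stars in all mixed columns of its
  class, and the budget makes the lower bound of \<open>mixed_ge\<close> tight for every
  row.\<close>

lemma partition_if_cheap:
  assumes sol: "diverse_solution 3 D E" and cost: "star_cost D E \<le> n * (6 * n - 6)"
  shows "\<exists>P. triangle_partition arc V P"
proof -
  have sup: "suppression D E" and div: "diverse 3 E" using sol by (auto simp: diverse_solution_def)
  have fstE: "fst E = fst D" and lenE: "length (snd E) = n"
    using sup by (auto simp: suppression_def length_D)
  have colE: "columns a E = columns a D" for a by (simp add: columns_def fstE)
  have ent: "snd E ! r ! Suc j = Some (of_bool (mark arc (vs ! r) (C ! j))) \<or> snd E ! r ! Suc j = None"
    if "r < n" "j < length C" for r j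
    using sup that unfolding suppression_def length_D
    by (metis Suc_mono nth_D(2))
  have sens: "snd E ! r ! 0 = Some (col (vs ! r))" if "r < n" for r
    using sup that unfolding suppression_def length_D columns_D
    by (metis imageE nth_D(1) old.nat.distinct(1) zero_less_Suc)
  define R where "R r = {s. s < n \<and> (\<forall>j<length C. snd E ! s ! Suc j = snd E ! r ! Suc j)}" for r
  define X where "X r = (!) vs ` R r" for r
  have inj: "inj_on ((!) vs) {..<n}" using dist by (simp add: inj_on_nth)
  have Rsub: "R r \<subseteq> {..<n}" for r unfolding R_def by auto
  have cardX: "card (X r) = card (R r)" for r
    unfolding X_def by (rule card_image[OF inj_on_subset[OF inj Rsub]])
  have XV: "X r \<subseteq> V" for r unfolding X_def R_def by auto
  have X3: "3 \<le> card (X r)" if r: "r < n" for r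
  proof -
    obtain u :: "nat \<Rightarrow> nat" where u: "u 0 = r" "inj_on u {..<3}" "u ` {..<3} \<subseteq> {..<n}"
      and "\<forall>q\<in>Suc ` {..<length C}. \<forall>i j. i < j \<and> j < 3 \<longrightarrow> snd E ! u i ! q = snd E ! u j ! q"
      using div[unfolded diverse_def lenE colE columns_D, THEN spec, THEN mp, OF r]
      by (elim exE conjE) (rule that)
    then have u4: "snd E ! u i ! Suc j = snd E ! u k ! Suc j" if "j < length C" "i < k" "k < 3" for j i k
      using that by blast
    have "u ` {..<3} \<subseteq> R r"
    proof
      fix s assume "s \<in> u ` {..<3}"
      then obtain i where i: "i < 3" "s = u i" by auto
      then have "snd E ! s ! Suc j = snd E ! r ! Suc j" if "j < length C" for j
        using u(1) u4[OF that, of 0 i] by (cases "i = 0") auto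
      then show "s \<in> R r" unfolding R_def using i u(3) by auto
    qed
    from card_mono[OF finite_subset[OF Rsub] this] show ?thesis
      using u(2) by (simp add: card_image cardX)
  qed
  have mixed_stars: "card (mixed (X r)) \<le> card (stars E r)" if r: "r < n" for r
  proof -
    have "{j. j < length C \<and> C ! j \<in> mixed (X r)} \<subseteq> stars E r"
    proof
      fix j assume "j \<in> {j. j < length C \<and> C ! j \<in> mixed (X r)}"
      then obtain s t where j: "j < length C" and st: "s \<in> R r" "t \<in> R r"
        "mark arc (vs ! s) (C ! j) \<noteq> mark arc (vs ! t) (C ! j)"
        unfolding mixed_def X_def by auto
      have "snd E ! s ! Suc j = snd E ! r ! Suc j" "snd E ! t ! Suc j = snd E ! r ! Suc j" "s < n" "t < n"
        using st j unfolding R_def by auto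
      with ent[of s j] ent[of t j] j st(3) show "j \<in> stars E r"
        unfolding stars_def by (auto simp: of_bool_def split: if_splits)
    qed
    then have "card {j. j < length C \<and> C ! j \<in> mixed (X r)} \<le> card (stars E r)"
      by (rule card_mono[rotated]) (simp add: stars_def)
    then show ?thesis using card_col_indices[of "mixed (X r)"] unfolding mixed_def by auto
  qed
  have ge: "6 * n - 6 \<le> card (stars E r)" if "r < n" for r
    using mixed_ge(1)[OF XV X3[OF that]] mixed_stars[OF that] by linarith
  \<comment> \<open>The budget is \<open>n\<close> times the lower bound for one row, so a single
    expensive row would exceed it.\<close>
  have eq: "card (stars E r) = 6 * n - 6" if r: "r < n" for r
  proof (rule ccontr)
    assume "card (stars E r) \<noteq> 6 * n - 6"
    then have "6 * n - 6 < card (stars E r)" using ge[OF r] by simp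
    then have "(\<Sum>r<n. 6 * n - 6) < (\<Sum>r<n. card (stars E r))"
      using ge r by (intro sum_strict_mono_ex1) auto
    then show False using cost unfolding star_cost_D by simp
  qed
  have tri: "\<exists>a b c. X r = {a, b, c} \<and> X r \<subseteq> V \<and> arc a b \<and> arc a c \<and> arc b c" if r: "r < n" for r
  proof -
    have "card (mixed (X r)) = 6 * n - 6"
      using mixed_stars[OF r] mixed_ge(1)[OF XV X3[OF r]] eq[OF r] by linarith
    then have 3: "card (X r) = 3" and ad: "\<forall>a\<in>X r. \<forall>b\<in>X r. a \<noteq> b \<longrightarrow> adj arc a b"
      using mixed_ge(2)[OF XV X3[OF r]] by auto
    then obtain a b c where abc: "X r = {a, b, c}" "a \<noteq> b" "a \<noteq> c" "b \<noteq> c"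
      using card_3_iff by metis
    then have "adj arc a b" "adj arc a c" "adj arc b c" using ad by auto
    then obtain a' b' c' where "{a, b, c} = {a', b', c'}" "arc a' b'" "arc a' c'" "arc b' c'"
      by (rule triangle_order)
    then show ?thesis using abc(1) XV[of r] by metis
  qed
  have "triangle_partition arc V (X ` {..<n})"
    unfolding triangle_partition_def
  proof (intro conjI ballI)
    fix v assume "v \<in> V"
    then obtain r where r: "r < n" "v = vs ! r" by (auto simp: in_set_conv_nth)
    show "\<exists>!Y. Y \<in> X ` {..<n} \<and> v \<in> Y"
    proof (rule ex1I[of _ "X r"])
      show "X r \<in> X ` {..<n} \<and> v \<in> X r" using r by (auto simp: X_def R_def)
    next
      fix Y assume Y: "Y \<in> X ` {..<n} \<and> v \<in> Y"
      then obtain s t where s: "Y = X s" "t \<in> R s" "vs ! t = vs ! r" unfolding X_def r(2) by auto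
      then have "t = r" using inj r Rsub unfolding inj_on_def by blast
      then have "R s = R r" using s(2) unfolding R_def by auto
      then show "Y = X r" using s(1) unfolding X_def by simp
    qed
  qed (use tri in auto)
  then show ?thesis by blast
qed

text \<open>Each row is starred exactly in the mixed columns of its triangle. The three sensitive
  values of a triangle differ since arcs increase the colour.\<close>

lemma cheap_if_partition:
  assumes P: "triangle_partition arc V P"
  shows "\<exists>E. diverse_solution 3 D E \<and> star_cost D E \<le> n * (6 * n - 6)"
proof -
  define X where "X u = (THE X. X \<in> P \<and> u \<in> X)" for u
  have ex1: "\<exists>!X. X \<in> P \<and> u \<in> X" if "u \<in> V" for u
    using bspec[OF conjunct2[OF P[unfolded triangle_partition_def]] that] .
  have X: "X u \<in> P" "u \<in> X u" if "u \<in> V" for u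
    using theI'[OF ex1[OF that]] unfolding X_def by blast+
  have tri: "\<exists>a b c. Y = {a, b, c} \<and> Y \<subseteq> V \<and> arc a b \<and> arc a c \<and> arc b c" if "Y \<in> P" for Y
    using bspec[OF conjunct1[OF P[unfolded triangle_partition_def]] that] .
  have Xeq: "X v = X u" if "u \<in> V" "v \<in> X u" for u v
  proof -
    have "v \<in> V" using tri[OF X(1)[OF that(1)]] that(2) by blast
    from the1_equality[OF ex1[OF this]] X(1)[OF that(1)] that(2) show ?thesis
      unfolding X_def[of v] by blast
  qed
  define E where "E = (fst D, map (\<lambda>u. Some (col u) #
    map (\<lambda>c. if c \<in> mixed (X u) then None else Some (of_bool (mark arc u c) :: nat)) C) vs)"
  have E0: "snd E ! r ! 0 = Some (col (vs ! r))" if "r < n" for r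
    using that by (simp add: E_def)
  have E1: "snd E ! r ! Suc j =
      (if C ! j \<in> mixed (X (vs ! r)) then None else Some (of_bool (mark arc (vs ! r) (C ! j))))"
    if "r < n" "j < length C" for r j
    using that by (simp add: E_def)
  have lenE: "length (snd E) = n" by (simp add: E_def)
  have colE: "columns a E = columns a D" for a by (simp add: columns_def E_def)
  have sup: "suppression D E"
    unfolding suppression_def length_D columns_D
  proof (intro conjI allI impI)
    show "wf_database E" by (auto simp: wf_database_def E_def graph_db_def)
    fix r j assume rj: "r < n" "j < Suc (length C)"
    show "snd E ! r ! j = Some (snd D ! r ! j) \<or> j \<in> Suc ` {..<length C} \<and> snd E ! r ! j = None"
    proof (cases j)
      case 0
      then show ?thesis using E0 nth_D(1) rj by simp
    next
      case (Suc i)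
      then show ?thesis using E1[of r i] nth_D(2)[of r i] rj by auto
    qed
  qed (simp_all add: E_def)
  have Erow: "snd E ! s ! Suc j = snd E ! r ! Suc j"
    if "r < n" "s < n" "vs ! s \<in> X (vs ! r)" "j < length C" for r s j
  proof -
    have rV: "vs ! r \<in> V" using that by simp
    have "X (vs ! s) = X (vs ! r)" using Xeq[OF rV that(3)] .
    moreover have "mark arc (vs ! s) (C ! j) = mark arc (vs ! r) (C ! j)" if "C ! j \<notin> mixed (X (vs ! r))"
    proof (rule ccontr)
      assume "mark arc (vs ! s) (C ! j) \<noteq> mark arc (vs ! r) (C ! j)"
      then have "\<exists>u\<in>X (vs ! r). \<exists>v\<in>X (vs ! r). mark arc u (C ! j) \<noteq> mark arc v (C ! j)"
        using \<open>vs ! s \<in> X (vs ! r)\<close> X(2)[OF rV] by (intro bexI[of _ "vs ! s"] bexI[of _ "vs ! r"])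
      moreover have "C ! j \<in> set C" using \<open>j < length C\<close> by (rule nth_mem)
      ultimately have "C ! j \<in> mixed (X (vs ! r))" unfolding mixed_def by blast
      with that show False by (rule notE)
    qed
    ultimately show ?thesis using E1[OF that(1,4)] E1[OF that(2,4)] by simp
  qed
  have "diverse 3 E"
    unfolding diverse_def lenE colE columns_D
  proof (intro allI impI)
    fix r assume r: "r < n"
    then have rV: "vs ! r \<in> V" by simp
    obtain a b c where abc: "X (vs ! r) = {a, b, c}" "{a, b, c} \<subseteq> V" "arc a b" "arc a c" "arc b c"
      using tri[OF X(1)[OF rV]] by metis
    then have ne: "col a \<noteq> col b" "col a \<noteq> col c" "col b \<noteq> col c" using arc_col by fastforce+
    have "vs ! r \<in> {a, b, c}" using X(2)[OF rV] abc(1) by simp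
    then obtain b' c' where bc: "X (vs ! r) = {vs ! r, b', c'}" "b' \<in> V" "c' \<in> V"
      "col (vs ! r) \<noteq> col b'" "col (vs ! r) \<noteq> col c'" "col b' \<noteq> col c'"
    proof -
      have V: "a \<in> V" "b \<in> V" "c \<in> V" using abc(2) by auto
      consider "vs ! r = a" | "vs ! r = b" | "vs ! r = c" using \<open>vs ! r \<in> {a, b, c}\<close> by blast
      then show thesis
      proof cases
        case 1 then show ?thesis using abc(1) ne V by (intro that[of b c]) auto
      next
        case 2 then show ?thesis using abc(1) ne V by (intro that[of a c]) auto
      next
        case 3 then show ?thesis using abc(1) ne V by (intro that[of a b]) auto
      qed
    qed
    then obtain s t where s: "s < n" "vs ! s = b'" and t: "t < n" "vs ! t = c'"
      by (metis in_set_conv_nth)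
    define u where "u i = (if i = 0 then r else if i = 1 then s else t)" for i :: nat
    have u0: "u 0 = r" by (simp add: u_def)
    have un: "u i < n" "vs ! u i \<in> X (vs ! r)" for i
      using r s t bc(1) by (auto simp: u_def)
    have cu: "col (vs ! u i) \<noteq> col (vs ! u j)" if "i < j" "j < 3" for i j
    proof -
      have "i = 0 \<and> j = 1 \<or> i = 0 \<and> j = 2 \<or> i = 1 \<and> j = 2" using that by auto
      then show ?thesis using bc s t by (auto simp: u_def)
    qed
    have "inj_on u {..<3}"
      unfolding inj_on_def using cu by (metis lessThan_iff linorder_neqE_nat)
    moreover have "u ` {..<3} \<subseteq> {..<n}" using un by auto
    moreover have "snd E ! u i ! q = snd E ! u j ! q" if "q \<in> Suc ` {..<length C}" for q i j
      using that Erow[OF r un(1) un(2)] by auto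
    moreover have "snd E ! u i ! 0 \<noteq> snd E ! u j ! 0" if "i < j" "j < 3" for i j
      using cu[OF that] E0 un(1) by auto
    ultimately show "\<exists>u :: nat \<Rightarrow> nat. u 0 = r \<and> inj_on u {..<3} \<and> u ` {..<3} \<subseteq> {..<n} \<and>
        (\<forall>q\<in>Suc ` {..<length C}. \<forall>i j. i < j \<and> j < 3 \<longrightarrow> snd E ! u i ! q = snd E ! u j ! q) \<and>
        (\<forall>s\<in>{0}. \<forall>i j. i < j \<and> j < 3 \<longrightarrow> snd E ! u i ! s \<noteq> snd E ! u j ! s)"
      using u0 by (intro exI[of _ u]) blast
  qed
  moreover have "star_cost D E = n * (6 * n - 6)"
  proof -
    have "card (stars E r) = 6 * n - 6" if r: "r < n" for r
    proof -
      have rV: "vs ! r \<in> V" using r by simp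
      obtain a b c where abc: "X (vs ! r) = {a, b, c}" "{a, b, c} \<subseteq> V" "arc a b" "arc a c" "arc b c"
        using tri[OF X(1)[OF rV]] by metis
      have "stars E r = {j. j < length C \<and> C ! j \<in> mixed (X (vs ! r))}"
        using E1[OF r] by (auto simp: stars_def split: if_splits)
      then have "card (stars E r) = card (mixed (X (vs ! r)))"
        using card_col_indices[of "mixed (X (vs ! r))"] unfolding mixed_def by auto
      then show ?thesis using mixed_triangle abc by simp
    qed
    then show ?thesis by (simp add: star_cost_D)
  qed
  ultimately show ?thesis using sup unfolding diverse_solution_def by (intro exI[of _ E]) simp
qed

theorem budget_iff_partition:
  "(\<exists>E. optimal_solution (diverse_solution 3) star_cost D E \<and> star_cost D E \<le> n * (6 * n - 6)) \<longleftrightarrow>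
    (\<exists>P. triangle_partition arc V P)"
  unfolding optimal_solution_budget using partition_if_cheap cheap_if_partition by blast

end

section \<open>Tilings of a torus and rainbow triangles\<close>

text \<open>The first argument is the part of the vertex. For a tile \<open>T\<close> at a position,
  the vertices \<open>Inc 1 T j\<close> and \<open>Inc 2 T j\<close> form a cycle with two perfect
  matchings. One matching joins \<open>j\<close> with \<open>j\<close> and is completed to triangles
  by \<open>Ele 0\<close> vertices: the tile is chosen. The other joins \<open>j\<close> with the
  next index and is completed by the vertices \<open>Inc 0 T j\<close>: the tile is not chosen. A
  chosen tile leaves its \<open>Inc 0\<close> vertices over; they are absorbed by
  \<open>Ele 1\<close> and \<open>Ele 2\<close> of the same elements.\<close>

datatype ('a, 'c) tag = Ele nat "nat \<times> 'c" | Inc nat 'a nat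

type_synonym pos = "nat \<times> nat"

fun tag_col :: "('a, 'c) tag \<times> pos \<Rightarrow> nat" where
  "tag_col (Ele v e, p) = v"
| "tag_col (Inc v T j, p) = v"

fun nb :: "nat \<Rightarrow> nat \<Rightarrow> pos \<Rightarrow> pos" where
  "nb N k (t, i) = (if k = 0 then (t, i)
     else if k = 1 then (t, if Suc i = N then 0 else Suc i) else (if Suc t = N then 0 else Suc t, i))"

text \<open>
  A tile at position \<open>p\<close> has an incoming colour and an outgoing colour in each of three directions:
  \<open>1\<close> (horizontal), \<open>2\<close> (vertical) and \<open>0\<close>, where the neighbour of \<open>p\<close> is \<open>p\<close> itself and there is
  one colour only. The element \<open>((k, c), p)\<close> stands for the colour \<open>c\<close> on the edge that enters \<open>p\<close>
  in direction \<open>k\<close>. A tile covers the elements of its incoming edges with a colour other than its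
  own, and those of its outgoing edges with its own colour. So an edge is covered
  exactly once iff the colours on both sides agree. In direction \<open>0\<close> this says that
  each position gets exactly one tile. Every tile covers as many elements as there are pairs
  \<open>(k, c)\<close>, and \<open>el\<close> enumerates them by these pairs.
\<close>

fun el :: "nat \<Rightarrow> (nat \<Rightarrow> 'a \<Rightarrow> 'c) \<Rightarrow> (nat \<Rightarrow> 'a \<Rightarrow> 'c) \<Rightarrow> 'a \<Rightarrow> pos \<Rightarrow> nat \<times> 'c \<Rightarrow> (nat \<times> 'c) \<times> pos"
  where
  "el N inn out T p (k, c) = (if c = inn k T then ((k, out k T), nb N k p) else ((k, c), p))"

locale torus =
  fixes tiles :: "'a list" and cat :: "'a \<Rightarrow> nat" and inn out :: "nat \<Rightarrow> 'a \<Rightarrow> 'c"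
    and c0 :: 'c and jl :: "(nat \<times> 'c) list" and N :: nat and kappa :: "pos \<Rightarrow> nat"
  assumes dist_tiles: "distinct tiles" and dist_jl: "distinct jl" and N: "2 \<le> N"
    and jl_dir: "(k, c) \<in> set jl \<Longrightarrow> k < 3"
    and jl_zero: "(0, c) \<in> set jl \<longleftrightarrow> c = c0"
    and jl_tile: "T \<in> set tiles \<Longrightarrow> k < 3 \<Longrightarrow> (k, inn k T) \<in> set jl \<and> (k, out k T) \<in> set jl"
begin

abbreviation "m \<equiv> length jl"
abbreviation "elt T p j \<equiv> el N inn out T p (jl ! j)"
abbreviation "nx j \<equiv> Suc j mod m"
abbreviation "Pos \<equiv> {..<N} \<times> {..<N}"

text \<open>The input matters only through the test \<open>kappa p' = cat T\<close>: without these
  arcs the triangles that choose \<open>T\<close> do not exist. All other arcs depend on the torus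
  size at most.\<close>

fun arc :: "('a, 'c) tag \<times> pos \<Rightarrow> ('a, 'c) tag \<times> pos \<Rightarrow> bool" where
  "arc (Ele v e, p) (Ele w e', p') \<longleftrightarrow> v = 1 \<and> w = 2 \<and> e = e' \<and> p = p'"
| "arc (Ele v e, p) (Inc w T j, p') \<longleftrightarrow>
    v = 0 \<and> (w = 1 \<or> w = 2) \<and> kappa p' = cat T \<and> elt T p' j = (e, p)"
| "arc (Inc v T j, p) (Ele w e, p') \<longleftrightarrow> v = 0 \<and> (w = 1 \<or> w = 2) \<and> elt T p j = (e, p')"
| "arc (Inc v T j, p) (Inc w T' j', p') \<longleftrightarrow> p = p' \<and> T = T' \<and>
    (v = 0 \<and> w = 1 \<and> j' = j \<or> v = 0 \<and> w = 2 \<and> j' = nx j \<or>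
     v = 1 \<and> w = 2 \<and> (j' = j \<or> j' = nx j))"

definition tags :: "('a, 'c) tag list" where
  "tags = concat (map (\<lambda>v. map (Ele v) jl) [0, 1, 2]) @
     concat (map (\<lambda>v. concat (map (\<lambda>T. map (Inc v T) [0..<m]) tiles)) [0, 1, 2])"

text \<open>Positions are listed downwards to match the loops of \<open>gen_for\<close>.\<close>

definition verts :: "(('a, 'c) tag \<times> pos) list" where
  "verts = concat (map (\<lambda>g. concat (map (\<lambda>t. map (\<lambda>i. (g, t, i)) (rev [0..<N])) (rev [0..<N]))) tags)"

definition tiling :: "(pos \<Rightarrow> 'a) \<Rightarrow> bool" where
  "tiling \<tau> \<longleftrightarrow> (\<forall>p\<in>Pos. \<tau> p \<in> set tiles \<and> cat (\<tau> p) = kappa p \<and>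
     (\<forall>k\<in>{1, 2}. out k (\<tau> p) = inn k (\<tau> (nb N k p))))"

lemma set_tags:
  "set tags = {Ele v e |v e. v < 3 \<and> e \<in> set jl} \<union> {Inc v T j |v T j. v < 3 \<and> T \<in> set tiles \<and> j < m}"
proof -
  have "v < 3 \<longleftrightarrow> v = 0 \<or> v = 1 \<or> v = 2" for v :: nat by auto
  then show ?thesis unfolding tags_def by auto
qed

lemma set_verts: "set verts = set tags \<times> Pos"
proof -
  have "(g, t, i) \<in> set verts \<longleftrightarrow> g \<in> set tags \<and> t < N \<and> i < N" for g t i
    unfolding verts_def by (auto simp: image_iff)
  then show ?thesis by auto
qed

lemma in_verts:
  "(Ele v e, p) \<in> set verts \<longleftrightarrow> v < 3 \<and> e \<in> set jl \<and> p \<in> Pos"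
  "(Inc v T j, p) \<in> set verts \<longleftrightarrow> v < 3 \<and> T \<in> set tiles \<and> j < m \<and> p \<in> Pos"
proof -
  have "(g, p) \<in> set verts \<longleftrightarrow> g \<in> set tags \<and> p \<in> Pos" for g p
    unfolding set_verts by simp
  then show "(Ele v e, p) \<in> set verts \<longleftrightarrow> v < 3 \<and> e \<in> set jl \<and> p \<in> Pos"
    "(Inc v T j, p) \<in> set verts \<longleftrightarrow> v < 3 \<and> T \<in> set tiles \<and> j < m \<and> p \<in> Pos"
    unfolding set_tags by (cases e, auto)
qed

lemma distinct_tags: "distinct tags"
proof -
  have "distinct (concat (map (\<lambda>T. map (Inc v T) [0..<m]) Ts))" if "distinct Ts" for v and Ts :: "'a list"
    using that by (induction Ts) (auto simp: distinct_map inj_on_def)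
  then show ?thesis unfolding tags_def
    using dist_jl dist_tiles by (auto simp: distinct_map inj_on_def)
qed

lemma length_verts: "length verts = length tags * (N * N)"
proof -
  have "length (concat (map (\<lambda>t. map (\<lambda>i. (g, t, i)) us) ts)) = length ts * length us" for g :: "('a, 'c) tag" and us ts :: "nat list"
    by (induction ts) auto
  then have "length (concat (map (\<lambda>g. concat (map (\<lambda>t. map (\<lambda>i. (g, t, i)) (rev [0..<N])) (rev [0..<N]))) gs)) =
      length gs * (N * N)" for gs :: "('a, 'c) tag list"
    by (induction gs) auto
  then show ?thesis unfolding verts_def by simp
qed

lemma distinct_verts: "distinct verts"
  by (rule card_distinct)
    (simp add: set_verts length_verts card_cartesian_product distinct_card[OF distinct_tags])

lemma rainbow: "rainbow_graph verts tag_col arc"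
proof
  show "distinct verts" by (rule distinct_verts)
  have "Ele 0 (0, c0) \<in> set tags" using jl_zero[of c0] by (simp add: set_tags)
  then have "1 \<le> length tags" by (cases tags) auto
  from mult_le_mono[OF this mult_le_mono[OF N N]] have "4 \<le> length tags * (N * N)" by simp
  then show "4 \<le> length verts" by (simp add: length_verts)
  show "tag_col v < 3" if "v \<in> set verts" for v
    using that by (cases v rule: tag_col.cases) (auto simp: in_verts)
  show "tag_col a < tag_col b" if "arc a b" for a b
    using that by (cases "(a, b)" rule: arc.cases) auto
qed

lemma nb_eq:
  assumes "t < N" "i < N"
  shows "nb N k (t, i) = (if k = 0 then (t, i) else if k = 1 then (t, Suc i mod N) else (Suc t mod N, i))"
  using assms by auto

declare nb.simps [simp del]

lemma nb_Pos: "p \<in> Pos \<Longrightarrow> nb N k p \<in> Pos"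
  using N by (cases p) (auto simp: nb_eq)

lemma Suc_mod_inj: "i < N \<Longrightarrow> i' < N \<Longrightarrow> Suc i mod N = Suc i' mod N \<Longrightarrow> i = i'"
  by (metis (no_types) Suc_inject Suc_lessI mod_less mod_self nat.distinct(1))

lemma Suc_mod_neq: "i < N \<Longrightarrow> Suc i mod N \<noteq> i"
  using N by (cases "Suc i = N") auto

lemma Suc_mod_ex: "j < n \<Longrightarrow> \<exists>i<n. Suc i mod n = j"
  by (cases j) (auto intro: exI[of _ "n - 1"] exI[of _ "j - 1"])

lemma nb_neq: "p \<in> Pos \<Longrightarrow> k \<noteq> 0 \<Longrightarrow> nb N k p \<noteq> p"
  using Suc_mod_neq by (cases p) (auto simp: nb_eq)

lemma nb_inj: "p \<in> Pos \<Longrightarrow> q \<in> Pos \<Longrightarrow> nb N k p = nb N k q \<Longrightarrow> p = q"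
  by (cases p; cases q) (auto simp: nb_eq split: if_splits dest: Suc_mod_inj)

lemma nb_surj:
  assumes "q \<in> Pos"
  shows "\<exists>p\<in>Pos. nb N k p = q"
proof -
  obtain t i where q: "q = (t, i)" "t < N" "i < N" using assms by auto
  obtain t' i' where *: "t' < N" "Suc t' mod N = t" "i' < N" "Suc i' mod N = i"
    using Suc_mod_ex[OF q(2)] Suc_mod_ex[OF q(3)] by blast
  consider "k = 0" | "k = 1" | "k \<noteq> 0" "k \<noteq> 1" by blast
  then show ?thesis
  proof cases
    case 1 then show ?thesis using q by (intro bexI[of _ "(t, i)"]) (simp_all add: nb_eq)
  next
    case 2 then show ?thesis using q * by (intro bexI[of _ "(t, i')"]) (simp_all add: nb_eq)
  next
    case 3 then show ?thesis using q * by (intro bexI[of _ "(t', i)"]) (simp_all add: nb_eq)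
  qed
qed

text \<open>Two pairs with the same direction could collide only if one is moved to the neighbour,
  the other stays, and the neighbour is \<open>p\<close> itself. That happens in direction
  \<open>0\<close> alone, where there is only one colour.\<close>

lemma el_inj:
  assumes "T \<in> set tiles" "p \<in> Pos" "j < m" "j' < m" "elt T p j = elt T p j'"
  shows "j = j'"
proof -
  obtain k c k' c' where kc: "jl ! j = (k, c)" "jl ! j' = (k', c')" by fastforce
  have mem: "(k, c) \<in> set jl" "(k', c') \<in> set jl" using kc assms(3,4) nth_mem by metis+
  have "k = k'" using assms(5) kc by (auto split: if_splits)
  moreover have "c = c'"
  proof (rule ccontr)
    assume ne: "c \<noteq> c'"
    with assms(5) kc \<open>k = k'\<close> have "nb N k p = p" by (auto split: if_splits)
    then have "k = 0" using nb_neq assms(2) by blast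
    then show False using jl_zero mem \<open>k = k'\<close> ne by auto
  qed
  ultimately show ?thesis using kc assms(3,4) dist_jl nth_eq_iff_index_eq by metis
qed

lemma el_mem:
  assumes "T \<in> set tiles" "p \<in> Pos" "j < m"
  shows "fst (elt T p j) \<in> set jl" "snd (elt T p j) \<in> Pos"
proof -
  obtain k c where kc: "jl ! j = (k, c)" by fastforce
  then have "(k, c) \<in> set jl" using assms(3) nth_mem by metis
  then show "fst (elt T p j) \<in> set jl" "snd (elt T p j) \<in> Pos"
    using kc jl_dir[of k c] jl_tile[OF assms(1), of k] nb_Pos[OF assms(2), of k] assms(2) by auto
qed

section \<open>The triangles of the ring gadget\<close>

definition triA :: "'a \<Rightarrow> pos \<Rightarrow> nat \<Rightarrow> (('a, 'c) tag \<times> pos) set" where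
  "triA T p j = {(Ele 0 (fst (elt T p j)), snd (elt T p j)), (Inc 1 T j, p), (Inc 2 T j, p)}"

definition triB :: "'a \<Rightarrow> pos \<Rightarrow> nat \<Rightarrow> (('a, 'c) tag \<times> pos) set" where
  "triB T p j = {(Inc 0 T j, p), (Inc 1 T j, p), (Inc 2 T (nx j), p)}"

definition triC :: "'a \<Rightarrow> pos \<Rightarrow> nat \<Rightarrow> (('a, 'c) tag \<times> pos) set" where
  "triC T p j = {(Inc 0 T j, p), (Ele 1 (fst (elt T p j)), snd (elt T p j)),
     (Ele 2 (fst (elt T p j)), snd (elt T p j))}"

lemma mem_tri:
  "(Ele v e, q) \<in> triA T p j \<longleftrightarrow> v = 0 \<and> elt T p j = (e, q)"
  "(Inc v T' j', q) \<in> triA T p j \<longleftrightarrow> (v = 1 \<or> v = 2) \<and> T' = T \<and> j' = j \<and> q = p"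
  "(Ele v e, q) \<in> triB T p j \<longleftrightarrow> False"
  "(Inc v T' j', q) \<in> triB T p j \<longleftrightarrow> T' = T \<and> q = p \<and>
    (v = 0 \<and> j' = j \<or> v = 1 \<and> j' = j \<or> v = 2 \<and> j' = nx j)"
  "(Ele v e, q) \<in> triC T p j \<longleftrightarrow> (v = 1 \<or> v = 2) \<and> elt T p j = (e, q)"
  "(Inc v T' j', q) \<in> triC T p j \<longleftrightarrow> v = 0 \<and> T' = T \<and> j' = j \<and> q = p"
  unfolding triA_def triB_def triC_def by (auto simp: prod_eq_iff)

lemma nx_less: "j < m \<Longrightarrow> nx j < m"
  by (cases m) auto

text \<open>Excludes unintended triangles. An element joined with \<open>Inc 1 T j\<close> and
  \<open>Inc 2 T j'\<close> forces \<open>j' = j\<close> by \<open>el_inj\<close>, and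
  \<open>Inc 0 T j\<close> in a ring triangle selects the successor index.\<close>

lemma triangle_cases:
  assumes V: "{a, b, c} \<subseteq> set verts" and arcs: "arc a b" "arc a c" "arc b c"
  shows "\<exists>T p j. T \<in> set tiles \<and> p \<in> Pos \<and> j < m \<and>
    (kappa p = cat T \<and> {a, b, c} = triA T p j \<or> {a, b, c} = triB T p j \<or> {a, b, c} = triC T p j)"
proof -
  have lt: "tag_col c < 3"
    using V by (cases c rule: tag_col.cases) (auto simp: in_verts)
  have less: "tag_col a < tag_col b" "tag_col b < tag_col c"
    using rainbow_graph.arc_col[OF rainbow] arcs by blast+
  then have col: "tag_col a = 0" "tag_col b = 1" "tag_col c = 2" using lt by linarith+
  show ?thesis
  proof (cases a rule: tag_col.cases)
    case (1 v e p)
    then have a: "a = (Ele 0 e, p)" using col by simp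
    obtain T j q where b: "b = (Inc 1 T j, q)"
      using arcs(1) col(2) a by (cases b rule: tag_col.cases) auto
    obtain T' j' q' where c: "c = (Inc 2 T' j', q')"
      using arcs(2) col(3) a by (cases c rule: tag_col.cases) auto
    have eq: "T' = T" "q' = q" using arcs(3) b c by auto
    have el: "kappa q = cat T" "elt T q j = (e, p)" "elt T q j' = (e, p)"
      using arcs a b c eq by auto
    have mem: "T \<in> set tiles" "q \<in> Pos" "j < m" "j' < m" using V b c in_verts eq by auto
    from el_inj[OF this] el have "j' = j" by simp
    then have "{a, b, c} = triA T q j" using a b c eq el by (simp add: triA_def)
    then show ?thesis using mem el(1) by blast
  next
    case (2 v T j p)
    then have a: "a = (Inc 0 T j, p)" using col by simp
    have mem: "T \<in> set tiles" "p \<in> Pos" "j < m" using V a in_verts by auto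
    show ?thesis
    proof (cases b rule: tag_col.cases)
      case (1 v e q)
      then have b: "b = (Ele 1 e, q)" using col by simp
      have c: "c = (Ele 2 e, q)"
        using arcs(3) col(3) b by (cases c rule: tag_col.cases) auto
      have "elt T p j = (e, q)" using arcs(1) a b by simp
      then have "{a, b, c} = triC T p j" using a b c by (simp add: triC_def)
      then show ?thesis using mem by blast
    next
      case (2 v T' j' p')
      then have b: "b = (Inc 1 T j, p)" using arcs(1) a col by auto
      then obtain T'' j'' p'' where c: "c = (Inc 2 T'' j'', p'')"
        using arcs(3) col(3) by (cases c rule: tag_col.cases) auto
      then have "{a, b, c} = triB T p j" using arcs(2) a b by (auto simp: triB_def)
      then show ?thesis using mem by blast
    qed
  qed
qed

text \<open>Choosing a tile at one index spreads around its ring to all indices. The direction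
  \<open>0\<close> element of a position then yields a tile there, and differing colours on an edge
  would let two positions cover the same element.\<close>

lemma tiling_if_partition:
  assumes P: "triangle_partition arc (set verts) P"
  shows "\<exists>\<tau>. tiling \<tau>"
proof -
  have ex1: "\<exists>!X. X \<in> P \<and> u \<in> X" if "u \<in> set verts" for u
    using bspec[OF conjunct2[OF P[unfolded triangle_partition_def]] that] .
  have eq: "X = Y" if "u \<in> set verts" "X \<in> P" "Y \<in> P" "u \<in> X" "u \<in> Y" for u X Y
    using ex1[OF that(1)] that by blast
  have tri: "\<exists>T p j. T \<in> set tiles \<and> p \<in> Pos \<and> j < m \<and>
      (kappa p = cat T \<and> X = triA T p j \<or> X = triB T p j \<or> X = triC T p j)" if X: "X \<in> P" for X
  proof -
    obtain a b c where abc: "X = {a, b, c}" "X \<subseteq> set verts" "arc a b" "arc a c" "arc b c"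
      using bspec[OF conjunct1[OF P[unfolded triangle_partition_def]] X] by blast
    from triangle_cases[of a b c] show ?thesis using abc by simp
  qed
  have inner: "u \<in> set verts" if "u \<in> triA T p j" "T \<in> set tiles" "p \<in> Pos" "j < m" for u T p j
    using that el_mem[of T p j] by (cases u rule: tag_col.cases) (auto simp: mem_tri in_verts)
  have on_cat: "kappa p = cat T" if on: "triA T p j \<in> P" for T p j
  proof -
    have u: "(Inc 1 T j, p) \<in> triA T p j" by (simp add: mem_tri)
    obtain T' p' j' where "kappa p' = cat T' \<and> triA T p j = triA T' p' j' \<or>
        triA T p j = triB T' p' j' \<or> triA T p j = triC T' p' j'"
      using tri[OF on] by blast
    then consider "kappa p' = cat T'" "triA T p j = triA T' p' j'"
      | "triA T p j = triB T' p' j'" | "triA T p j = triC T' p' j'" by blast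
    then show ?thesis
    proof cases
      case 1
      then have "(Inc 1 T j, p) \<in> triA T' p' j'" using u by simp
      then show ?thesis using 1(1) by (simp add: mem_tri)
    next
      case 2
      then have "(Inc 0 T' j', p') \<in> triA T p j" by (simp add: mem_tri)
      then show ?thesis by (simp add: mem_tri)
    next
      case 3
      then have "(Inc 1 T j, p) \<in> triC T' p' j'" using u by simp
      then show ?thesis by (simp add: mem_tri)
    qed
  qed
  \<comment> \<open>The triangle at \<open>nx j\<close> occupies \<open>Inc 2 T (nx j)\<close>,
    which \<open>triB T p j\<close> would need as well, so \<open>Inc 1 T j\<close> is left to
    \<open>triA T p j\<close>.\<close>
  have on_pred: "triA T p j \<in> P"
    if on: "triA T p (nx j) \<in> P" and T: "T \<in> set tiles" "p \<in> Pos" "j < m" for T p j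
  proof -
    have u: "(Inc 1 T j, p) \<in> set verts" using T by (simp add: in_verts)
    then obtain X where X: "X \<in> P" "(Inc 1 T j, p) \<in> X" using ex1 by blast
    with tri[OF X(1)] have "X = triA T p j \<or> X = triB T p j" by (auto simp: mem_tri)
    moreover have "X \<noteq> triB T p j"
    proof
      assume B: "X = triB T p j"
      have v: "(Inc 2 T (nx j), p) \<in> set verts" using T nx_less by (simp add: in_verts)
      have "X = triA T p (nx j)" by (rule eq[OF v X(1) on]) (simp_all add: B mem_tri)
      moreover have "(Inc 0 T j, p) \<in> X" by (simp add: B mem_tri)
      ultimately show False by (simp add: mem_tri)
    qed
    ultimately show ?thesis using X(1) by simp
  qed
  have on_shift: "triA T p ((j + d) mod m) \<in> P \<Longrightarrow> triA T p j \<in> P"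
    if T: "T \<in> set tiles" "p \<in> Pos" "j < m" for T p j d
  proof (induction d)
    case 0
    then show ?case using T by simp
  next
    case (Suc d)
    have "nx ((j + d) mod m) = (j + Suc d) mod m" by (simp add: mod_Suc_eq)
    moreover have "(j + d) mod m < m" using T(3) by (cases m) auto
    ultimately show ?case using on_pred[of T p "(j + d) mod m"] T Suc by simp
  qed
  have on_all: "triA T p j' \<in> P"
    if on: "triA T p j \<in> P" and T: "T \<in> set tiles" "p \<in> Pos" "j < m" "j' < m" for T p j j'
    \<comment> \<open>This many steps lead from \<open>j'\<close> around the ring to
      \<open>j\<close>.\<close>
    using on_shift[of T p j' "m - j' + j"] on T by simp
  have on_ex: "\<exists>T p j. T \<in> set tiles \<and> p \<in> Pos \<and> j < m \<and> triA T p j \<in> P \<and> elt T p j = (e, q)"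
    if e: "e \<in> set jl" "q \<in> Pos" for e q
  proof -
    have "(Ele 0 e, q) \<in> set verts" using e by (simp add: in_verts)
    then obtain X where X: "X \<in> P" "(Ele 0 e, q) \<in> X" using ex1 by blast
    with tri[OF X(1)] show ?thesis by (auto simp: mem_tri) blast+
  qed
  have on_unique: "p = p'"
    if on: "triA T p j \<in> P" "triA T' p' j' \<in> P" and e: "elt T p j = elt T' p' j'"
      and T: "T \<in> set tiles" "p \<in> Pos" "j < m" for T p j T' p' j'
  proof -
    obtain e q where eq': "elt T p j = (e, q)" by (cases "elt T p j")
    have "(Ele 0 e, q) \<in> triA T p j" "(Ele 0 e, q) \<in> triA T' p' j'"
      using eq' e by (simp_all add: mem_tri)
    with inner[OF _ T] eq on have "triA T p j = triA T' p' j'" by blast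
    then have "(Inc 1 T j, p) \<in> triA T' p' j'" by (metis mem_tri(2))
    then show ?thesis by (simp add: mem_tri)
  qed
  have "\<exists>T. T \<in> set tiles \<and> (\<forall>j<m. triA T p j \<in> P)" if p: "p \<in> Pos" for p
  proof -
    \<comment> \<open>The element \<open>(0, c0)\<close> at \<open>p\<close> can only be covered
      from \<open>p\<close> itself, because in direction \<open>0\<close> every position is its own
      neighbour.\<close>
    obtain T p' j where T: "T \<in> set tiles" "p' \<in> Pos" "j < m" "triA T p' j \<in> P"
      "elt T p' j = ((0, c0), p)"
      using on_ex[of "(0, c0)" p] p jl_zero by blast
    obtain k c where kc: "jl ! j = (k, c)" by fastforce
    then have mem: "(k, c) \<in> set jl" using T(3) nth_mem by metis
    have "k = 0" using T(5) kc by (auto split: if_splits)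
    moreover have "nb N 0 p' = p'" by (cases p') (simp add: nb.simps)
    ultimately have "p' = p" using T(5) kc by (auto split: if_splits)
    then show ?thesis using on_all T by blast
  qed
  then have "\<forall>p\<in>Pos. \<exists>T. T \<in> set tiles \<and> (\<forall>j<m. triA T p j \<in> P)" by blast
  from bchoice[OF this] obtain \<tau>
    where "\<forall>p\<in>Pos. \<tau> p \<in> set tiles \<and> (\<forall>j<m. triA (\<tau> p) p j \<in> P)" by blast
  then have \<tau>: "\<tau> p \<in> set tiles" "\<And>j. j < m \<Longrightarrow> triA (\<tau> p) p j \<in> P" if "p \<in> Pos" for p
    using that by blast+
  have "tiling \<tau>"
    unfolding tiling_def
  proof (intro ballI conjI)
    fix p assume p: "p \<in> Pos"
    show "\<tau> p \<in> set tiles" using \<tau> p by blast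
    have "0 < m" using jl_zero[of c0] by (cases jl) auto
    then show "cat (\<tau> p) = kappa p" using on_cat \<tau>(2)[OF p] by metis
    fix k :: nat assume k: "k \<in> {1, 2}"
    then have k3: "k < 3" by auto
    let ?q = "nb N k p"
    have q: "?q \<in> Pos" using nb_Pos p .
    show "out k (\<tau> p) = inn k (\<tau> ?q)"
    proof (rule ccontr)
      assume ne: "out k (\<tau> p) \<noteq> inn k (\<tau> ?q)"
      obtain j where j: "j < m" "jl ! j = (k, inn k (\<tau> p))"
        using jl_tile[OF \<tau>(1)[OF p] k3] by (metis in_set_conv_nth)
      obtain j' where j': "j' < m" "jl ! j' = (k, out k (\<tau> p))"
        using jl_tile[OF \<tau>(1)[OF p] k3] by (metis in_set_conv_nth)
      \<comment> \<open>The colour \<open>out k (\<tau> p)\<close> on the edge into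
        \<open>?q\<close> is covered by \<open>p\<close> as its outgoing colour, and by
        \<open>?q\<close> as an incoming colour other than its own.\<close>
      have "p = ?q"
        by (rule on_unique[OF \<tau>(2)[OF p j(1)] \<tau>(2)[OF q j'(1)] _ \<tau>(1)[OF p] p j(1)])
          (use j j' ne in simp)
      then show False using nb_neq[OF p, of k] k by auto
    qed
  qed
  then show ?thesis by blast
qed

text \<open>Chosen tiles use \<open>triA\<close> and \<open>triC\<close>, all others
  \<open>triB\<close>. This is a partition because agreement of colours makes every element covered
  exactly once, as \<open>cover\<close> states.\<close>

lemma partition_if_tiling:
  assumes "tiling \<tau>"
  shows "\<exists>P. triangle_partition arc (set verts) P"
proof -
  have \<tau>: "\<tau> p \<in> set tiles" "cat (\<tau> p) = kappa p" if "p \<in> Pos" for p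
    using assms that unfolding tiling_def by blast+
  have match: "out k (\<tau> p) = inn k (\<tau> (nb N k p))" if p: "p \<in> Pos" and k: "k < 3" for k p
  proof (cases "k = 0")
    case True
    then have "out k (\<tau> p) = c0" "inn k (\<tau> p) = c0"
      using jl_tile[OF \<tau>(1)[OF p], of 0] jl_zero by auto
    then show ?thesis using True by (cases p) (simp add: nb.simps)
  next
    case False
    then have "k \<in> {1, 2}" using k by auto
    then show ?thesis using assms p unfolding tiling_def by blast
  qed
  have cover: "\<exists>p\<in>Pos. \<exists>j<m. elt (\<tau> p) p j = (e, q) \<and>
      (\<forall>p'\<in>Pos. \<forall>j'<m. elt (\<tau> p') p' j' = (e, q) \<longrightarrow> p' = p \<and> j' = j)"
    if e: "e \<in> set jl" and q: "q \<in> Pos" for e q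
  proof -
    obtain k c where kc: "e = (k, c)" by (cases e)
    then have k: "k < 3" using jl_dir e by simp
    \<comment> \<open>The colour carried by the edge is covered from the side where the edge leaves,
      every other colour from the side where it enters.\<close>
    have char: "elt (\<tau> p) p j = (e, q) \<longleftrightarrow>
        (if c = inn k (\<tau> q) then nb N k p = q \<and> jl ! j = (k, inn k (\<tau> p)) else p = q \<and> jl ! j = (k, c))"
      if p: "p \<in> Pos" for p j
    proof -
      obtain k' c' where kc': "jl ! j = (k', c')" by fastforce
      show ?thesis using match[OF p k] kc kc' by (auto split: if_splits)
    qed
    have uniq: "p' = p \<and> j' = j"
      if "p \<in> Pos" "j < m" "elt (\<tau> p) p j = (e, q)" "p' \<in> Pos" "j' < m" "elt (\<tau> p') p' j' = (e, q)"
      for p j p' j'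
    proof -
      have 1: "if c = inn k (\<tau> q) then nb N k p = q \<and> jl ! j = (k, inn k (\<tau> p))
          else p = q \<and> jl ! j = (k, c)"
        using that(3) char[OF that(1)] by simp
      have 2: "if c = inn k (\<tau> q) then nb N k p' = q \<and> jl ! j' = (k, inn k (\<tau> p'))
          else p' = q \<and> jl ! j' = (k, c)"
        using that(6) char[OF that(4)] by simp
      have "p' = p"
      proof (cases "c = inn k (\<tau> q)")
        case True
        then show ?thesis using 1 2 nb_inj[OF that(4,1), of k] by simp
      qed (use 1 2 in simp)
      moreover have "jl ! j' = jl ! j" using 1 2 \<open>p' = p\<close> by (simp split: if_splits)
      ultimately show ?thesis using that(2,5) dist_jl nth_eq_iff_index_eq by blast
    qed
    have "\<exists>p\<in>Pos. \<exists>j<m. elt (\<tau> p) p j = (e, q)"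
    proof (cases "c = inn k (\<tau> q)")
      case True
      obtain p where p: "p \<in> Pos" "nb N k p = q" using nb_surj[OF q] by blast
      obtain j where "j < m" "jl ! j = (k, inn k (\<tau> p))"
        using jl_tile[OF \<tau>(1)[OF p(1)] k] by (metis in_set_conv_nth)
      then show ?thesis using True p char[OF p(1)] by auto
    next
      case False
      obtain j where "j < m" "jl ! j = (k, c)" using e kc by (metis in_set_conv_nth)
      then show ?thesis using False q char[OF q] by auto
    qed
    then show ?thesis using uniq by blast
  qed
  define P where "P = {triA (\<tau> p) p j |p j. p \<in> Pos \<and> j < m} \<union> {triC (\<tau> p) p j |p j. p \<in> Pos \<and> j < m} \<union>
    {triB T p j |T p j. T \<in> set tiles \<and> p \<in> Pos \<and> j < m \<and> T \<noteq> \<tau> p}"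
  have P_A: "triA (\<tau> p) p j \<in> P" and P_C: "triC (\<tau> p) p j \<in> P" if "p \<in> Pos" "j < m" for p j
    using that unfolding P_def by blast+
  have P_B: "triB T p j \<in> P" if "T \<in> set tiles" "p \<in> Pos" "j < m" "T \<noteq> \<tau> p" for T p j
    using that unfolding P_def by blast
  have P_cases: "(\<exists>p j. X = triA (\<tau> p) p j \<and> p \<in> Pos \<and> j < m) \<or>
      (\<exists>p j. X = triC (\<tau> p) p j \<and> p \<in> Pos \<and> j < m) \<or>
      (\<exists>T p j. X = triB T p j \<and> T \<in> set tiles \<and> p \<in> Pos \<and> j < m \<and> T \<noteq> \<tau> p)" if "X \<in> P" for X
    using that unfolding P_def by blast
  have "triangle_partition arc (set verts) P"
    unfolding triangle_partition_def
  proof (intro conjI ballI)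
    fix X assume "X \<in> P"
    from P_cases[OF this] consider p j where "X = triA (\<tau> p) p j" "p \<in> Pos" "j < m"
      | p j where "X = triC (\<tau> p) p j" "p \<in> Pos" "j < m"
      | T p j where "X = triB T p j" "T \<in> set tiles" "p \<in> Pos" "j < m"
      by blast
    then show "\<exists>a b c. X = {a, b, c} \<and> X \<subseteq> set verts \<and> arc a b \<and> arc a c \<and> arc b c"
    proof cases
      case 1
      have "X \<subseteq> set verts" using 1 \<tau> el_mem[of "\<tau> p" p j] by (auto simp: triA_def in_verts)
      moreover let ?x = "(Ele 0 (fst (elt (\<tau> p) p j)), snd (elt (\<tau> p) p j))"
        and ?y = "(Inc 1 (\<tau> p) j, p)" and ?z = "(Inc 2 (\<tau> p) j, p)"
      have "arc ?x ?y \<and> arc ?x ?z \<and> arc ?y ?z" using \<tau>(2)[OF 1(2)] by (simp del: el.simps)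
      moreover have "X = {?x, ?y, ?z}" using 1(1) by (simp only: triA_def)
      ultimately show ?thesis by blast
    next
      case 2
      have "X \<subseteq> set verts" using 2 \<tau> el_mem[of "\<tau> p" p j] by (auto simp: triC_def in_verts)
      moreover let ?x = "(Inc 0 (\<tau> p) j, p)"
        and ?y = "(Ele 1 (fst (elt (\<tau> p) p j)), snd (elt (\<tau> p) p j))"
        and ?z = "(Ele 2 (fst (elt (\<tau> p) p j)), snd (elt (\<tau> p) p j))"
      have "arc ?x ?y \<and> arc ?x ?z \<and> arc ?y ?z" by (simp del: el.simps)
      moreover have "X = {?x, ?y, ?z}" using 2(1) by (simp only: triC_def)
      ultimately show ?thesis by blast
    next
      case 3
      have "X \<subseteq> set verts" using 3 nx_less by (auto simp: triB_def in_verts)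
      moreover let ?x = "(Inc 0 T j, p)" and ?y = "(Inc 1 T j, p)" and ?z = "(Inc 2 T (nx j), p)"
      have "arc ?x ?y \<and> arc ?x ?z \<and> arc ?y ?z" by simp
      moreover have "X = {?x, ?y, ?z}" using 3(1) by (simp only: triB_def)
      ultimately show ?thesis by blast
    qed
  next
    fix u assume u: "u \<in> set verts"
    show "\<exists>!X. X \<in> P \<and> u \<in> X"
    proof (cases u rule: tag_col.cases)
      case (1 v e q)
      then have e: "v < 3" "e \<in> set jl" "q \<in> Pos" using u by (auto simp: in_verts)
      obtain p j where pj: "p \<in> Pos" "j < m" "elt (\<tau> p) p j = (e, q)"
        and uniq: "\<And>p' j'. p' \<in> Pos \<Longrightarrow> j' < m \<Longrightarrow> elt (\<tau> p') p' j' = (e, q) \<Longrightarrow> p' = p \<and> j' = j"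
        using cover[OF e(2,3)] by blast
      let ?X = "if v = 0 then triA (\<tau> p) p j else triC (\<tau> p) p j"
      show ?thesis
      proof (rule ex1I[of _ ?X])
        have "v = 0 \<or> v = 1 \<or> v = 2" using e(1) by auto
        then show "?X \<in> P \<and> u \<in> ?X"
          unfolding 1 using P_A[OF pj(1,2)] P_C[OF pj(1,2)] pj(3)
          by (elim disjE) (simp_all add: mem_tri del: el.simps)
      next
        fix X assume X: "X \<in> P \<and> u \<in> X"
        from P_cases[OF conjunct1[OF X]] show "X = ?X"
        proof (elim disjE exE conjE)
          fix p' j' assume X': "X = triA (\<tau> p') p' j'" "p' \<in> Pos" "j' < m"
          with X 1 have "v = 0" "elt (\<tau> p') p' j' = (e, q)" by (simp_all only: mem_tri)
          with X' uniq show ?thesis by simp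
        next
          fix p' j' assume X': "X = triC (\<tau> p') p' j'" "p' \<in> Pos" "j' < m"
          with X 1 have "v = 1 \<or> v = 2" "elt (\<tau> p') p' j' = (e, q)" by (simp_all only: mem_tri)
          with X' uniq show ?thesis by auto
        next
          fix T p' j' assume "X = triB T p' j'"
          with X 1 show ?thesis by (simp add: mem_tri)
        qed
      qed
    next
      case (2 v T j p)
      then have T: "v < 3" "T \<in> set tiles" "j < m" "p \<in> Pos" using u by (auto simp: in_verts)
      obtain i where i: "i < m" "nx i = j" using Suc_mod_ex[OF T(3)] by blast
      have nx_inj: "i' = i" if "i' < m" "nx i' = j" for i'
        using that i by (metis Suc_inject Suc_lessI mod_less mod_self nat.distinct(1))
      let ?X = "if T = \<tau> p then (if v = 0 then triC T p j else triA T p j)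
        else triB T p (if v = 2 then i else j)"
      show ?thesis
      proof (rule ex1I[of _ ?X])
        have "v = 0 \<or> v = 1 \<or> v = 2" using T(1) by auto
        then show "?X \<in> P \<and> u \<in> ?X"
          unfolding 2 using P_A[OF T(4,3)] P_C[OF T(4,3)] P_B[OF T(2,4,3)] P_B[OF T(2,4) i(1)] i(2)
          by (cases "T = \<tau> p"; elim disjE) (simp_all add: mem_tri)
      next
        fix X assume X: "X \<in> P \<and> u \<in> X"
        from P_cases[OF conjunct1[OF X]] show "X = ?X"
        proof (elim disjE exE conjE)
          fix p' j' assume X': "X = triA (\<tau> p') p' j'" "p' \<in> Pos" "j' < m"
          with X 2 have "v = 1 \<or> v = 2" "T = \<tau> p'" "j = j'" "p = p'" by (simp_all only: mem_tri)
          with X' show ?thesis by auto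
        next
          fix p' j' assume X': "X = triC (\<tau> p') p' j'" "p' \<in> Pos" "j' < m"
          with X 2 have "v = 0" "T = \<tau> p'" "j = j'" "p = p'" by (simp_all only: mem_tri)
          with X' show ?thesis by simp
        next
          fix T' p' j' assume X': "X = triB T' p' j'" "p' \<in> Pos" "j' < m" "T' \<noteq> \<tau> p'"
          with X 2 have "T = T'" "p = p'" "v = 0 \<and> j = j' \<or> v = 1 \<and> j = j' \<or> v = 2 \<and> j = nx j'"
            by (simp_all only: mem_tri)
          with X' nx_inj[of j'] show ?thesis by auto
        qed
      qed
    qed
  qed
  then show ?thesis by blast
qed

theorem partition_iff_tiling: "(\<exists>P. triangle_partition arc (set verts) P) \<longleftrightarrow> (\<exists>\<tau>. tiling \<tau>)"
  using tiling_if_partition partition_if_tiling by blast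

end

section \<open>Verifier computations as tilings\<close>

text \<open>Idling after the halt is expressed as an action that rewrites the scanned symbols, so
  that one local rule describes all rows up to a fixed height.\<close>

definition tm_act :: "turing_machine \<Rightarrow> nat \<Rightarrow> nat list \<Rightarrow> nat \<times> (nat \<times> direction) list" where
  "tm_act M q ss = (if q < nstates M then delta M q ss else (q, map (\<lambda>s. (s, Stay)) ss))"

lemma tm_step_act:
  "tm_step M c = (fst (tm_act M (fst c) (map read_tape (snd c))),
     map2 act_tape (snd (tm_act M (fst c) (map read_tape (snd c)))) (snd c))"
proof -
  have "map2 act_tape (map (\<lambda>s. (s, Stay)) (map read_tape ts)) ts = ts" for ts
    by (rule nth_equalityI) (auto simp: act_tape_def read_tape_def)
  then show ?thesis by (simp add: tm_step_def tm_act_def Let_def prod_eq_iff del: map_map)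
qed

definition reached :: "turing_machine \<Rightarrow> nat \<Rightarrow> config \<Rightarrow> bool" where
  "reached M t c \<longleftrightarrow> fst c \<le> nstates M \<and> length (snd c) = ntapes M \<and>
     (\<forall>tp\<in>set (snd c). (\<forall>z. fst tp z < nsyms M) \<and> \<bar>snd tp\<bar> \<le> int t)"

lemma tm_act_wf:
  assumes "wf_tm M" "q \<le> nstates M" "length ss = ntapes M" "set ss \<subseteq> {..<nsyms M}"
  shows "fst (tm_act M q ss) \<le> nstates M" "length (snd (tm_act M q ss)) = ntapes M"
    "fst ` set (snd (tm_act M q ss)) \<subseteq> {..<nsyms M}"
proof -
  have "fst (tm_act M q ss) \<le> nstates M \<and> length (snd (tm_act M q ss)) = ntapes M \<and>
    fst ` set (snd (tm_act M q ss)) \<subseteq> {..<nsyms M}"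
  proof (cases "q < nstates M")
    case True
    then show ?thesis using assms unfolding wf_tm_def tm_act_def by simp
  next
    case False
    then show ?thesis using assms by (auto simp: tm_act_def)
  qed
  then show "fst (tm_act M q ss) \<le> nstates M" "length (snd (tm_act M q ss)) = ntapes M"
    "fst ` set (snd (tm_act M q ss)) \<subseteq> {..<nsyms M}" by blast+
qed

lemma reached_reads:
  "reached M t c \<Longrightarrow> length (map read_tape (snd c)) = ntapes M"
  "reached M t c \<Longrightarrow> set (map read_tape (snd c)) \<subseteq> {..<nsyms M}"
  by (auto simp: reached_def read_tape_def)

lemma reached_step:
  assumes wf: "wf_tm M" and c: "reached M t c"
  shows "reached M (Suc t) (tm_step M c)"
proof -
  let ?a = "tm_act M (fst c) (map read_tape (snd c))"
  have q: "fst c \<le> nstates M" using c by (simp add: reached_def)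
  note a = tm_act_wf[OF wf q reached_reads[OF c]]
  have off: "\<bar>offset d\<bar> \<le> 1" for d by (cases d) auto
  have "(\<forall>z. fst tp z < nsyms M) \<and> \<bar>snd tp\<bar> \<le> int (Suc t)"
    if tp: "tp \<in> set (map2 act_tape (snd ?a) (snd c))" for tp
  proof -
    obtain z where z: "tp = (\<lambda>(e, tp0). act_tape e tp0) z" "z \<in> set (zip (snd ?a) (snd c))"
      using tp unfolding set_map by (rule imageE)
    obtain e tp0 where "z = (e, tp0)" by (cases z)
    with z have e: "(e, tp0) \<in> set (zip (snd ?a) (snd c))" "tp = act_tape e tp0" by simp_all
    then have "e \<in> set (snd ?a)" "tp0 \<in> set (snd c)" by (auto dest: set_zip_leftD set_zip_rightD)
    moreover from this have "fst e < nsyms M" using a(3) by auto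
    ultimately show ?thesis using c e(2) off[of "snd e"] unfolding reached_def act_tape_def by fastforce
  qed
  then show ?thesis unfolding tm_step_act using a c by (simp add: reached_def)
qed

lemma reached_init: "wf_tm M \<Longrightarrow> reached M 0 (init_config M w)"
  unfolding reached_def init_config_def wf_tm_def
  by (auto simp: input_tape_def blank_tape_def sym_of_bit_def)

lemma reached_funpow: "wf_tm M \<Longrightarrow> reached M t ((tm_step M ^^ t) (init_config M w))"
  by (induction t) (simp_all add: reached_init reached_step)

lemma halted_funpow: "fst c = nstates M \<Longrightarrow> (tm_step M ^^ d) c = c"
  by (induction d) (simp_all add: tm_step_def)

text \<open>
  A tile holds the state and the scanned symbols, which are the same along a row, and for one cell
  position the symbols on all tapes and which heads are at the left neighbour, here and at the right
  neighbour. The last component is the symbol to the left on the first tape. The categories are: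
  in the first row \<open>s\<close> and \<open>s + 4\<close> for the origin, where \<open>s\<close> is the symbol on the first tape and
  \<open>3\<close> stands for the cells of the certificate; \<open>8\<close> in the inner rows; in the last row \<open>9\<close> for the
  origin and \<open>10\<close> elsewhere.
\<close>

datatype tile = Tile (t_cat: nat) (t_state: nat) (t_read: "nat list") (t_syms: "nat list")
  (t_left: "bool list") (t_here: "bool list") (t_right: "bool list") (t_prev: nat)

text \<open>A \<open>Hor\<close> colour makes the windows of neighbouring tiles overlap: here and
  right of one tile are left and here of the next. A \<open>Ver\<close> colour carries the result of
  a step. \<open>Border\<close> joins the last row to the first, where the torus closes up and
  nothing is to be transmitted.\<close>

datatype colour = Trivial | Border | Hor nat "nat list" "bool list" "bool list" nat
  | Ver nat "nat list" "bool list"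

definition colour_in :: "nat \<Rightarrow> tile \<Rightarrow> colour" where
  "colour_in k T = (if k = 0 then Trivial
     else if k = 1 then Hor (t_state T) (t_read T) (t_left T) (t_here T) (t_prev T)
     else if t_cat T < 8 then Border else Ver (t_state T) (t_syms T) (t_here T))"

definition next_syms :: "(nat \<times> direction) list \<Rightarrow> nat list \<Rightarrow> bool list \<Rightarrow> nat list" where
  "next_syms as ss h = map (\<lambda>i. if h ! i then fst (as ! i) else ss ! i) [0..<length ss]"

definition next_heads ::
  "(nat \<times> direction) list \<Rightarrow> bool list \<Rightarrow> bool list \<Rightarrow> bool list \<Rightarrow> bool list" where
  "next_heads as l h r = map (\<lambda>i. case snd (as ! i) of
     Move_Left \<Rightarrow> r ! i | Stay \<Rightarrow> h ! i | Move_Right \<Rightarrow> l ! i) [0..<length h]"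

definition colour_out :: "turing_machine \<Rightarrow> nat \<Rightarrow> tile \<Rightarrow> colour" where
  "colour_out M k T = (if k = 0 then Trivial
     else if k = 1 then Hor (t_state T) (t_read T) (t_here T) (t_right T) (hd (t_syms T))
     else if 9 \<le> t_cat T then Border
     else (case tm_act M (t_state T) (t_read T) of (q, as) \<Rightarrow>
       Ver q (next_syms as (t_syms T) (t_here T))
         (next_heads as (t_left T) (t_here T) (t_right T))))"

text \<open>A head on the cell forces the guessed scanned symbol to be the true one. In the
  certificate area the clause on \<open>t_prev\<close> forbids gaps: a blank is followed by blanks
  only. Category \<open>9\<close> asks for the output bit \<open>True\<close>, which is the symbol
  \<open>2\<close>.\<close>

definition tile_ok :: "turing_machine \<Rightarrow> tile \<Rightarrow> bool" where
  "tile_ok M T \<longleftrightarrow> t_cat T < 11 \<and> t_state T \<le> nstates M \<and>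
     length (t_read T) = ntapes M \<and> set (t_read T) \<subseteq> {..<nsyms M} \<and>
     length (t_syms T) = ntapes M \<and> set (t_syms T) \<subseteq> {..<nsyms M} \<and>
     length (t_left T) = ntapes M \<and> length (t_here T) = ntapes M \<and> length (t_right T) = ntapes M \<and>
     t_prev T < nsyms M \<and>
     (\<forall>i<ntapes M. t_here T ! i \<longrightarrow> t_syms T ! i = t_read T ! i) \<and>
     (t_cat T < 8 \<longrightarrow> t_state T = 0 \<and> tl (t_syms T) = replicate (ntapes M - 1) 0 \<and>
       t_here T = replicate (ntapes M) (4 \<le> t_cat T) \<and>
       (if t_cat T mod 4 = 3 then hd (t_syms T) \<le> 2 \<and> (t_prev T = 0 \<longrightarrow> hd (t_syms T) = 0)
        else hd (t_syms T) = t_cat T mod 4)) \<and>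
     (t_cat T = 9 \<longrightarrow> last (t_syms T) = 2)"

text \<open>The tiles depend on the verifier and not on its input, so they can be built into the
  text of the reduction program.\<close>

lemma finite_tiles: "finite {T. tile_ok M T}"
proof -
  let ?L = "{xs. set xs \<subseteq> {..<nsyms M} \<and> length xs = ntapes M}"
  let ?B = "{xs :: bool list. set xs \<subseteq> UNIV \<and> length xs = ntapes M}"
  have "finite ?L" "finite ?B" by (intro finite_lists_length_eq finite_lessThan finite)+
  then have "finite ((\<lambda>(c, q, ss, s, l, h, r, z). Tile c q ss s l h r z) `
      ({..<11} \<times> {..nstates M} \<times> ?L \<times> ?L \<times> ?B \<times> ?B \<times> ?B \<times> {..<nsyms M}))"
    by (intro finite_imageI finite_cartesian_product) simp_all
  then show ?thesis
  proof (rule rev_finite_subset, intro subsetI)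
    fix T assume "T \<in> {T. tile_ok M T}"
    then show "T \<in> (\<lambda>(c, q, ss, s, l, h, r, z). Tile c q ss s l h r z) `
        ({..<11} \<times> {..nstates M} \<times> ?L \<times> ?L \<times> ?B \<times> ?B \<times> ?B \<times> {..<nsyms M})"
      by (intro image_eqI[of _ _ "(t_cat T, t_state T, t_read T, t_syms T, t_left T, t_here T,
          t_right T, t_prev T)"]) (auto simp: tile_ok_def)
  qed
qed

text \<open>The word \<open>pair x y\<close> with \<open>y\<close> left open: even places hold
  \<open>True\<close>, odd ones the bits of \<open>x\<close>, then come the separator
  \<open>False\<close> and \<open>b\<close> free cells. Parity is tested through
  \<open>div 2\<close>, which counter programs can compute.\<close>

definition init_sym :: "bool list \<Rightarrow> nat \<Rightarrow> nat \<Rightarrow> nat" where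
  "init_sym x b i =
     (if i < 2 * length x then (if i = 2 * (i div 2) then 2 else fst (input_tape x) (int (i div 2)))
      else if i = 2 * length x then 1 else if i \<le> 2 * length x + b then 3 else 0)"

fun category :: "bool list \<Rightarrow> nat \<Rightarrow> nat \<Rightarrow> nat \<times> nat \<Rightarrow> nat" where
  "category x b N (t, i) =
     (if t = 0 then (if i = 0 then init_sym x b i + 4 else init_sym x b i)
      else if Suc t < N then 8 else if i = 0 then 9 else 10)"

lemma init_sym_le: "init_sym x b i \<le> 3"
  by (auto simp: init_sym_def input_tape_def sym_of_bit_def)

lemma nth_pair:
  "length (pair x y) = 2 * length x + 1 + length y"
  "i < length x \<Longrightarrow> pair x y ! (2 * i) = True"
  "i < length x \<Longrightarrow> pair x y ! Suc (2 * i) = x ! i"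
  "pair x y ! (2 * length x) = False"
  "i < length y \<Longrightarrow> pair x y ! (2 * length x + 1 + i) = y ! i"
proof -
  have len: "length (concat (map (\<lambda>b. [True, b]) x)) = 2 * length x" for x
    by (induction x) auto
  have nth: "i < length x \<Longrightarrow> concat (map (\<lambda>b. [True, b]) x) ! (2 * i) = True \<and>
      concat (map (\<lambda>b. [True, b]) x) ! Suc (2 * i) = x ! i" for i
    by (induction x arbitrary: i) (auto simp: nth_Cons' less_Suc_eq_0_disj)
  show "length (pair x y) = 2 * length x + 1 + length y"
    by (simp add: pair_def len)
  show "i < length x \<Longrightarrow> pair x y ! (2 * i) = True" "i < length x \<Longrightarrow> pair x y ! Suc (2 * i) = x ! i"
    using nth[of i] by (simp_all add: pair_def nth_append len)
  show "pair x y ! (2 * length x) = False"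
    "i < length y \<Longrightarrow> pair x y ! (2 * length x + 1 + i) = y ! i"
    by (simp_all add: pair_def nth_append len)
qed

lemma input_tape_pair:
  assumes "length y \<le> b"
  shows "init_sym x b i \<noteq> 3 \<Longrightarrow> fst (input_tape (pair x y)) (int i) = init_sym x b i"
    and "init_sym x b i = 3 \<Longrightarrow> 2 * length x < i \<and>
      fst (input_tape (pair x y)) (int i) =
        (if i - 2 * length x - 1 < length y then sym_of_bit (y ! (i - 2 * length x - 1)) else 0)"
proof -
  let ?f = "fst (input_tape (pair x y)) (int i)"
  have f: "?f = (if i < 2 * length x + 1 + length y then sym_of_bit (pair x y ! i) else 0)"
    by (simp add: input_tape_def nth_pair)
  consider "i < 2 * length x" | "i = 2 * length x" | j where "i = 2 * length x + 1 + j"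
    by (metis less_iff_Suc_add linorder_neqE_nat Suc_eq_plus1 add.commute add.assoc)
  then have "(init_sym x b i \<noteq> 3 \<longrightarrow> ?f = init_sym x b i) \<and>
    (init_sym x b i = 3 \<longrightarrow> 2 * length x < i \<and>
      ?f = (if i - 2 * length x - 1 < length y then sym_of_bit (y ! (i - 2 * length x - 1)) else 0))"
  proof cases
    case 1
    have h: "i div 2 < length x" using 1 by simp
    show ?thesis
    proof (cases "even i")
      case True
      then have "i = 2 * (i div 2)" by simp
      then show ?thesis using 1 f nth_pair(2)[OF h, of y] by (simp add: init_sym_def sym_of_bit_def)
    next
      case False
      then have i: "i = Suc (2 * (i div 2))" by simp
      then have "pair x y ! i = x ! (i div 2)" using nth_pair(3)[OF h, of y] by simp
      moreover have "i \<noteq> 2 * (i div 2)" using i by simp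
      ultimately show ?thesis using 1 f h by (simp add: init_sym_def input_tape_def sym_of_bit_def)
    qed
  next
    case 2
    then show ?thesis using f nth_pair(4)[of x y] by (simp add: init_sym_def sym_of_bit_def)
  next
    case 3
    then show ?thesis using f nth_pair(5)[of j y x] assms by (auto simp: init_sym_def)
  qed
  then show "init_sym x b i \<noteq> 3 \<Longrightarrow> ?f = init_sym x b i"
    "init_sym x b i = 3 \<Longrightarrow> 2 * length x < i \<and>
      ?f = (if i - 2 * length x - 1 < length y then sym_of_bit (y ! (i - 2 * length x - 1)) else 0)"
    by blast+
qed

text \<open>Row positions stand for the tape cells \<open>{-H..<H}\<close>, the negative ones coming last.\<close>

definition cell :: "nat \<Rightarrow> nat \<Rightarrow> int" where
  "cell H j = (if j < H then int j else int j - 2 * int H)"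

text \<open>Going one position on means going one cell to the right except at the seam between
  \<open>H - 1\<close> and \<open>-H\<close>, and the bound keeps \<open>h\<close> and
  \<open>h + 1\<close> away from it.\<close>

lemma cell_Suc:
  assumes "j < 2 * H" and "\<bar>h\<bar> + 2 \<le> int H"
  shows "h + 1 = cell H (Suc j mod (2 * H)) \<longleftrightarrow> h = cell H j"
  using assms by (cases "Suc j = 2 * H") (auto simp: cell_def)

lemma cell_ex: "\<bar>h\<bar> < int H \<Longrightarrow> \<exists>j<2 * H. h = cell H j"
proof (cases "0 \<le> h")
  case True
  then show "\<bar>h\<bar> < int H \<Longrightarrow> ?thesis" by (intro exI[of _ "nat h"]) (auto simp: cell_def)
next
  case False
  then show "\<bar>h\<bar> < int H \<Longrightarrow> ?thesis"
    by (intro exI[of _ "nat (h + 2 * int H)"]) (auto simp: cell_def)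
qed

lemma cell_0: "0 < H \<Longrightarrow> cell H 0 = 0"
  by (simp add: cell_def)

lemma cell_eq_0: "j < 2 * H \<Longrightarrow> cell H j = 0 \<longleftrightarrow> j = 0"
  by (auto simp: cell_def)

definition syms :: "nat \<Rightarrow> config \<Rightarrow> nat \<Rightarrow> nat list" where
  "syms H c j = map (\<lambda>tp. fst tp (cell H j)) (snd c)"

definition heads :: "nat \<Rightarrow> config \<Rightarrow> nat \<Rightarrow> bool list" where
  "heads H c j = map (\<lambda>tp. snd tp = cell H j) (snd c)"

text \<open>Once state and scanned symbols are known, a step acts on a cell through the cell and its
  two neighbours, and the heads stay away from the seam of the cyclic row.\<close>

lemma step_row:
  assumes wf: "wf_tm M" and c: "reached M t c"
    and bound: "\<And>tp. tp \<in> set (snd c) \<Longrightarrow> \<bar>snd tp\<bar> + 3 \<le> int H"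
    and l: "l < 2 * H" and j: "Suc l mod (2 * H) = j" and r: "Suc j mod (2 * H) = r"
  defines "a \<equiv> tm_act M (fst c) (map read_tape (snd c))"
  shows "fst (tm_step M c) = fst a"
    and "syms H (tm_step M c) j = next_syms (snd a) (syms H c j) (heads H c j)"
    and "heads H (tm_step M c) j = next_heads (snd a) (heads H c l) (heads H c j) (heads H c r)"
proof -
  have len: "length (snd c) = ntapes M" and q: "fst c \<le> nstates M" using c by (simp_all add: reached_def)
  have lena: "length (snd a) = ntapes M"
    unfolding a_def by (rule tm_act_wf(2)[OF wf q reached_reads[OF c]])
  have step: "tm_step M c = (fst a, map2 act_tape (snd a) (snd c))"
    unfolding a_def by (rule tm_step_act)
  have j2: "j < 2 * H" using j l by (metis mod_less_divisor not_less_zero gr_zeroI)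
  show "fst (tm_step M c) = fst a" by (simp add: step)
  show "syms H (tm_step M c) j = next_syms (snd a) (syms H c j) (heads H c j)"
    by (rule nth_equalityI)
      (auto simp: step syms_def heads_def next_syms_def act_tape_def len lena)
  show "heads H (tm_step M c) j = next_heads (snd a) (heads H c l) (heads H c j) (heads H c r)"
  proof (rule nth_equalityI)
    show "length (heads H (tm_step M c) j) =
        length (next_heads (snd a) (heads H c l) (heads H c j) (heads H c r))"
      by (simp add: step heads_def next_heads_def len lena)
    fix i assume "i < length (heads H (tm_step M c) j)"
    then have i: "i < ntapes M" by (simp add: step heads_def len lena)
    let ?h = "snd (snd c ! i)"
    have h: "\<bar>?h\<bar> + 3 \<le> int H" using bound[of "snd c ! i"] i len by simp
    have R: "?h + 1 = cell H j \<longleftrightarrow> ?h = cell H l" using cell_Suc[OF l, of ?h] h j by simp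
    \<comment> \<open>The \<open>3\<close> in the bound comes from here: \<open>cell_Suc\<close> is
      applied to \<open>?h - 1\<close>, which may lie one cell further out.\<close>
    have L: "?h = cell H r \<longleftrightarrow> ?h - 1 = cell H j" using cell_Suc[OF j2, of "?h - 1"] h r by simp
    show "heads H (tm_step M c) j ! i =
        next_heads (snd a) (heads H c l) (heads H c j) (heads H c r) ! i"
      using i R L by (cases "snd (snd a ! i)")
        (auto simp: step heads_def next_heads_def act_tape_def len lena)
  qed
qed

section \<open>Tilings and accepted certificates\<close>

locale verifier =
  fixes M :: turing_machine and pt p :: "nat poly" and V A :: "bool list set"
  assumes wf: "wf_tm M"
    and decides: "computes_in_time M (\<lambda>w. [w \<in> V]) (poly pt)"
    and A: "x \<in> A \<longleftrightarrow> (\<exists>y. length y \<le> poly p (length x) \<and> pair x y \<in> V)"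
begin

definition cert :: "bool list \<Rightarrow> nat" where
  "cert x = poly p (length x)"

definition time :: "bool list \<Rightarrow> nat" where
  "time x = poly pt (2 * length x + 1 + cert x)"

text \<open>Large enough for three purposes: no head comes near the seam, the input with its
  certificate fits into the nonnegative cells, and \<open>2 * half x\<close> rows outlast the
  computation.\<close>

definition half :: "bool list \<Rightarrow> nat" where
  "half x = time x + 2 * length x + cert x + 3"

definition row_tiling :: "bool list \<Rightarrow> (nat \<times> nat \<Rightarrow> tile) \<Rightarrow> bool" where
  "row_tiling x \<tau> \<longleftrightarrow> (\<forall>t<2 * half x. \<forall>i<2 * half x.
     tile_ok M (\<tau> (t, i)) \<and> t_cat (\<tau> (t, i)) = category x (cert x) (2 * half x) (t, i) \<and>
     colour_out M 1 (\<tau> (t, i)) = colour_in 1 (\<tau> (t, Suc i mod (2 * half x))) \<and>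
     colour_out M 2 (\<tau> (t, i)) = colour_in 2 (\<tau> (Suc t mod (2 * half x), i)))"

abbreviation "run_of w t \<equiv> (tm_step M ^^ t) (init_config M w)"

lemma ntapes_pos: "0 < ntapes M"
  using wf by (simp add: wf_tm_def)

lemma halts:
  assumes "length y \<le> cert x"
  shows "\<exists>t0\<le>time x. (\<forall>t\<ge>t0. run_of (pair x y) t = run_of (pair x y) t0) \<and>
    fst (last (snd (run_of (pair x y) t0))) 0 = sym_of_bit (pair x y \<in> V)"
proof -
  obtain t0 where t0: "t0 \<le> poly pt (length (pair x y))"
    "fst (run_of (pair x y) t0) = nstates M" "has_output (run_of (pair x y) t0) [pair x y \<in> V]"
    using decides unfolding computes_in_time_def by blast
  have "t0 \<le> time x" using t0(1) poly_nat_mono[of "length (pair x y)" "2 * length x + 1 + cert x" pt] assms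
    unfolding time_def nth_pair by simp
  moreover have "run_of (pair x y) t = run_of (pair x y) t0" if "t0 \<le> t" for t
  proof -
    have "run_of (pair x y) (t - t0 + t0) = run_of (pair x y) t0"
      unfolding funpow_add o_apply by (rule halted_funpow[OF t0(2)])
    then show ?thesis using that by simp
  qed
  moreover have "fst (last (snd (run_of (pair x y) t0))) 0 = sym_of_bit (pair x y \<in> V)"
    using t0(3) unfolding has_output_def by auto
  ultimately show ?thesis by blast
qed

text \<open>Heads rest after the halt, so the bound by the running time holds in all later rows
  too.\<close>

lemma head_bound:
  assumes y: "length y \<le> cert x" and tp: "tp \<in> set (snd (run_of (pair x y) t))"
  shows "\<bar>snd tp\<bar> + 3 \<le> int (half x)"
proof -
  obtain t0 where t0: "t0 \<le> time x" "\<And>t. t0 \<le> t \<Longrightarrow> run_of (pair x y) t = run_of (pair x y) t0"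
    using halts[OF y] by blast
  have "run_of (pair x y) t = run_of (pair x y) (min t t0)" using t0(2)[of t] by (simp add: min_def)
  then have "\<bar>snd tp\<bar> \<le> int (min t t0)"
    using reached_funpow[OF wf, of "min t t0" "pair x y"] tp unfolding reached_def by metis
  then show ?thesis using t0(1) by (simp add: half_def)
qed

lemma accepted:
  assumes y: "length y \<le> cert x"
  shows "fst (last (snd (run_of (pair x y) (2 * half x - 1)))) 0 = sym_of_bit (pair x y \<in> V)"
proof -
  obtain t0 where t0: "t0 \<le> time x" "\<And>t. t0 \<le> t \<Longrightarrow> run_of (pair x y) t = run_of (pair x y) t0"
    "fst (last (snd (run_of (pair x y) t0))) 0 = sym_of_bit (pair x y \<in> V)"
    using halts[OF y] by blast
  from t0(1) have "t0 \<le> 2 * half x - 1" by (simp add: half_def)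
  from t0(2)[OF this] t0(3) show ?thesis by (simp only:)
qed

lemma init_row:
  assumes y: "length y \<le> cert x" and j: "j < 2 * half x"
  shows "syms (half x) (init_config M (pair x y)) j =
      fst (input_tape (pair x y)) (cell (half x) j) # replicate (ntapes M - 1) 0"
    and "heads (half x) (init_config M (pair x y)) j = replicate (ntapes M) (j = 0)"
    and "fst (input_tape (pair x y)) (cell (half x) j) =
      (if j < half x then fst (input_tape (pair x y)) (int j) else 0)"
    and "half x \<le> j \<Longrightarrow> init_sym x (cert x) j = 0"
proof -
  show "syms (half x) (init_config M (pair x y)) j =
      fst (input_tape (pair x y)) (cell (half x) j) # replicate (ntapes M - 1) 0"
    by (simp add: syms_def init_config_def blank_tape_def)
  show "heads (half x) (init_config M (pair x y)) j = replicate (ntapes M) (j = 0)"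
    using cell_eq_0[OF j] ntapes_pos
    by (cases "ntapes M") (auto simp: heads_def init_config_def blank_tape_def input_tape_def)
  show "fst (input_tape (pair x y)) (cell (half x) j) =
      (if j < half x then fst (input_tape (pair x y)) (int j) else 0)"
    using j by (auto simp: cell_def input_tape_def)
  show "half x \<le> j \<Longrightarrow> init_sym x (cert x) j = 0"
    by (simp add: init_sym_def half_def)
qed

lemma tiling_if_accepted:
  assumes y: "length y \<le> cert x" and acc: "pair x y \<in> V"
  shows "\<exists>\<tau>. row_tiling x \<tau>"
proof -
  define H where "H = half x"
  define N where "N = 2 * H"
  have H: "0 < H" by (simp add: H_def half_def)
  have N2: "2 \<le> N" using H by (simp add: N_def)
  define c where "c t = run_of (pair x y) t" for t
  define left where "left j = (if j = 0 then N - 1 else j - 1)" for j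
  have left: "Suc (left j) mod N = j" "left j < N" if "j < N" for j
    using that by (auto simp: left_def)
  have left_Suc: "left (Suc j mod N) = j" if "j < N" for j
    using that by (cases "Suc j = N") (auto simp: left_def)
  define \<tau> where "\<tau> = (\<lambda>(t, j). Tile (category x (cert x) N (t, j)) (fst (c t))
    (map read_tape (snd (c t))) (syms H (c t) j) (heads H (c t) (left j)) (heads H (c t) j)
    (heads H (c t) (Suc j mod N)) (hd (syms H (c t) (left j))))"
  have reach: "reached M t (c t)" for t unfolding c_def by (rule reached_funpow[OF wf])
  have len: "length (snd (c t)) = ntapes M" for t using reach[of t] by (simp add: reached_def)
  have syms_lt: "set (syms H (c t) j) \<subseteq> {..<nsyms M}" for t j
    using reach[of t] by (auto simp: syms_def reached_def)
  have syms_ne: "syms H (c t) j \<noteq> []" for t j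
    using len[of t] ntapes_pos by (auto simp: syms_def)
  have c0: "c 0 = init_config M (pair x y)" by (simp add: c_def)
  have ok: "tile_ok M (\<tau> (t, j))" if t: "t < N" and j: "j < N" for t j
  proof -
    have jH: "j < 2 * half x" using j by (simp add: N_def H_def)
    have cat11: "category x (cert x) N (t, j) < 11"
      using init_sym_le[of x "cert x" j] init_sym_le[of x "cert x" 0] by simp
    have here: "syms H (c t) j ! i = map read_tape (snd (c t)) ! i"
      if "i < ntapes M" "heads H (c t) j ! i" for i
      using that len[of t] by (simp add: syms_def heads_def read_tape_def)
    have first: "t_state (\<tau> (t, j)) = 0 \<and> tl (t_syms (\<tau> (t, j))) = replicate (ntapes M - 1) 0 \<and>
       t_here (\<tau> (t, j)) = replicate (ntapes M) (4 \<le> t_cat (\<tau> (t, j))) \<and>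
       (if t_cat (\<tau> (t, j)) mod 4 = 3
        then hd (t_syms (\<tau> (t, j))) \<le> 2 \<and> (t_prev (\<tau> (t, j)) = 0 \<longrightarrow> hd (t_syms (\<tau> (t, j))) = 0)
        else hd (t_syms (\<tau> (t, j))) = t_cat (\<tau> (t, j)) mod 4)" (is ?first)
      if "t_cat (\<tau> (t, j)) < 8"
    proof -
      have t0: "t = 0" using that by (auto simp: \<tau>_def split: if_splits)
      define s where "s = init_sym x (cert x) j"
      have s3: "s \<le> 3" unfolding s_def by (rule init_sym_le)
      have cat: "t_cat (\<tau> (0, j)) = (if j = 0 then s + 4 else s)" by (simp add: \<tau>_def s_def)
      have mod: "t_cat (\<tau> (0, j)) mod 4 = s" using le_imp_less_Suc[OF s3] unfolding cat by (cases "j = 0") simp_all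
      have hdj: "hd (syms H (c 0) i) = (if i < H then fst (input_tape (pair x y)) (int i) else 0)"
        if "i < N" for i
        using init_row[OF y, of i] that by (simp add: c0 H_def N_def)
      have "if s = 3 then hd (syms H (c 0) j) \<le> 2 \<and>
          (hd (syms H (c 0) (left j)) = 0 \<longrightarrow> hd (syms H (c 0) j) = 0)
        else hd (syms H (c 0) j) = s"
      proof (cases "s = 3")
        case True
        have jlt: "j < H" using init_row(4)[OF y jH] True unfolding s_def H_def by (cases "j < half x") auto
        note f = input_tape_pair(2)[OF y True[unfolded s_def]]
        have l: "left j = j - 1" "j - 1 < H" using f jlt by (auto simp: left_def)
        \<comment> \<open>The cell before a bit of the certificate holds the separator or another
          bit, so it is not blank and the clause on \<open>t_prev\<close> is satisfied.\<close>
        have prev: "fst (input_tape (pair x y)) (int (j - 1)) \<noteq> 0" if "j - 2 * length x - 1 < length y"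
          using that f by (auto simp: input_tape_def nth_pair sym_of_bit_def)
        have "fst (input_tape (pair x y)) (int j) \<le> 2"
          by (auto simp: input_tape_def sym_of_bit_def)
        then show ?thesis using True hdj[OF j] hdj[OF left(2)[OF j]] jlt l f prev by auto
      next
        case False
        then show ?thesis
          using hdj[OF j] input_tape_pair(1)[OF y False[unfolded s_def]] init_row(4)[OF y jH]
          unfolding s_def H_def by auto
      qed
      moreover have "tl (syms H (c 0) j) = replicate (ntapes M - 1) 0"
        using init_row(1)[OF y jH] by (simp add: c0 H_def)
      moreover have "heads H (c 0) j = replicate (ntapes M) (4 \<le> t_cat (\<tau> (0, j)))"
        using init_row(2)[OF y jH] s3 by (simp add: c0 H_def cat)
      moreover have "fst (c 0) = 0" by (simp add: c0 init_config_def)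
      ultimately show ?thesis unfolding t0 mod by (simp add: \<tau>_def)
    qed
    have final: "last (syms H (c t) j) = 2" if "t_cat (\<tau> (t, j)) = 9"
    proof -
      have tj: "t = N - 1" "j = 0"
        using that t init_sym_le[of x "cert x" j] by (auto simp: \<tau>_def split: if_splits)
      have "last (syms H (c t) j) = fst (last (snd (c t))) 0"
        using len[of t] ntapes_pos H tj by (subst syms_def, subst last_map) (auto simp: cell_0)
      then show ?thesis using accepted[OF y] acc tj by (simp add: c_def N_def H_def sym_of_bit_def)
    qed
    show ?thesis
      unfolding tile_ok_def
    proof (intro conjI)
      show "t_cat (\<tau> (t, j)) < 11" using cat11 by (simp add: \<tau>_def)
      show "t_state (\<tau> (t, j)) \<le> nstates M" using reach[of t] by (simp add: \<tau>_def reached_def)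
      show "t_prev (\<tau> (t, j)) < nsyms M"
        using syms_lt[of t "left j"] syms_ne[of t "left j"] by (auto simp: \<tau>_def dest: hd_in_set)
      show "t_cat (\<tau> (t, j)) = 9 \<longrightarrow> last (t_syms (\<tau> (t, j))) = 2" using final by (simp add: \<tau>_def)
      show "set (t_read (\<tau> (t, j))) \<subseteq> {..<nsyms M}"
        using reached_reads(2)[OF reach] by (simp add: \<tau>_def)
      show "set (t_syms (\<tau> (t, j))) \<subseteq> {..<nsyms M}" using syms_lt by (simp add: \<tau>_def)
      show "\<forall>i<ntapes M. t_here (\<tau> (t, j)) ! i \<longrightarrow> t_syms (\<tau> (t, j)) ! i = t_read (\<tau> (t, j)) ! i"
        using here by (simp add: \<tau>_def)
      show "t_cat (\<tau> (t, j)) < 8 \<longrightarrow> ?first" using first by (rule impI)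
    qed (simp_all add: \<tau>_def len syms_def heads_def)
  qed
  have hor: "colour_out M 1 (\<tau> (t, j)) = colour_in 1 (\<tau> (t, Suc j mod N))" if "j < N" for t j
    using left_Suc[OF that] by (simp add: colour_out_def colour_in_def \<tau>_def)
  have ver: "colour_out M 2 (\<tau> (t, j)) = colour_in 2 (\<tau> (Suc t mod N, j))"
    if t: "t < N" and j: "j < N" for t j
  proof (cases "Suc t = N")
    case True
    have "0 < t" using True N2 by simp
    then have "9 \<le> t_cat (\<tau> (t, j))" using True by (simp add: \<tau>_def)
    moreover have "t_cat (\<tau> (Suc t mod N, j)) < 8"
      using True init_sym_le[of x "cert x" j] init_sym_le[of x "cert x" 0] by (simp add: \<tau>_def)
    ultimately show ?thesis by (simp add: colour_out_def colour_in_def)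
  next
    case False
    then have t': "Suc t < N" using t by simp
    have cats: "t_cat (\<tau> (t, j)) < 9" "8 \<le> t_cat (\<tau> (Suc t, j))"
      using t' init_sym_le[of x "cert x" j] init_sym_le[of x "cert x" 0] by (simp_all add: \<tau>_def)
    have cs: "c (Suc t) = tm_step M (c t)" by (simp add: c_def)
    have b: "\<bar>snd tp\<bar> + 3 \<le> int H" if "tp \<in> set (snd (c t))" for tp
      using head_bound[OF y] that by (simp add: c_def H_def)
    note row = step_row[OF wf reach b left(2)[OF j, unfolded N_def] left(1)[OF j, unfolded N_def] refl]
    show ?thesis
      using cats t' row unfolding cs N_def[symmetric]
      by (simp add: colour_out_def colour_in_def \<tau>_def cs N_def[symmetric] split_beta)
  qed
  have "row_tiling x \<tau>"
    unfolding row_tiling_def H_def[symmetric] N_def[symmetric]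
    using ok hor ver by (auto simp: \<tau>_def)
  then show ?thesis by blast
qed

text \<open>The certificate is read off the first row up to its first blank. By induction every row
  of the tiling then coincides with the configuration of the verifier at that time.\<close>

lemma accepted_if_tiling:
  assumes \<tau>: "row_tiling x \<tau>"
  shows "\<exists>y. length y \<le> cert x \<and> pair x y \<in> V"
proof -
  define H where "H = half x"
  define N where "N = 2 * H"
  have H: "time x + 2 * length x + cert x + 3 = H" by (simp add: H_def half_def)
  have N: "2 \<le> N" "H < N" using H by (simp_all add: N_def)
  have T: "tile_ok M (\<tau> (t, i))" "t_cat (\<tau> (t, i)) = category x (cert x) N (t, i)"
    "colour_out M 1 (\<tau> (t, i)) = colour_in 1 (\<tau> (t, Suc i mod N))"
    "colour_out M 2 (\<tau> (t, i)) = colour_in 2 (\<tau> (Suc t mod N, i))" if "t < N" "i < N" for t i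
    using \<tau> that unfolding row_tiling_def H_def[symmetric] N_def[symmetric] by blast+
  have hor: "t_state (\<tau> (t, Suc i mod N)) = t_state (\<tau> (t, i))"
    "t_read (\<tau> (t, Suc i mod N)) = t_read (\<tau> (t, i))"
    "t_left (\<tau> (t, Suc i mod N)) = t_here (\<tau> (t, i))"
    "t_here (\<tau> (t, Suc i mod N)) = t_right (\<tau> (t, i))"
    "t_prev (\<tau> (t, Suc i mod N)) = hd (t_syms (\<tau> (t, i)))" if "t < N" "i < N" for t i
    using T(3)[OF that] by (simp_all add: colour_out_def colour_in_def)
  have lens: "length (t_syms (\<tau> (t, i))) = ntapes M" if "t < N" "i < N" for t i
    using T(1)[OF that] by (simp add: tile_ok_def)
  define g where "g j = hd (t_syms (\<tau> (0, j)))" for j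
  define s where "s j = init_sym x (cert x) j" for j
  have row0: "t_state (\<tau> (0, j)) = 0" "tl (t_syms (\<tau> (0, j))) = replicate (ntapes M - 1) 0"
    "t_here (\<tau> (0, j)) = replicate (ntapes M) (j = 0)"
    "s j = 3 \<Longrightarrow> g j \<le> 2" "s j = 3 \<Longrightarrow> t_prev (\<tau> (0, j)) = 0 \<Longrightarrow> g j = 0"
    "s j \<noteq> 3 \<Longrightarrow> g j = s j" if j: "j < N" for j
  proof -
    have s3: "s j \<le> 3" unfolding s_def by (rule init_sym_le)
    have N0: "0 < N" using N by simp
    have cat: "t_cat (\<tau> (0, j)) = (if j = 0 then s j + 4 else s j)"
      using T(2)[OF N0 j] by (simp add: s_def)
    have mod: "t_cat (\<tau> (0, j)) mod 4 = s j" using le_imp_less_Suc[OF s3] unfolding cat by (cases "j = 0") simp_all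
    have lt8: "t_cat (\<tau> (0, j)) < 8" and ge4: "4 \<le> t_cat (\<tau> (0, j)) \<longleftrightarrow> j = 0"
      using s3 by (auto simp: cat)
    have "t_state (\<tau> (0, j)) = 0 \<and> tl (t_syms (\<tau> (0, j))) = replicate (ntapes M - 1) 0 \<and>
      t_here (\<tau> (0, j)) = replicate (ntapes M) (j = 0) \<and>
      (if s j = 3 then g j \<le> 2 \<and> (t_prev (\<tau> (0, j)) = 0 \<longrightarrow> g j = 0) else g j = s j)"
      using T(1)[OF N0 j] lt8 unfolding tile_ok_def mod ge4 g_def by blast
    then show "t_state (\<tau> (0, j)) = 0" "tl (t_syms (\<tau> (0, j))) = replicate (ntapes M - 1) 0"
      "t_here (\<tau> (0, j)) = replicate (ntapes M) (j = 0)"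
      "s j = 3 \<Longrightarrow> g j \<le> 2" "s j = 3 \<Longrightarrow> t_prev (\<tau> (0, j)) = 0 \<Longrightarrow> g j = 0"
      "s j \<noteq> 3 \<Longrightarrow> g j = s j" by (auto split: if_splits)
  qed
  define o1 where "o1 = 2 * length x + 1"
  \<comment> \<open>The first disjunct covers a certificate that fills the whole free area.\<close>
  define L where "L = (LEAST l. l = cert x \<or> g (o1 + l) = 0)"
  have L_le: "L \<le> cert x" unfolding L_def by (rule Least_le) simp
  have L_prop: "L = cert x \<or> g (o1 + L) = 0"
    unfolding L_def by (rule LeastI[of "\<lambda>l. l = cert x \<or> g (o1 + l) = 0" "cert x"]) simp
  have L_min: "g (o1 + l) \<noteq> 0" if "l < L" for l
    using not_less_Least[of l] that unfolding L_def by blast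
  have s_cert: "s (o1 + l) = 3" "o1 + l < N" if "l < cert x" for l
    using that H N by (simp_all add: s_def o1_def init_sym_def)
  \<comment> \<open>Blanks propagate to the right, since \<open>t_prev\<close> is the symbol of the
    left neighbour.\<close>
  have zero: "g (o1 + l) = 0" if "L \<le> l" "l < cert x" for l
    using that
  proof (induction rule: dec_induct)
    case base
    then show ?case using L_prop by auto
  next
    case (step l)
    have less: "o1 + l < N" "o1 + Suc l < N"
      using s_cert(2)[of l] s_cert(2)[OF step.prems] step.prems by simp_all
    have "t_prev (\<tau> (0, o1 + Suc l)) = g (o1 + l)"
      using hor(5)[of 0 "o1 + l"] less by (simp add: g_def)
    then show ?case using row0(5)[OF less(2) s_cert(1)[OF step.prems]] step by simp
  qed
  define y where "y = map (\<lambda>l. g (o1 + l) = 2) [0..<L]"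
  have y: "length y \<le> cert x" using L_le by (simp add: y_def)
  have g_input: "g j = fst (input_tape (pair x y)) (cell H j)" if j: "j < N" for j
  proof -
    have jH: "j < 2 * half x" using j by (simp add: N_def H_def)
    note input = init_row(3)[OF y jH, folded H_def]
    show ?thesis
    proof (cases "s j = 3")
      case False
      then have "g j = s j" using row0(6)[OF j] by simp
      then show ?thesis
        using input input_tape_pair(1)[OF y False[unfolded s_def]] init_row(4)[OF y jH]
        unfolding s_def H_def by auto
    next
      case True
      have jlt: "j < H"
        using init_row(4)[OF y jH] True unfolding s_def H_def by (cases "j < half x") auto
      note f = input_tape_pair(2)[OF y True[unfolded s_def]]
      define l where "l = j - 2 * length x - 1"
      have l: "j = o1 + l" using f by (simp add: l_def o1_def)
      have lc: "l < cert x" using True unfolding s_def init_sym_def l o1_def by (auto split: if_splits)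
      show ?thesis
      proof (cases "l < L")
        case True
        have "g j = 1 \<or> g j = 2"
          using L_min[OF True] row0(4)[OF j \<open>s j = 3\<close>] l by (cases "g j"; auto)
        then have "sym_of_bit (y ! l) = g j" using True l by (auto simp: y_def sym_of_bit_def)
        then show ?thesis using f input jlt True unfolding l_def[symmetric] by (simp add: y_def)
      next
        case False
        then show ?thesis using f input jlt zero[OF _ lc] l unfolding l_def[symmetric] by (simp add: y_def)
      qed
    qed
  qed
  define c where "c t = run_of (pair x y) t" for t
  have reach: "reached M t (c t)" for t unfolding c_def by (rule reached_funpow[OF wf])
  have len: "length (snd (c t)) = ntapes M" for t using reach[of t] by (simp add: reached_def)
  have bound: "\<bar>snd tp\<bar> + 3 \<le> int H" if "tp \<in> set (snd (c t))" for tp t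
    using head_bound[OF y] that by (simp add: c_def H_def)
  have main: "\<forall>j<N. t_state (\<tau> (t, j)) = fst (c t) \<and> t_syms (\<tau> (t, j)) = syms H (c t) j \<and>
      t_here (\<tau> (t, j)) = heads H (c t) j" if "t < N" for t
    using that
  proof (induction t)
    case 0
    show ?case
    proof (intro allI impI)
      fix j assume j: "j < N"
      then have jH: "j < 2 * half x" by (simp add: N_def H_def)
      have "t_syms (\<tau> (0, j)) \<noteq> []" using lens[OF 0 j] ntapes_pos by auto
      then have "t_syms (\<tau> (0, j)) = g j # replicate (ntapes M - 1) 0"
        using row0(2)[OF j] unfolding g_def by (metis list.collapse)
      then show "t_state (\<tau> (0, j)) = fst (c 0) \<and> t_syms (\<tau> (0, j)) = syms H (c 0) j \<and>
          t_here (\<tau> (0, j)) = heads H (c 0) j"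
        using row0(1,3)[OF j] init_row(1,2)[OF y jH] g_input[OF j]
        by (simp add: c_def H_def init_config_def)
    qed
  next
    case (Suc t)
    then have t: "t < N" and IH: "\<And>j. j < N \<Longrightarrow> t_state (\<tau> (t, j)) = fst (c t) \<and>
        t_syms (\<tau> (t, j)) = syms H (c t) j \<and> t_here (\<tau> (t, j)) = heads H (c t) j" by auto
    have const: "t_read (\<tau> (t, j)) = t_read (\<tau> (t, 0))" if "j < N" for j
      using that
    proof (induction j)
      case (Suc j)
      then show ?case using hor(2)[OF t, of j] by simp
    qed simp
    have reads: "t_read (\<tau> (t, j)) = map read_tape (snd (c t))" if j: "j < N" for j
    proof (rule nth_equalityI)
      show "length (t_read (\<tau> (t, j))) = length (map read_tape (snd (c t)))"
        using T(1)[OF t j] len by (simp add: tile_ok_def)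
      fix i assume "i < length (t_read (\<tau> (t, j)))"
      then have i: "i < ntapes M" using T(1)[OF t j] by (simp add: tile_ok_def)
      \<comment> \<open>Each head is at some cell of the row. The tile there vouches for the scanned
        symbol, and the list of scanned symbols is constant along the row.\<close>
      have "\<bar>snd (snd (c t) ! i)\<bar> < int H" using bound[of "snd (c t) ! i" t] i len[of t] by simp
      then obtain j' where j': "j' < N" "snd (snd (c t) ! i) = cell H j'"
        using cell_ex unfolding N_def by blast
      have "t_here (\<tau> (t, j')) ! i" using IH[OF j'(1)] i len[of t] j'(2) by (simp add: heads_def)
      then have "t_syms (\<tau> (t, j')) ! i = t_read (\<tau> (t, j')) ! i"
        using T(1)[OF t j'(1)] i unfolding tile_ok_def by blast
      then have "syms H (c t) j' ! i = t_read (\<tau> (t, j)) ! i"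
        using IH[OF j'(1)] const[OF j'(1)] const[OF j] by simp
      then show "t_read (\<tau> (t, j)) ! i = map read_tape (snd (c t)) ! i"
        using i len[of t] j'(2) by (simp add: syms_def read_tape_def)
    qed
    show ?case
    proof (intro allI impI)
      fix j assume j: "j < N"
      define l where "l = (if j = 0 then N - 1 else j - 1)"
      have l: "l < N" "Suc l mod N = j" using j by (auto simp: l_def)
      let ?r = "Suc j mod N"
      have r: "?r < N" using j by simp
      have sides: "t_left (\<tau> (t, j)) = heads H (c t) l" "t_right (\<tau> (t, j)) = heads H (c t) ?r"
        using hor(3)[OF t l(1)] hor(4)[OF t j] IH[OF l(1)] IH[OF r] l(2) by simp_all
      have cs: "c (Suc t) = tm_step M (c t)" by (simp add: c_def)
      note row = step_row[OF wf reach[of t] bound[where t = t] l(1)[unfolded N_def] l(2)[unfolded N_def] refl,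
          folded N_def cs]
      have cats: "t_cat (\<tau> (t, j)) < 9" "8 \<le> t_cat (\<tau> (Suc t, j))"
        using T(2)[OF t j] T(2)[OF Suc.prems j] Suc.prems init_sym_le[of x "cert x" j]
          init_sym_le[of x "cert x" 0] by simp_all
      have "colour_out M 2 (\<tau> (t, j)) = colour_in 2 (\<tau> (Suc t, j))"
        using T(4)[OF t j] Suc.prems by simp
      then show "t_state (\<tau> (Suc t, j)) = fst (c (Suc t)) \<and>
          t_syms (\<tau> (Suc t, j)) = syms H (c (Suc t)) j \<and>
          t_here (\<tau> (Suc t, j)) = heads H (c (Suc t)) j"
        using cats IH[OF j] reads[OF j] sides row
        by (simp add: colour_out_def colour_in_def split_beta)
    qed
  qed
  have N0: "0 < N" "N - 1 < N" using N by auto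
  have "t_cat (\<tau> (N - 1, 0)) = 9" using T(2)[OF N0(2,1)] N by simp
  then have "last (t_syms (\<tau> (N - 1, 0))) = 2" using T(1)[OF N0(2,1)] by (simp add: tile_ok_def)
  then have "last (syms H (c (N - 1)) 0) = 2" using main[OF N0(2)] N0(1) by simp
  moreover have "last (syms H (c (N - 1)) 0) = fst (last (snd (c (N - 1)))) 0"
    using len[of "N - 1"] ntapes_pos H by (subst syms_def, subst last_map) (auto simp: cell_0)
  ultimately have "sym_of_bit (pair x y \<in> V) = 2"
    using accepted[OF y] by (simp add: c_def N_def H_def)
  then have "pair x y \<in> V" by (simp add: sym_of_bit_def split: if_splits)
  then show ?thesis using y by blast
qed

theorem row_tiling_iff: "(\<exists>\<tau>. row_tiling x \<tau>) \<longleftrightarrow> x \<in> A"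
  unfolding A cert_def[symmetric] using tiling_if_accepted accepted_if_tiling by blast

end

section \<open>Computing the reduction\<close>

lemma gen_cong:
  assumes "gen d g" and "\<And>x xs. length xs = d \<Longrightarrow> g x xs = h x xs"
  shows "gen d h"
proof -
  obtain c q where "\<And>x xs m. env d x m xs \<Longrightarrow> run x c (st xs) (st xs) (g x xs) (poly q m)"
    using assms(1) unfolding gen_def by blast
  then show ?thesis using assms(2) by (intro genI[of d c h q]) (auto simp: env_def)
qed

lemma gen_replicate:
  assumes "calc e f" "e \<le> d"
  shows "gen d (\<lambda>x xs. replicate (f x xs) b)"
proof -
  have "concat (map (\<lambda>k. [b]) ks) = replicate (length ks) b" for ks :: "nat list"
    by (induction ks) auto
  then show ?thesis using gen_for[OF assms gen_const[of "Suc d" "[b]"]] by simp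
qed

lemma concat_map_concat: "concat (map f (concat xss)) = concat (map (\<lambda>xs. concat (map f xs)) xss)"
  by (induction xss) auto

lemma concat_map_cols:
  "concat (map h (cols vs)) = concat (map (\<lambda>a. concat (map (\<lambda>b. h (a, b, False) @ h (a, b, True)) vs)) vs)"
  unfolding cols_def concat_map_concat by (simp add: o_def concat_map_concat)

definition double :: "bool list \<Rightarrow> bool list" where
  "double w = concat (map (\<lambda>b. [True, b]) w)"

lemma double_simps:
  "double [] = []" "double (b # w) = [True, b] @ double w" "double (v @ w) = double v @ double w"
  "double (concat ws) = concat (map double ws)"
  unfolding double_def by (simp_all add: concat_map_concat)

text \<open>Brings the output word into the form of nested loops over the vertices.
  \<open>double [True, True]\<close> is the label of the sensitive column;
  \<open>double [True, False, True, False]\<close> stands for the two quasi-identifier columns of a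
  pair.\<close>

lemma encode_graph_db:
  "pair (encode_database (graph_db vs col arc)) r =
    double [True, True] @
    concat (map (\<lambda>a. concat (map (\<lambda>b. double [True, False, True, False]) vs)) vs) @
    double [False] @
    concat (map (\<lambda>u. double (True # True # encode_nat (col u)) @
      concat (map (\<lambda>a. concat (map (\<lambda>b.
        double (True # encode_nat (of_bool (mark arc u (a, b, False)))) @
        double (True # encode_nat (of_bool (mark arc u (a, b, True))))) vs)) vs) @
      double [False]) vs) @
    double [False] @ [False] @ r"
proof -
  have 1: "double (encode_list encode_attribute (map (\<lambda>_. Quasi_Identifier) (cols vs))) =
    concat (map (\<lambda>a. concat (map (\<lambda>b. double [True, False, True, False]) vs)) vs) @ double [False]"
    by (simp add: encode_list_def encode_attribute_def double_simps o_def concat_map_cols)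
  have 2: "double (encode_list encode_nat (map (\<lambda>c. of_bool (mark arc u c)) (cols vs))) =
      concat (map (\<lambda>a. concat (map (\<lambda>b.
        double (True # encode_nat (of_bool (mark arc u (a, b, False)))) @
        double (True # encode_nat (of_bool (mark arc u (a, b, True))))) vs)) vs) @ double [False]" for u
    unfolding encode_list_def double_simps(3,4) map_map o_def concat_map_cols by simp
  have cons: "encode_list e (y # ys) = (True # e y) @ encode_list e ys" for e :: "'b \<Rightarrow> bool list" and y ys
    by (simp add: encode_list_def)
  have 3: "double (encode_list (encode_list encode_nat)
        (map (\<lambda>u. col u # map (\<lambda>c. of_bool (mark arc u c)) (cols vs)) vs)) =
      concat (map (\<lambda>u. double (True # True # encode_nat (col u)) @
        double (encode_list encode_nat (map (\<lambda>c. of_bool (mark arc u c)) (cols vs)))) vs) @ double [False]"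
    unfolding encode_list_def[of "encode_list encode_nat"] double_simps(3,4) map_map o_def cons
    by (simp add: double_simps)
  have p: "pair v r = double v @ [False] @ r" for v by (simp add: pair_def double_def)
  show ?thesis
    unfolding p encode_database_def graph_db_def fst_conv snd_conv cons double_simps(3) 1 3 2
    by (simp add: encode_attribute_def double_simps)
qed

section \<open>Writing the database with nested loops\<close>

locale torus_family =
  fixes tiles :: "'a list" and cat :: "'a \<Rightarrow> nat" and inn out :: "nat \<Rightarrow> 'a \<Rightarrow> 'c"
    and c0 :: 'c and jl :: "(nat \<times> 'c) list"
    and width :: "bool list \<Rightarrow> nat" and kappa :: "bool list \<Rightarrow> nat \<times> nat \<Rightarrow> nat"
  assumes torus: "torus tiles inn out c0 jl (width x)"
    and calc_width: "calc 1 (\<lambda>x xs. width x)"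
    and calc_kappa: "\<And>d f g. calc d f \<Longrightarrow> calc d g \<Longrightarrow> calc d (\<lambda>x xs. kappa x (f x xs, g x xs))"
begin

sublocale torus tiles cat inn out c0 jl "width x" "kappa x" for x
  by (rule torus)

abbreviation "edge x \<equiv> arc x"
abbreviation "vs x \<equiv> verts x"

lemma calc_width': "0 < d \<Longrightarrow> calc d (\<lambda>x xs. width x)"
  using calc_width unfolding calc_def by auto

lemma dec_nb:
  assumes "calc d f1" "calc d f2" "calc d g1" "calc d g2"
  shows "dec d (\<lambda>x xs. nb (width x) k (f1 x xs, f2 x xs) = (g1 x xs, g2 x xs))"
proof -
  have d: "0 < d" using assms(1) by (rule calc_pos)
  have w: "calc d (\<lambda>x xs. if Suc (f x xs) = width x then 0 else Suc (f x xs))" if "calc d f" for f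
    by (intro calc_dec_if dec_eq calc_Suc that calc_width' calc_const d)
  consider "k = 0" | "k = 1" | "k \<noteq> 0" "k \<noteq> 1" by blast
  then show ?thesis
  proof cases
    case 1
    then have nb: "nb n k (t, i) = (t, i)" for n t i by (simp add: nb.simps)
    show ?thesis unfolding nb prod.inject by (intro dec_and dec_eq assms)
  next
    case 2
    then have nb: "nb n k (t, i) = (t, if Suc i = n then 0 else Suc i)" for n t i
      by (simp add: nb.simps)
    show ?thesis unfolding nb prod.inject by (intro dec_and dec_eq assms w)
  next
    case 3
    then have nb: "nb n k (t, i) = (if Suc t = n then 0 else Suc t, i)" for n t i
      by (simp add: nb.simps)
    show ?thesis unfolding nb prod.inject by (intro dec_and dec_eq assms w)
  qed
qed

lemma dec_el:
  assumes "calc d f1" "calc d f2" "calc d g1" "calc d g2"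
  shows "dec d (\<lambda>x xs. el (width x) inn out T (f1 x xs, f2 x xs) kc = (e, (g1 x xs, g2 x xs)))"
proof -
  obtain k c where kc: "kc = (k, c)" by (cases kc)
  have d: "0 < d" using assms(1) by (rule calc_pos)
  have "dec d (\<lambda>x xs. (k, out k T) = e \<and> nb (width x) k (f1 x xs, f2 x xs) = (g1 x xs, g2 x xs))"
    by (intro dec_and dec_const dec_nb assms d)
  moreover have "dec d (\<lambda>x xs. (k, c) = e \<and> f1 x xs = g1 x xs \<and> f2 x xs = g2 x xs)"
    by (intro dec_and dec_const dec_eq assms d)
  ultimately show ?thesis unfolding kc by (cases "c = inn k T") simp_all
qed

lemma dec_edge:
  assumes "calc d f1" "calc d f2" "calc d g1" "calc d g2"
  shows "dec d (\<lambda>x xs. edge x (g, (f1 x xs, f2 x xs)) (h, (g1 x xs, g2 x xs)))"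
proof -
  have d: "0 < d" using assms(1) by (rule calc_pos)
  show ?thesis
  proof (cases g; cases h)
    fix v e w e' assume g: "g = Ele v e" "h = Ele w e'"
    show ?thesis unfolding g arc.simps prod.inject
      by (intro dec_and dec_const[OF d] dec_eq assms)
  next
    fix v e w T j assume g: "g = Ele v e" "h = Inc w T j"
    show ?thesis unfolding g arc.simps
      by (intro dec_and dec_const[OF d] dec_el dec_eq calc_kappa calc_const[OF d] assms)
  next
    fix v T j w e assume g: "g = Inc v T j" "h = Ele w e"
    show ?thesis unfolding g arc.simps by (intro dec_and dec_const[OF d] dec_el assms)
  next
    fix v T j w T' j' assume g: "g = Inc v T j" "h = Inc w T' j'"
    show ?thesis unfolding g arc.simps prod.inject
      by (intro dec_and dec_const[OF d] dec_eq assms)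
  qed
qed

text \<open>The tags are enumerated by the program text. The two coordinates come from nested loops,
  which push them as variables \<open>d\<close> and \<open>d + 1\<close>.\<close>

lemma gen_verts:
  assumes G: "\<And>g. gen (d + 2) (G g)" and d: "0 < d"
    and F: "\<And>x xs g t i. length xs = d \<Longrightarrow> G g x (xs @ [t, i]) = F x xs (g, (t, i))"
  shows "gen d (\<lambda>x xs. concat (map (F x xs) (vs x)))"
proof (rule gen_cong)
  show "gen d (\<lambda>x xs. concat (map (\<lambda>g. concat (map (\<lambda>t. concat (map (\<lambda>i.
      G g x ((xs @ [t]) @ [i])) (rev [0..<width x]))) (rev [0..<width x]))) tags))"
    using d G by (intro gen_concat_list gen_for[OF calc_width]) simp_all
  show "concat (map (\<lambda>g. concat (map (\<lambda>t. concat (map (\<lambda>i.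
      G g x ((xs @ [t]) @ [i])) (rev [0..<width x]))) (rev [0..<width x]))) tags) =
    concat (map (F x xs) (vs x))" if "length xs = d" for x xs
    using F[OF that] unfolding verts_def concat_map_concat map_map o_def by simp
qed

lemma tag_col_eq: "tag_col (g, p) = (case g of Ele v e \<Rightarrow> v | Inc v T j \<Rightarrow> v)"
  by (cases g) simp_all

text \<open>Seven variables: the input head and two coordinates each for the row vertex and the two
  vertices of the column. The tags are constants of the program.\<close>

lemma gen_entry:
  "gen 7 (\<lambda>x xs. double (True # encode_nat (of_bool
    (mark (edge x) (gu, (xs ! 1, xs ! 2)) ((ga, (xs ! 3, xs ! 4)), (gb, (xs ! 5, xs ! 6)), l)))))"
proof -
  have var: "calc 7 (\<lambda>x xs. xs ! j)" if "0 < j" "j < 7" for j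
    using that by (rule calc_var)
  have e: "dec 7 (\<lambda>x xs. (gu, (xs ! 1, xs ! 2)) = (g, (xs ! i, xs ! j)))"
    if "0 < i" "i < 7" "0 < j" "j < 7" for g i j
    unfolding prod.inject using that by (intro dec_and dec_const dec_eq var) simp_all
  have a: "dec 7 (\<lambda>x xs. adj (edge x) (ga, (xs ! 3, xs ! 4)) (gb, (xs ! 5, xs ! 6)))"
    unfolding adj_def by (intro dec_or dec_edge var) simp_all
  have m: "dec 7 (\<lambda>x xs. mark (edge x) (gu, (xs ! 1, xs ! 2)) ((ga, (xs ! 3, xs ! 4)), (gb, (xs ! 5, xs ! 6)), l))"
  proof (cases l)
    case True
    then show ?thesis unfolding mark_def prod.case
      using dec_and[OF e[of 3 4 ga] dec_not[OF a]] by simp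
  next
    case False
    then show ?thesis unfolding mark_def prod.case
      using dec_or[OF e[of 3 4 ga] dec_and[OF e[of 5 6 gb] a]] by simp
  qed
  have "gen 7 (\<lambda>x xs. if mark (edge x) (gu, (xs ! 1, xs ! 2)) ((ga, (xs ! 3, xs ! 4)), (gb, (xs ! 5, xs ! 6)), l)
      then double (True # encode_nat 1) else double (True # encode_nat 0))"
    by (rule gen_if[OF m _ gen_const gen_const]) simp
  then show ?thesis by (rule gen_cong) simp
qed

definition budget :: "bool list \<Rightarrow> nat" where
  "budget x = length (vs x) * (6 * length (vs x) - 6)"

lemma poly_time_reduction:
  "poly_time (\<lambda>x. pair (encode_database (graph_db (vs x) tag_col (edge x))) (replicate (budget x) True))"
proof (rule gen_poly_time)
  have attr: "gen 1 (\<lambda>x xs. concat (map (\<lambda>a. concat (map (\<lambda>b. w) (vs x))) (vs x)))" for w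
    by (rule gen_verts[where G = "\<lambda>g x xs. concat (map (\<lambda>b. w) (vs x))"],
        rule gen_verts[where G = "\<lambda>g x xs. w"]) (simp_all add: gen_const)
  have b: "gen 5 (\<lambda>x xs. concat (map (\<lambda>b.
        double (True # encode_nat (of_bool (mark (edge x) (gu, (xs ! 1, xs ! 2)) ((ga, (xs ! 3, xs ! 4)), b, False)))) @
        double (True # encode_nat (of_bool (mark (edge x) (gu, (xs ! 1, xs ! 2)) ((ga, (xs ! 3, xs ! 4)), b, True)))))
      (vs x)))" for gu ga
    by (rule gen_verts[where G = "\<lambda>g x xs.
        double (True # encode_nat (of_bool (mark (edge x) (gu, (xs ! 1, xs ! 2)) ((ga, (xs ! 3, xs ! 4)), (g, (xs ! 5, xs ! 6)), False)))) @
        double (True # encode_nat (of_bool (mark (edge x) (gu, (xs ! 1, xs ! 2)) ((ga, (xs ! 3, xs ! 4)), (g, (xs ! 5, xs ! 6)), True))))"])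
      (use gen_append[OF gen_entry gen_entry] in \<open>simp_all add: nth_append\<close>)
  have a: "gen 3 (\<lambda>x xs. concat (map (\<lambda>a. concat (map (\<lambda>b.
        double (True # encode_nat (of_bool (mark (edge x) (gu, (xs ! 1, xs ! 2)) (a, b, False)))) @
        double (True # encode_nat (of_bool (mark (edge x) (gu, (xs ! 1, xs ! 2)) (a, b, True)))))
      (vs x))) (vs x)))" for gu
    by (rule gen_verts[where G = "\<lambda>g x xs. concat (map (\<lambda>b.
        double (True # encode_nat (of_bool (mark (edge x) (gu, (xs ! 1, xs ! 2)) ((g, (xs ! 3, xs ! 4)), b, False)))) @
        double (True # encode_nat (of_bool (mark (edge x) (gu, (xs ! 1, xs ! 2)) ((g, (xs ! 3, xs ! 4)), b, True)))))
      (vs x))"])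
      (use b in \<open>simp_all add: nth_append\<close>)
  have rows: "gen 1 (\<lambda>x xs. concat (map (\<lambda>u. double (True # True # encode_nat (tag_col u)) @
      concat (map (\<lambda>a. concat (map (\<lambda>b.
        double (True # encode_nat (of_bool (mark (edge x) u (a, b, False)))) @
        double (True # encode_nat (of_bool (mark (edge x) u (a, b, True))))) (vs x))) (vs x)) @
      double [False]) (vs x)))"
  proof (rule gen_verts[where G = "\<lambda>g x xs. double (True # True # encode_nat (case g of Ele v e \<Rightarrow> v | Inc v T j \<Rightarrow> v)) @
      concat (map (\<lambda>a. concat (map (\<lambda>b.
        double (True # encode_nat (of_bool (mark (edge x) (g, (xs ! 1, xs ! 2)) (a, b, False)))) @
        double (True # encode_nat (of_bool (mark (edge x) (g, (xs ! 1, xs ! 2)) (a, b, True))))) (vs x))) (vs x)) @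
      double [False]"])
    have 3: "(1 :: nat) + 2 = 3" by simp
    show "gen (1 + 2) (\<lambda>x xs. double (True # True # encode_nat (case g of Ele v e \<Rightarrow> v | Inc v T j \<Rightarrow> v)) @
      concat (map (\<lambda>a. concat (map (\<lambda>b.
        double (True # encode_nat (of_bool (mark (edge x) (g, (xs ! 1, xs ! 2)) (a, b, False)))) @
        double (True # encode_nat (of_bool (mark (edge x) (g, (xs ! 1, xs ! 2)) (a, b, True))))) (vs x))) (vs x)) @
      double [False])" for g
      unfolding 3 by (intro gen_append gen_const a)
  qed (simp_all add: nth_append tag_col_eq)
  have "calc 1 (\<lambda>x xs. length (vs x))"
    unfolding length_verts by (intro calc_mult calc_width calc_const) simp
  then have "calc 1 (\<lambda>x xs. budget x)"
    unfolding budget_def by (intro calc_mult calc_diff calc_const) simp_all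
  then have r: "gen 1 (\<lambda>x xs. replicate (budget x) True)" by (rule gen_replicate) simp
  show "gen 1 (\<lambda>x xs. pair (encode_database (graph_db (vs x) tag_col (edge x))) (replicate (budget x) True))"
    unfolding encode_graph_db by (intro gen_append gen_const attr rows r)
qed

end

context verifier
begin

definition width :: "bool list \<Rightarrow> nat" where
  "width x = 2 * half x"

lemma calc_cert: "0 < d \<Longrightarrow> calc d (\<lambda>x xs. cert x)"
  unfolding cert_def by (intro calc_poly calc_length)

lemma calc_width: "0 < d \<Longrightarrow> calc d (\<lambda>x xs. width x)"
  unfolding width_def half_def time_def
  by (intro calc_mult calc_add calc_poly calc_length calc_cert calc_const)

lemma calc_category:
  assumes "calc d f" "calc d g"
  shows "calc d (\<lambda>x xs. category x (cert x) (width x) (f x xs, g x xs))"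
proof -
  have d: "0 < d" using assms(1) by (rule calc_pos)
  show ?thesis
    unfolding category.simps init_sym_def
    by (intro calc_dec_if dec_eq dec_less dec_le calc_add calc_mult calc_half calc_symbol calc_Suc
        calc_length calc_cert calc_width calc_const assms d)
qed

lemma reduction:
  "\<exists>f. poly_time f \<and> (\<forall>x. \<exists>i\<in>binary_ternary_databases. \<exists>k.
     f x = pair (encode_database i) (replicate k True) \<and>
     (x \<in> A \<longleftrightarrow> (\<exists>y. optimal_solution (diverse_solution 3) star_cost i y \<and> star_cost i y \<le> k)))"
proof -
  obtain tiles where tiles: "set tiles = {T. tile_ok M T}" "distinct tiles"
    using finite_distinct_list[OF finite_tiles] by blast
  \<comment> \<open>All colours that occur in the directions \<open>1\<close> and \<open>2\<close>,
    and for direction \<open>0\<close> the single colour \<open>Trivial\<close>.\<close>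
  let ?J = "insert (0, Trivial) ((\<lambda>(k, T). (k, colour_in k T)) ` ({1, 2} \<times> set tiles) \<union>
    (\<lambda>(k, T). (k, colour_out M k T)) ` ({1, 2} \<times> set tiles))"
  have "finite ?J" by simp
  then obtain jl where jl: "set jl = ?J" "distinct jl" using finite_distinct_list by blast
  interpret F: torus_family tiles t_cat colour_in "colour_out M" Trivial jl width
    "\<lambda>x. category x (cert x) (width x)"
  proof
    fix x :: "bool list" and k c T
    show "distinct tiles" "distinct jl" using tiles jl by auto
    show "2 \<le> width x" by (simp add: width_def half_def)
    show "k < 3" if "(k, c) \<in> set jl" using that unfolding jl by auto
    show "(0, c) \<in> set jl \<longleftrightarrow> c = Trivial" unfolding jl by auto
    show "(k, colour_in k T) \<in> set jl \<and> (k, colour_out M k T) \<in> set jl"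
      if "T \<in> set tiles" "k < 3"
    proof -
      have "k = 0 \<or> k = 1 \<or> k = 2" using that by auto
      then show ?thesis
      proof (elim disjE)
        assume "k = 0"
        then show ?thesis unfolding jl by (simp add: colour_in_def colour_out_def)
      qed (use that(1) in \<open>auto simp: jl intro!: image_eqI[of _ _ "(k, T)"]\<close>)
    qed
    show "calc 1 (\<lambda>x xs. width x)" by (rule calc_width) simp
  qed (rule calc_category)
  have tiling: "(\<exists>\<tau>. F.tiling x \<tau>) \<longleftrightarrow> x \<in> A" for x
  proof -
    have "F.tiling x \<tau> \<longleftrightarrow> row_tiling x \<tau>" for \<tau>
      unfolding F.tiling_def row_tiling_def tiles(1) width_def[symmetric]
      by (auto simp: F.nb_eq simp del: category.simps)
    then show ?thesis using row_tiling_iff by simp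
  qed
  show ?thesis
  proof (intro exI conjI allI)
    show "poly_time (\<lambda>x. pair (encode_database (graph_db (F.verts x) tag_col (F.arc x)))
        (replicate (F.budget x) True))"
      by (rule F.poly_time_reduction)
    fix x
    interpret G: rainbow_graph "F.verts x" tag_col "F.arc x" by (rule F.rainbow)
    show "\<exists>i\<in>binary_ternary_databases. \<exists>k.
        pair (encode_database (graph_db (F.verts x) tag_col (F.arc x))) (replicate (F.budget x) True) =
          pair (encode_database i) (replicate k True) \<and>
        (x \<in> A \<longleftrightarrow> (\<exists>y. optimal_solution (diverse_solution 3) star_cost i y \<and> star_cost i y \<le> k))"
      using G.graph_db_legal G.budget_iff_partition F.partition_iff_tiling[of x] tiling[of x]
      unfolding F.budget_def by blast
  qed
qed

end

theorem theorem7: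
  shows "np_hard_minimization encode_database binary_ternary_databases
           (diverse_solution 3) star_cost"
  unfolding np_hard_minimization_def
proof
  fix A assume "A \<in> class_NP"
  then obtain V p where V: "V \<in> class_P"
    and A: "\<And>x. x \<in> A \<longleftrightarrow> (\<exists>y. length y \<le> poly p (length x) \<and> pair x y \<in> V)"
    unfolding class_NP_def by blast
  then obtain M pt where "wf_tm M" "computes_in_time M (\<lambda>w. [w \<in> V]) (poly pt)"
    unfolding class_P_def poly_time_def by blast
  then interpret verifier M pt p V A
    using A by unfold_locales
  show "\<exists>f. poly_time f \<and> (\<forall>x. \<exists>i\<in>binary_ternary_databases. \<exists>k.
     f x = pair (encode_database i) (replicate k True) \<and>
     (x \<in> A \<longleftrightarrow> (\<exists>y. optimal_solution (diverse_solution 3) star_cost i y \<and> star_cost i y \<le> k)))"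
    by (rule reduction)
qed

end
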